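(* Let $n\ge 1$ and for $1\le i\le n$ let $G_i$ be a group with a finite inverse-closed generating set $A_i$. Let $\Lambda$ be a finite simplicial graph (no loops or multiple edges) with vertices $v_1,\dots,v_n$, where $v_i$ is labeled by the group $G_i$, let $G\Lambda$ be the associated graph product, and let $A:=\bigcup_{i=1}^n A_i$. Then: (1) if each $G_i$ is autostackable over $A_i$, then $G\Lambda$ is autostackable over $A$; (2) if each $G_i$ is stackable over $A_i$, then $G\Lambda$ is stackable over $A$; (3) if each $G_i$ is algorithmically stackable over $A_i$, then $G\Lambda$ is algorithmically stackable over $A$.
   Context: Graph product: $G\Lambda$ is the quotient of the free product of the groups $G_i$ by the relations that elements of $G_i$ and $G_j$ commute whenever $v_i$ and $v_j$ are adjacent in $\Lambda$. Each $G_i$ embeds in $G\Lambda$, and the sets $A_i$ are regarded as (disjoint) subsets of $G\Lambda$. Conventions. All generating sets are finite and inverse-closed; no element of a generating set represents the identity, and distinct elements represent distinct group elements. $A^*$ is the set of all finite words over $A$; for $a\in A$, $a^{-1}$ denotes the letter of $A$ representing the inverse of $a$. Flow functions. Let $G$ be a group with finite inverse-closed generating set $A$ and Cayley graph $\Gamma=\Gamma(G,A)$. Let $\vec E$ be the set of directed edges and $\vec P$ the set of directed edge paths of $\Gamma$. For $g\in G$, $a\in A$, $e_{g,a}$ is the directed edge from $g$ to $ga$ labeled $a$; the directed edges $e_{g,a}$ and $e_{ga,a^{-1}}$ have the same underlying undirected edge. A flow function associated to a maximal tree $\mathcal T$ in $\Gamma$ is a function $\Phi:\vec E\to\vec P$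 such that: (F1) for each $e\in\vec E$, the path $\Phi(e)$ has the same initial and terminal vertices as $e$; (F2d) if the undirected edge underlying $e$ lies in $\mathcal T$, then $\Phi(e)=e$; (F2r) the transitive closure $<_\Phi$ of the relation $<$ on $\vec E$, defined by $e'<e$ whenever $e'$ lies on the path $\Phi(e)$ and the undirected edges underlying both $e$ and $e'$ do not lie in $\mathcal T$, is a well-founded strict partial ordering. $\Phi$ is bounded if there is a constant $k$ such that for all $e\in\vec E$ the path $\Phi(e)$ has length at most $k$. Stacking map. For $g\in G$ let $y_g\in A^*$ be the label of the unique path without backtracking in $\mathcal T$ from the identity to $g$, and let $\mathcal N=\{y_g\mid g\in G\}$. The stacking map of $\Phi$ is $\phi:\mathcal N\times A\to A^*$, where $\phi(y_g,a)$ is the word labeling the path $\Phi(e_{g,a})$. Its graph is $graph(\phi)=\{(y_g,a,\phi(y_g,a))\mid g\in G,\ a\in A\}\subseteq (A^* )^3$. Definitions. $G$ is stackable over $A$ if there is a bounded flow function on a maximal tree in $\Gamma(G,A)$. $G$ is algorithmically stackable over $A$ if it has a bounded flow function for which $graph(\phi)$ is computable (a decidable set). $G$ is autostackable over $A$ if it has a bounded flow function for which $graph(\phi)$ is synchronously regular. Synchronously regular languages. Let $\$\notin A$ and let $A_n=(A\cup\{\$\})^n\setminus\{(\$,\dots,\$)\}$. For $u=(u_1,\dots,u_n)\in(A^* )^n$, append symbols $\$$ at the end of each $u_i$ to make all components have length $M=\max_i \ell(u_i)$, and let $\mu(u)\in A_n^*$ be the word of length $M$ whose $m$-th letter is the $n$-tuple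 of $m$-th letters of the padded components. A subset $L\subseteq(A^* )^n$ is synchronously regular if $\{\mu(u)\mid u\in L\}$ is a regular language over $A_n$. *)

theory Defs
  imports
    "HOL-Algebra.Generated_Groups"
    "HOL-Library.Nat_Bijection"
    "Graph_Theory.Digraph_Component"
begin

section \<open>Graph products\<close>

definition syllable_words :: "'i set \<Rightarrow> ('i \<Rightarrow> ('a, 'm) monoid_scheme) \<Rightarrow> ('i \<times> 'a) list set" where
  "syllable_words I G = lists (SIGMA i:I. carrier (G i))"

inductive_set free_product_rel ::
    "'i set \<Rightarrow> ('i \<Rightarrow> ('a, 'm) monoid_scheme) \<Rightarrow> (('i \<times> 'a) list \<times> ('i \<times> 'a) list) set"
  for I :: "'i set" and G :: "'i \<Rightarrow> ('a, 'm) monoid_scheme" where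
  refl: "w \<in> syllable_words I G \<Longrightarrow> (w, w) \<in> free_product_rel I G"
| sym: "(v, w) \<in> free_product_rel I G \<Longrightarrow> (w, v) \<in> free_product_rel I G"
| trans: "(u, v) \<in> free_product_rel I G \<Longrightarrow> (v, w) \<in> free_product_rel I G
    \<Longrightarrow> (u, w) \<in> free_product_rel I G"
| one: "u \<in> syllable_words I G \<Longrightarrow> v \<in> syllable_words I G \<Longrightarrow> i \<in> I
    \<Longrightarrow> (u @ [(i, \<one>\<^bsub>G i\<^esub>)] @ v, u @ v) \<in> free_product_rel I G"
| mult: "u \<in> syllable_words I G \<Longrightarrow> v \<in> syllable_words I G \<Longrightarrow> i \<in> I
    \<Longrightarrow> g \<in> carrier (G i) \<Longrightarrow> h \<in> carrier (G i)
    \<Longrightarrow> (u @ [(i, g), (i, h)] @ v, u @ [(i, g \<otimes>\<^bsub>G i\<^esub> h)] @ v) \<in> free_product_rel I G"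

definition free_product ::
    "'i set \<Rightarrow> ('i \<Rightarrow> ('a, 'm) monoid_scheme) \<Rightarrow> ('i \<times> 'a) list set monoid" where
  "free_product I G =
    \<lparr>carrier = syllable_words I G // free_product_rel I G,
     monoid.mult = (\<lambda>P Q. \<Union>x\<in>P. \<Union>y\<in>Q. free_product_rel I G `` {x @ y}),
     one = free_product_rel I G `` {[]}\<rparr>"

definition free_product_incl ::
    "'i set \<Rightarrow> ('i \<Rightarrow> ('a, 'm) monoid_scheme) \<Rightarrow> 'i \<Rightarrow> 'a \<Rightarrow> ('i \<times> 'a) list set" where
  "free_product_incl I G i g = free_product_rel I G `` {[(i, g)]}"

definition normal_closure :: "('a, 'm) monoid_scheme \<Rightarrow> 'a set \<Rightarrow> 'a set" where
  "normal_closure G S = \<Inter>{N. N \<lhd> G \<and> S \<subseteq> N}"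

definition graph_product_relators ::
    "'i set \<Rightarrow> 'i set set \<Rightarrow> ('i \<Rightarrow> ('a, 'm) monoid_scheme) \<Rightarrow> ('i \<times> 'a) list set set" where
  "graph_product_relators V E G =
    (let F = free_product V G; \<iota> = free_product_incl V G in
      {\<iota> i g \<otimes>\<^bsub>F\<^esub> \<iota> j h \<otimes>\<^bsub>F\<^esub> inv\<^bsub>F\<^esub> (\<iota> i g) \<otimes>\<^bsub>F\<^esub> inv\<^bsub>F\<^esub> (\<iota> j h) | i j g h.
        i \<in> V \<and> j \<in> V \<and> {i, j} \<in> E \<and> g \<in> carrier (G i) \<and> h \<in> carrier (G j)})"

definition graph_product ::
    "'i set \<Rightarrow> 'i set set \<Rightarrow> ('i \<Rightarrow> ('a, 'm) monoid_scheme) \<Rightarrow> ('i \<times> 'a) list set set monoid" where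
  "graph_product V E G =
    free_product V G Mod normal_closure (free_product V G) (graph_product_relators V E G)"

definition graph_product_incl ::
    "'i set \<Rightarrow> 'i set set \<Rightarrow> ('i \<Rightarrow> ('a, 'm) monoid_scheme) \<Rightarrow> 'i \<Rightarrow> 'a
      \<Rightarrow> ('i \<times> 'a) list set set" where
  "graph_product_incl V E G i g =
    normal_closure (free_product V G) (graph_product_relators V E G)
      #>\<^bsub>free_product V G\<^esub> free_product_incl V G i g"

section \<open>Finite generating sets and Cayley graphs\<close>

text \<open>A generating set is a set of group elements, so that distinct letters automatically
  represent distinct elements and the letter for the inverse of \<open>a\<close> is \<open>inv a\<close>.\<close>

locale generated_group = group G for G (structure) +
  fixes A :: "'a set"
  assumes finite_gens: "finite A"
    and gens_closed: "A \<subseteq> carrier G"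
    and one_notin_gens: "\<one> \<notin> A"
    and inv_gens: "a \<in> A \<Longrightarrow> inv a \<in> A"
    and generates: "generate G A = carrier G"

text \<open>The directed edge from \<open>g\<close> to \<open>g \<otimes> a\<close> labelled \<open>a\<close> is the pair \<open>(g, a)\<close>.\<close>

definition cayley_graph ::
    "('a, 'm) monoid_scheme \<Rightarrow> 'a set \<Rightarrow> ('a, 'a \<times> 'a) pre_digraph" where
  "cayley_graph G A =
    \<lparr>verts = carrier G, arcs = carrier G \<times> A, tail = fst, head = (\<lambda>(g, a). g \<otimes>\<^bsub>G\<^esub> a)\<rparr>"

definition reverse_edge :: "('a, 'm) monoid_scheme \<Rightarrow> 'a \<times> 'a \<Rightarrow> 'a \<times> 'a" where
  "reverse_edge G = (\<lambda>(g, a). (g \<otimes>\<^bsub>G\<^esub> a, inv\<^bsub>G\<^esub> a))"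

definition undirected_edge :: "('a, 'm) monoid_scheme \<Rightarrow> 'a \<times> 'a \<Rightarrow> ('a \<times> 'a) set" where
  "undirected_edge G e = {e, reverse_edge G e}"

definition no_backtracking :: "('a, 'm) monoid_scheme \<Rightarrow> ('a \<times> 'a) list \<Rightarrow> bool" where
  "no_backtracking G p \<longleftrightarrow> (\<forall>i. Suc i < length p \<longrightarrow> p ! Suc i \<noteq> reverse_edge G (p ! i))"

text \<open>The spanning subgraph of the Cayley graph with set \<open>T\<close> of undirected edges.\<close>

definition edge_subgraph ::
    "('a, 'm) monoid_scheme \<Rightarrow> 'a set \<Rightarrow> ('a \<times> 'a) set set \<Rightarrow> ('a, 'a \<times> 'a) pre_digraph" where
  "edge_subgraph G A T =
    (cayley_graph G A)\<lparr>arcs := {e \<in> arcs (cayley_graph G A). undirected_edge G e \<in> T}\<rparr>"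

text \<open>The library predicates \<^const>\<open>forest\<close> and \<^const>\<open>tree\<close> only exclude directed cycles
  and regard an edge followed by its reverse as one, so they do not express trees of
  undirected graphs. A maximal tree is connected, has no cycles without backtracking, and
  contains all vertices.\<close>

definition maximal_tree ::
    "('a, 'm) monoid_scheme \<Rightarrow> 'a set \<Rightarrow> ('a \<times> 'a) set set \<Rightarrow> bool" where
  "maximal_tree G A T \<longleftrightarrow>
    T \<subseteq> undirected_edge G ` arcs (cayley_graph G A) \<and>
    strongly_connected (edge_subgraph G A T) \<and>
    \<not> (\<exists>p. pre_digraph.cycle (edge_subgraph G A T) p \<and> no_backtracking G p)"

section \<open>Flow functions and the stacking map\<close>

definition flow_order ::
    "('a, 'm) monoid_scheme \<Rightarrow> 'a set \<Rightarrow> ('a \<times> 'a) set set \<Rightarrow> ('a \<times> 'a \<Rightarrow> ('a \<times> 'a) list)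
      \<Rightarrow> (('a \<times> 'a) \<times> ('a \<times> 'a)) set" where
  "flow_order G A T \<Phi> =
    {(e', e). e \<in> arcs (cayley_graph G A) \<and> e' \<in> arcs (cayley_graph G A) \<and> e' \<in> set (\<Phi> e) \<and>
      undirected_edge G e \<notin> T \<and> undirected_edge G e' \<notin> T}\<^sup>+"

definition flow_function ::
    "('a, 'm) monoid_scheme \<Rightarrow> 'a set \<Rightarrow> ('a \<times> 'a) set set \<Rightarrow> ('a \<times> 'a \<Rightarrow> ('a \<times> 'a) list) \<Rightarrow> bool"
  where
  "flow_function G A T \<Phi> \<longleftrightarrow>
    maximal_tree G A T \<and>
    (\<forall>e\<in>arcs (cayley_graph G A).
      pre_digraph.awalk (cayley_graph G A)
        (tail (cayley_graph G A) e) (\<Phi> e) (head (cayley_graph G A) e)) \<and>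
    (\<forall>e\<in>arcs (cayley_graph G A). undirected_edge G e \<in> T \<longrightarrow> \<Phi> e = [e]) \<and>
    irrefl (flow_order G A T \<Phi>) \<and> trans (flow_order G A T \<Phi>) \<and> wf (flow_order G A T \<Phi>)"

definition bounded_flow_function ::
    "('a, 'm) monoid_scheme \<Rightarrow> 'a set \<Rightarrow> ('a \<times> 'a) set set \<Rightarrow> ('a \<times> 'a \<Rightarrow> ('a \<times> 'a) list) \<Rightarrow> bool"
  where
  "bounded_flow_function G A T \<Phi> \<longleftrightarrow>
    flow_function G A T \<Phi> \<and> (\<exists>k. \<forall>e\<in>arcs (cayley_graph G A). length (\<Phi> e) \<le> k)"

definition tree_word ::
    "('a, 'm) monoid_scheme \<Rightarrow> 'a set \<Rightarrow> ('a \<times> 'a) set set \<Rightarrow> 'a \<Rightarrow> 'a list" where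
  "tree_word G A T g =
    map snd (THE p. pre_digraph.awalk (edge_subgraph G A T) \<one>\<^bsub>G\<^esub> p g \<and> no_backtracking G p)"

text \<open>A tuple of words is a list of words. The third component is the value of the stacking
  map at \<open>(tree_word G A T g, a)\<close>.\<close>

definition stacking_graph ::
    "('a, 'm) monoid_scheme \<Rightarrow> 'a set \<Rightarrow> ('a \<times> 'a) set set \<Rightarrow> ('a \<times> 'a \<Rightarrow> ('a \<times> 'a) list)
      \<Rightarrow> 'a list list set" where
  "stacking_graph G A T \<Phi> =
    {[tree_word G A T g, [a], map snd (\<Phi> (g, a))] | g a. g \<in> carrier G \<and> a \<in> A}"

section \<open>Synchronously regular languages\<close>

definition regular_language :: "'b set \<Rightarrow> 'b list set \<Rightarrow> bool" where
  "regular_language \<Sigma> L \<longleftrightarrow>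
    (\<exists>(Q :: nat set) q\<^sub>0 F \<delta>. finite Q \<and> q\<^sub>0 \<in> Q \<and> F \<subseteq> Q \<and> (\<forall>q\<in>Q. \<forall>x\<in>\<Sigma>. \<delta> q x \<in> Q) \<and>
      L = {w \<in> lists \<Sigma>. foldl \<delta> q\<^sub>0 w \<in> F})"

text \<open>The padding symbol is \<^const>\<open>None\<close>.\<close>

definition padded_alphabet :: "nat \<Rightarrow> 'a set \<Rightarrow> 'a option list set" where
  "padded_alphabet n A =
    {x. length x = n \<and> set x \<subseteq> insert None (Some ` A)} - {replicate n None}"

definition pad_word :: "'a list list \<Rightarrow> 'a option list list" where
  "pad_word us =
    map (\<lambda>m. map (\<lambda>u. if m < length u then Some (u ! m) else None) us)
      [0..<Max (length ` set us)]"

definition synchronously_regular :: "nat \<Rightarrow> 'a set \<Rightarrow> 'a list list set \<Rightarrow> bool" where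
  "synchronously_regular n A L \<longleftrightarrow> regular_language (padded_alphabet n A) (pad_word ` L)"

section \<open>Decidable sets of tuples of words\<close>

text \<open>\<open>recursive_fun n f\<close>: the total function \<open>f\<close> on \<open>n\<close>-tuples of natural numbers is
  recursive. Tuples are lists of length \<open>n\<close>; rule \<open>ext\<close> says that the values of \<open>f\<close> on
  lists of other lengths are irrelevant. Minimization is only applied to regular functions.\<close>

inductive recursive_fun :: "nat \<Rightarrow> (nat list \<Rightarrow> nat) \<Rightarrow> bool" where
  zero: "recursive_fun n (\<lambda>xs. 0)"
| suc: "recursive_fun 1 (\<lambda>xs. Suc (hd xs))"
| proj: "i < n \<Longrightarrow> recursive_fun n (\<lambda>xs. xs ! i)"
| comp: "recursive_fun (length gs) f \<Longrightarrow> (\<forall>g\<in>set gs. recursive_fun n g)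
    \<Longrightarrow> recursive_fun n (\<lambda>xs. f (map (\<lambda>g. g xs) gs))"
| prim_rec: "recursive_fun n f \<Longrightarrow> recursive_fun (Suc (Suc n)) g
    \<Longrightarrow> recursive_fun (Suc n) (\<lambda>xs. rec_nat (f (tl xs)) (\<lambda>k r. g (k # r # tl xs)) (hd xs))"
| minimize: "recursive_fun (Suc n) f \<Longrightarrow> (\<forall>xs. length xs = n \<longrightarrow> (\<exists>k. f (k # xs) = 0))
    \<Longrightarrow> recursive_fun n (\<lambda>xs. LEAST k. f (k # xs) = 0)"
| ext: "recursive_fun n f \<Longrightarrow> (\<forall>xs. length xs = n \<longrightarrow> g xs = f xs) \<Longrightarrow> recursive_fun n g"

text \<open>Words over the finite alphabet \<open>A\<close> are coded by natural numbers after an arbitrary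
  numbering \<open>c\<close> of the letters. As \<open>A\<close> is finite, the choice of \<open>c\<close> is irrelevant.\<close>

definition decidable_tuples :: "nat \<Rightarrow> 'a set \<Rightarrow> 'a list list set \<Rightarrow> bool" where
  "decidable_tuples n A L \<longleftrightarrow>
    (\<exists>(c :: 'a \<Rightarrow> nat) f. inj_on c A \<and> recursive_fun n f \<and>
      (\<forall>us. length us = n \<and> set us \<subseteq> lists A \<longrightarrow>
        f (map (\<lambda>u. list_encode (map c u)) us) = (if us \<in> L then 1 else 0)))"

section \<open>Stackable, algorithmically stackable and autostackable groups\<close>

definition stackable :: "('a, 'm) monoid_scheme \<Rightarrow> 'a set \<Rightarrow> bool" where
  "stackable G A \<longleftrightarrow> generated_group G A \<and> (\<exists>T \<Phi>. bounded_flow_function G A T \<Phi>)"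

definition algorithmically_stackable :: "('a, 'm) monoid_scheme \<Rightarrow> 'a set \<Rightarrow> bool" where
  "algorithmically_stackable G A \<longleftrightarrow> generated_group G A \<and>
    (\<exists>T \<Phi>. bounded_flow_function G A T \<Phi> \<and> decidable_tuples 3 A (stacking_graph G A T \<Phi>))"

definition autostackable :: "('a, 'm) monoid_scheme \<Rightarrow> 'a set \<Rightarrow> bool" where
  "autostackable G A \<longleftrightarrow> generated_group G A \<and>
    (\<exists>T \<Phi>. bounded_flow_function G A T \<Phi> \<and> synchronously_regular 3 A (stacking_graph G A T \<Phi>))"

end

theory Submission
  imports Defs
begin

text \<open>
  In the Cayley graph of a group, the labels of the paths of a maximal tree that start at the
  identity form a prefix-closed set of words with one word for each group element, and every
  such set of words belongs to exactly one maximal tree (\<open>tree_edge_tree_word\<close>,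
  \<open>maximal_tree_nf_tree\<close>, \<open>tree_word_nf_tree\<close>). A bounded flow function is therefore the same
  as a prefix-closed normal form \<open>y\<close> together with words \<open>\<phi> g a\<close> that label the paths of the flow;
  such a pair is called a stacking below.

  An element of a graph product is written as a product of syllables from the vertex groups.
  Syllables of adjacent vertices may be exchanged, and the normal words are those reduced words
  in which no exchange can move a syllable of a smaller vertex to the left. Whether a syllable may
  be appended to a normal word depends only on a set of forbidden vertices that is updated
  syllable by syllable. Right multiplication by a syllable can be carried out on normal words, and
  this yields an action of the whole graph product (\<open>act_act\<close>, \<open>act_commute\<close>); hence every element
  has exactly one normal word.

  The normal form of the graph product spells every syllable by the normal form of its vertex
  group. An edge at \<open>x\<close> whose label \<open>a\<close> belongs to the vertex \<open>j\<close> is of one of two kinds. If the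
  normal word of \<open>x\<close> ends in a syllable at \<open>j\<close>, or if a syllable at \<open>j\<close> may be appended to it, then
  the edge lies in a translate of the Cayley graph of that vertex group, in which the
  tree is the translate of the tree of the vertex group, and the flow is translated as well.
  Otherwise \<open>a\<close> commutes with the last letter \<open>c\<close> of the normal form of \<open>x\<close>, and the flow follows the
  path labelled \<open>c\<inverse> a c\<close>: its outer edges lie in the tree, and its middle edge starts one
  letter closer to the identity. Edges of the second kind can thus be replaced only finitely often
  before an edge of the first kind is reached, where the flow of a vertex group takes over
  (\<open>wf_product_flow\<close>). This proves the statement on stackable groups.

  As the flow is bounded, the graph of the stacking map is a finite union of sets
  \<open>L \<times> {a} \<times> {x}\<close> with a fixed letter \<open>a\<close> and a fixed word \<open>x\<close>, and it is regular or decidable if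
  and only if all the slices \<open>L\<close> are. A slice of the graph product is recognized by reading a word
  letter by letter while keeping the set of forbidden vertices, the vertex of the current syllable
  and the part of this syllable that has been read (\<open>read_word_eq_Some\<close>, \<open>product_slice\<close>). If the
  slices of the vertex groups are regular, the part of the syllable may be replaced by its class
  under a right congruence of finite index (\<open>regular_product_slice\<close>); if they are decidable, the same
  reading process is a recursive function on codes (\<open>computable_read_word\<close>).
\<close>

section \<open>Maximal trees and prefix-closed normal forms\<close>

primrec path_from :: "('a, 'm) monoid_scheme \<Rightarrow> 'a \<Rightarrow> 'a list \<Rightarrow> ('a \<times> 'a) list" where
  "path_from G g [] = []"
| "path_from G g (a # w) = (g, a) # path_from G (g \<otimes>\<^bsub>G\<^esub> a) w"

definition path_end :: "('a, 'm) monoid_scheme \<Rightarrow> 'a \<Rightarrow> 'a list \<Rightarrow> 'a" where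
  "path_end G g w = foldl (\<otimes>\<^bsub>G\<^esub>) g w"

abbreviation word_value :: "('a, 'm) monoid_scheme \<Rightarrow> 'a list \<Rightarrow> 'a" where
  "word_value G \<equiv> path_end G \<one>\<^bsub>G\<^esub>"

definition reduced :: "('a, 'm) monoid_scheme \<Rightarrow> 'a list \<Rightarrow> bool" where
  "reduced G w \<longleftrightarrow> successively (\<lambda>a b. b \<noteq> inv\<^bsub>G\<^esub> a) w"

definition inverse_word :: "('a, 'm) monoid_scheme \<Rightarrow> 'a list \<Rightarrow> 'a list" where
  "inverse_word G w = rev (map (\<lambda>a. inv\<^bsub>G\<^esub> a) w)"

definition prefix_closed_nf :: "('a, 'm) monoid_scheme \<Rightarrow> 'a set \<Rightarrow> ('a \<Rightarrow> 'a list) \<Rightarrow> bool" where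
  "prefix_closed_nf G A y \<longleftrightarrow>
    (\<forall>g\<in>carrier G. y g \<in> lists A \<and> word_value G (y g) = g \<and>
      (\<forall>u a. y g = u @ [a] \<longrightarrow> y (word_value G u) = u))"

definition tree_edge :: "('a, 'm) monoid_scheme \<Rightarrow> ('a \<Rightarrow> 'a list) \<Rightarrow> 'a \<Rightarrow> 'a \<Rightarrow> bool" where
  "tree_edge G y g a \<longleftrightarrow>
    y (g \<otimes>\<^bsub>G\<^esub> a) = y g @ [a] \<or> y g = y (g \<otimes>\<^bsub>G\<^esub> a) @ [inv\<^bsub>G\<^esub> a]"

lemma path_end_simps [simp]:
  "path_end G g [] = g"
  "path_end G g (a # w) = path_end G (g \<otimes>\<^bsub>G\<^esub> a) w"
  "path_end G g (u @ v) = path_end G (path_end G g u) v"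
  by (simp_all add: path_end_def)

lemma path_from_append: "path_from G g (u @ v) = path_from G g u @ path_from G (path_end G g u) v"
  by (induction u arbitrary: g) auto

lemma map_snd_path_from [simp]: "map snd (path_from G g w) = w"
  by (induction w arbitrary: g) auto

lemma length_path_from [simp]: "length (path_from G g w) = length w"
  by (induction w arbitrary: g) auto

lemma not_successively_split:
  "\<not> successively P w \<Longrightarrow> \<exists>u a b v. w = u @ a # b # v \<and> \<not> P a b"
proof (induction P w rule: successively.induct)
  case (3 P a b w)
  show ?case
  proof (cases "P a b")
    case True
    then obtain u c d v where "b # w = u @ c # d # v" "\<not> P c d" using 3 by auto
    then show ?thesis by (intro exI[of _ "a # u"]) auto
  qed (rule exI[of _ "[]"], auto)
qed auto

context generated_group begin

lemma gens_carrier: "a \<in> A \<Longrightarrow> a \<in> carrier G"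
  using gens_closed by auto

lemma path_end_carrier [simp]: "g \<in> carrier G \<Longrightarrow> w \<in> lists A \<Longrightarrow> path_end G g w \<in> carrier G"
  by (induction w arbitrary: g) (auto simp: gens_carrier)

lemma path_end_word_value:
  "g \<in> carrier G \<Longrightarrow> w \<in> lists A \<Longrightarrow> path_end G g w = g \<otimes> word_value G w"
proof (induction w arbitrary: g)
  case (Cons a w)
  then have a: "a \<in> carrier G" "w \<in> lists A" by (auto simp: gens_carrier)
  then show ?case using Cons.IH[of "g \<otimes> a"] Cons.IH[of a] Cons.prems by (simp add: m_assoc)
qed auto

lemma set_path_from:
  "g \<in> carrier G \<Longrightarrow> w \<in> lists A \<Longrightarrow> set (path_from G g w) \<subseteq> carrier G \<times> A"
  by (induction w arbitrary: g) (auto simp: gens_carrier)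

lemma reverse_edge_reverse_edge:
  "g \<in> carrier G \<Longrightarrow> a \<in> A \<Longrightarrow> reverse_edge G (g \<otimes> a, inv a) = (g, a)"
  by (simp add: reverse_edge_def gens_carrier m_assoc)

lemma undirected_edge_reverse:
  "g \<in> carrier G \<Longrightarrow> a \<in> A \<Longrightarrow> undirected_edge G (g \<otimes> a, inv a) = undirected_edge G (g, a)"
  using reverse_edge_reverse_edge[of g a] by (auto simp: undirected_edge_def reverse_edge_def)

lemma path_end_inverse_word:
  "g \<in> carrier G \<Longrightarrow> w \<in> lists A \<Longrightarrow> path_end G (path_end G g w) (inverse_word G w) = g"
  by (induction w arbitrary: g) (auto simp: inverse_word_def gens_carrier m_assoc)

lemma no_backtracking_path_from:
  "g \<in> carrier G \<Longrightarrow> w \<in> lists A \<Longrightarrow> no_backtracking G (path_from G g w) \<longleftrightarrow> reduced G w"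
proof -
  have *: "no_backtracking G p \<longleftrightarrow> successively (\<lambda>e f. f \<noteq> reverse_edge G e) p" for p
    by (auto simp: no_backtracking_def successively_conv_nth)
  show "g \<in> carrier G \<Longrightarrow> w \<in> lists A \<Longrightarrow> no_backtracking G (path_from G g w) \<longleftrightarrow> reduced G w"
    unfolding * reduced_def
  proof (induction w arbitrary: g)
    case (Cons a w)
    have c: "g \<otimes> a \<in> carrier G" "w \<in> lists A" using Cons.prems by (auto simp: gens_carrier)
    show ?case using Cons.IH[OF c] by (cases w) (auto simp: reverse_edge_def)
  qed auto
qed

definition tree_path :: "('a \<times> 'a) set set \<Rightarrow> 'a \<Rightarrow> 'a list \<Rightarrow> bool" where
  "tree_path T g w \<longleftrightarrow> w \<in> lists A \<and> (\<forall>e\<in>set (path_from G g w). undirected_edge G e \<in> T)"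

lemma tree_path_simps [simp]:
  "tree_path T g []"
  "tree_path T g (a # w) \<longleftrightarrow> a \<in> A \<and> undirected_edge G (g, a) \<in> T \<and> tree_path T (g \<otimes> a) w"
  "tree_path T g (u @ v) \<longleftrightarrow> tree_path T g u \<and> tree_path T (path_end G g u) v"
  by (auto simp: tree_path_def path_from_append)

lemma tree_path_lists: "tree_path T g w \<Longrightarrow> w \<in> lists A"
  by (simp add: tree_path_def)

lemma tree_path_inverse_word:
  "g \<in> carrier G \<Longrightarrow> tree_path T g w \<Longrightarrow> tree_path T (path_end G g w) (inverse_word G w)"
proof (induction w arbitrary: g)
  case (Cons a w)
  then have c: "a \<in> A" "a \<in> carrier G" "w \<in> lists A" "g \<otimes> a \<in> carrier G"
    by (auto simp: gens_carrier tree_path_def)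
  then show ?case using Cons path_end_inverse_word[of "g \<otimes> a" w]
    by (auto simp: inverse_word_def inv_gens undirected_edge_reverse)
qed (simp add: inverse_word_def)

lemma awalk_cayley_graph:
  "pre_digraph.awalk (cayley_graph G A) g p h \<longleftrightarrow>
    g \<in> carrier G \<and> (\<exists>w\<in>lists A. p = path_from G g w \<and> h = path_end G g w)"
proof -
  have cas: "pre_digraph.cas (cayley_graph G A) g p h \<longleftrightarrow>
      p = path_from G g (map snd p) \<and> h = path_end G g (map snd p)" for g
  proof (induction p arbitrary: g)
    case (Cons e p)
    obtain k a where e: "e = (k, a)" by (cases e)
    show ?case
      unfolding pre_digraph.cas.simps Cons.IH by (simp add: e cayley_graph_def) metis
  qed (simp add: pre_digraph.cas.simps eq_commute)
  show ?thesis
  proof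
    assume a: "pre_digraph.awalk (cayley_graph G A) g p h"
    then have "g \<in> carrier G" "set p \<subseteq> carrier G \<times> A"
      unfolding pre_digraph.awalk_def by (auto simp: cayley_graph_def)
    moreover from this have "map snd p \<in> lists A" by fastforce
    ultimately show "g \<in> carrier G \<and> (\<exists>w\<in>lists A. p = path_from G g w \<and> h = path_end G g w)"
      using a unfolding pre_digraph.awalk_def cas by blast
  next
    assume "g \<in> carrier G \<and> (\<exists>w\<in>lists A. p = path_from G g w \<and> h = path_end G g w)"
    then obtain w where w: "g \<in> carrier G" "w \<in> lists A" "p = path_from G g w" "h = path_end G g w"
      by blast
    then show "pre_digraph.awalk (cayley_graph G A) g p h"
      unfolding pre_digraph.awalk_def cas using set_path_from[OF w(1,2)]
      by (simp add: cayley_graph_def)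
  qed
qed

lemma awalk_edge_subgraph:
  "pre_digraph.awalk (edge_subgraph G A T) g p h \<longleftrightarrow>
    g \<in> carrier G \<and> (\<exists>w. tree_path T g w \<and> p = path_from G g w \<and> h = path_end G g w)"
proof -
  have "pre_digraph.cas (edge_subgraph G A T) g p h = pre_digraph.cas (cayley_graph G A) g p h" for g
    by (induction p arbitrary: g)
      (auto simp: pre_digraph.cas.simps cayley_graph_def edge_subgraph_def)
  then have "pre_digraph.awalk (edge_subgraph G A T) g p h \<longleftrightarrow>
     pre_digraph.awalk (cayley_graph G A) g p h \<and> (\<forall>e\<in>set p. undirected_edge G e \<in> T)"
    by (auto simp: pre_digraph.awalk_def edge_subgraph_def)
  then show ?thesis
    unfolding awalk_cayley_graph tree_path_def by blast
qed

lemma wf_digraph_edge_subgraph: "wf_digraph (edge_subgraph G A T)"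
  by unfold_locales (auto simp: edge_subgraph_def cayley_graph_def gens_carrier)

lemma awalk_verts_path_from:
  "pre_digraph.awalk_verts (edge_subgraph G A T) g (path_from G g w) =
    map (\<lambda>k. path_end G g (take k w)) [0..<Suc (length w)]"
proof (induction w arbitrary: g)
  case Nil
  then show ?case by (simp add: pre_digraph.awalk_verts.simps)
next
  case (Cons a w)
  have "[0..<Suc (length (a # w))] = 0 # map Suc [0..<Suc (length w)]"
    by (simp add: map_Suc_upt upt_conv_Cons del: upt_Suc)
  then show ?case using Cons
    by (simp add: pre_digraph.awalk_verts.simps edge_subgraph_def cayley_graph_def
        comp_def del: upt_Suc)
qed

text \<open>Removing a step and its reverse from a path does not move its ends.\<close>

lemma exists_reduced_tree_path:
  assumes "g \<in> carrier G" "tree_path T g w"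
  shows "\<exists>v. tree_path T g v \<and> path_end G g v = path_end G g w \<and> reduced G v"
  using assms(2)
proof (induction "length w" arbitrary: w rule: less_induct)
  case less
  show ?case
  proof (cases "reduced G w")
    case False
    then obtain u a b v where w: "w = u @ a # b # v" and "b = inv a"
      using not_successively_split unfolding reduced_def by blast
    have "path_end G g u \<in> carrier G" "a \<in> carrier G"
      using less w assms by (auto simp: gens_carrier tree_path_lists)
    then have "path_end G g u \<otimes> a \<otimes> inv a = path_end G g u" by (simp add: m_assoc)
    then show ?thesis
      using less.hyps[of "u @ v"] less.prems w \<open>b = inv a\<close> by auto
  qed (use less in auto)
qed

end

text \<open>A shortest nonempty closed path without backtracking is a cycle, because a vertex visited
  twice would cut out a shorter one.\<close>

lemma (in generated_group) no_closed_reduced_tree_path: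
  assumes "\<not> (\<exists>p. pre_digraph.cycle (edge_subgraph G A T) p \<and> no_backtracking G p)"
    and "g \<in> carrier G" "tree_path T g w" "reduced G w" "path_end G g w = g"
  shows "w = []"
  using assms(2-)
proof (induction "length w" arbitrary: g w rule: less_induct)
  case less
  let ?V = "pre_digraph.awalk_verts (edge_subgraph G A T) g (path_from G g w)"
  show ?case
  proof (rule ccontr)
    assume "w \<noteq> []"
    have "pre_digraph.awalk (edge_subgraph G A T) g (path_from G g w) g"
      unfolding awalk_edge_subgraph using less by auto
    moreover have "no_backtracking G (path_from G g w)"
      using less by (simp add: no_backtracking_path_from tree_path_lists)
    moreover have "path_from G g w \<noteq> []" using \<open>w \<noteq> []\<close> by (cases w) auto
    ultimately have "\<not> distinct (tl ?V)"
      using assms(1) unfolding pre_digraph.cycle_def by blast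
    moreover have "tl ?V = map (\<lambda>k. path_end G g (take k w)) [1..<Suc (length w)]"
      unfolding awalk_verts_path_from by (simp add: upt_conv_Cons del: upt_Suc)
    ultimately have "\<not> inj_on (\<lambda>k. path_end G g (take k w)) {1..<Suc (length w)}"
      by (simp add: distinct_map del: upt_Suc)
    then obtain i j where ij: "1 \<le> i" "i < j" "j \<le> length w"
        "path_end G g (take i w) = path_end G g (take j w)"
      unfolding inj_on_def
      by (metis atLeastLessThan_iff less_Suc_eq_le linorder_neqE_nat)
    define u where "u = drop i (take j w)"
    have "take i (take j w) = take i w" using ij by (simp add: min_def)
    then have tj: "take j w = take i w @ u"
      unfolding u_def by (metis append_take_drop_id)
    then have w: "w = take i w @ u @ drop j w"
      by (metis append_assoc append_take_drop_id)
    have "length u < length w" "u \<noteq> []" using ij by (auto simp: u_def)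
    moreover have "tree_path T (path_end G g (take i w)) u" "take i w \<in> lists A"
      using less.prems(2) w tree_path_lists[OF less.prems(2)]
      by (metis tree_path_simps(3), metis append_in_lists_conv)
    moreover have "reduced G u"
      using less.prems(3) w unfolding reduced_def by (metis successively_append_iff)
    moreover have "path_end G (path_end G g (take i w)) u = path_end G g (take i w)"
      using ij(4) unfolding tj by simp
    ultimately show False
      using less.hyps[of u "path_end G g (take i w)"] less.prems by auto
  qed
qed

context generated_group begin

context
  fixes T assumes T: "maximal_tree G A T"
begin

text \<open>After a common final part has been removed, two different paths end with different edges.
  Following one of them and returning along the other then gives a closed path without backtracking.\<close>

lemma reduced_tree_path_unique:
  assumes "g \<in> carrier G" "tree_path T g u" "tree_path T g v" "reduced G u" "reduced G v"
    "path_end G g u = path_end G g v"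
  shows "u = v"
  using assms(2-)
proof (induction u arbitrary: v rule: rev_induct)
  case Nil
  then show ?case
    using no_closed_reduced_tree_path[of T g v] T assms(1) by (auto simp: maximal_tree_def)
next
  case (snoc a u)
  show ?case
  proof (cases v rule: rev_cases)
    case Nil
    then show ?thesis
      using no_closed_reduced_tree_path[of T g "u @ [a]"] T assms(1) snoc.prems
      by (auto simp: maximal_tree_def)
  next
    case (snoc v' b)
    note v = snoc
    have AB: "a \<in> A" "b \<in> A" "a \<in> carrier G" "b \<in> carrier G" "u \<in> lists A" "v' \<in> lists A"
      "path_end G g u \<in> carrier G" "path_end G g v' \<in> carrier G"
      using snoc.prems snoc assms(1) tree_path_lists[of T g u] tree_path_lists[of T g v']
      by (simp_all add: gens_carrier)
    show ?thesis
    proof (cases "a = b")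
      case True
      then show ?thesis using snoc.IH[of v'] snoc.prems v AB
        by (auto simp: reduced_def successively_append_iff)
    next
      case False
      let ?w = "(u @ [a]) @ inverse_word G v"
      have ab: "inv b \<noteq> inv a" using False AB by (metis inv_inv)
      have inv_red: "reduced G (inverse_word G v)"
      proof -
        have "successively (\<lambda>x y. y \<noteq> inv x) v" using snoc.prems by (simp add: reduced_def)
        then have "successively (\<lambda>x y. x \<noteq> inv y) v"
          by (rule successively_mono)
            (use tree_path_lists[OF snoc.prems(2)] in \<open>auto simp: gens_carrier\<close>)
        then show ?thesis
          unfolding reduced_def inverse_word_def successively_rev successively_map
          by (rule successively_mono)
            (use tree_path_lists[OF snoc.prems(2)] in \<open>auto simp: gens_carrier\<close>)
      qed
      have "tree_path T g ?w"
        using snoc.prems tree_path_inverse_word[OF assms(1) snoc.prems(2)] by auto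
      moreover have "reduced G ?w"
        using snoc.prems(3) inv_red ab v
        by (auto simp: reduced_def successively_append_iff inverse_word_def)
      moreover have "path_end G g ?w = g"
        using path_end_inverse_word[OF assms(1) tree_path_lists[OF snoc.prems(2)]] snoc.prems by simp
      ultimately have "?w = []"
        using no_closed_reduced_tree_path[of T g ?w] T assms(1) by (auto simp: maximal_tree_def)
      then show ?thesis by simp
    qed
  qed
qed

lemma tree_word_eqI:
  assumes "tree_path T \<one> w" "reduced G w"
  shows "tree_word G A T (word_value G w) = w"
proof -
  let ?P = "\<lambda>p. pre_digraph.awalk (edge_subgraph G A T) \<one> p (word_value G w) \<and> no_backtracking G p"
  have "(THE p. ?P p) = path_from G \<one> w"
  proof (rule the_equality)
    show "?P (path_from G \<one> w)"
      using assms by (auto simp: awalk_edge_subgraph no_backtracking_path_from tree_path_lists)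
    fix p assume "?P p"
    then obtain v where v: "tree_path T \<one> v" "p = path_from G \<one> v"
        "word_value G w = word_value G v" "no_backtracking G p"
      by (auto simp: awalk_edge_subgraph)
    then have "reduced G v" by (simp add: no_backtracking_path_from tree_path_lists)
    then show "p = path_from G \<one> w"
      using reduced_tree_path_unique[of \<one> v w] v assms by simp
  qed
  then show ?thesis by (simp add: tree_word_def)
qed

lemma tree_word:
  assumes "g \<in> carrier G"
  shows "tree_path T \<one> (tree_word G A T g)" "reduced G (tree_word G A T g)"
    "word_value G (tree_word G A T g) = g"
proof -
  have "\<one> \<rightarrow>\<^sup>*\<^bsub>edge_subgraph G A T\<^esub> g"
    using T assms one_closed unfolding maximal_tree_def strongly_connected_def
    by (simp add: edge_subgraph_def cayley_graph_def)
  then obtain w where "tree_path T \<one> w" "g = word_value G w"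
    unfolding wf_digraph.reachable_awalk[OF wf_digraph_edge_subgraph] awalk_edge_subgraph by blast
  then obtain v where "tree_path T \<one> v" "g = word_value G v" "reduced G v"
    using exists_reduced_tree_path[OF one_closed] by metis
  then show "tree_path T \<one> (tree_word G A T g)" "reduced G (tree_word G A T g)"
    "word_value G (tree_word G A T g) = g"
    using tree_word_eqI by metis+
qed

lemma prefix_closed_nf_tree_word: "prefix_closed_nf G A (tree_word G A T)"
  unfolding prefix_closed_nf_def
proof (intro ballI conjI allI impI)
  fix g assume g: "g \<in> carrier G"
  note tw = tree_word[OF g]
  show "tree_word G A T g \<in> lists A" "word_value G (tree_word G A T g) = g"
    using tw tree_path_lists by auto
  fix u a assume "tree_word G A T g = u @ [a]"
  then show "tree_word G A T (word_value G u) = u"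
    using tw by (intro tree_word_eqI) (simp_all add: reduced_def successively_append_iff)
qed

text \<open>An edge of the tree either prolongs the tree path to its initial vertex without backtracking,
  or it is the reverse of the last edge of this path.\<close>

lemma tree_edge_tree_word:
  assumes g: "g \<in> carrier G" and a: "a \<in> A"
  shows "tree_edge G (tree_word G A T) g a \<longleftrightarrow> undirected_edge G (g, a) \<in> T"
proof
  have ga: "g \<otimes> a \<in> carrier G" using g a by (simp add: gens_carrier)
  note tg = tree_word[OF g] and tga = tree_word[OF ga]
  { assume "tree_edge G (tree_word G A T) g a"
    then consider "tree_word G A T (g \<otimes> a) = tree_word G A T g @ [a]"
      | "tree_word G A T g = tree_word G A T (g \<otimes> a) @ [inv a]" by (auto simp: tree_edge_def)
    then show "undirected_edge G (g, a) \<in> T"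
    proof cases
      case 1 then show ?thesis using tga tg by auto
    next
      case 2
      then show ?thesis using tga tg undirected_edge_reverse[OF g a] by auto
    qed }
  assume e: "undirected_edge G (g, a) \<in> T"
  let ?w = "tree_word G A T g"
  show "tree_edge G (tree_word G A T) g a"
  proof (cases "reduced G (?w @ [a])")
    case True
    then have "tree_word G A T (word_value G (?w @ [a])) = ?w @ [a]"
      using tg e a by (intro tree_word_eqI) auto
    then show ?thesis using tg by (simp add: tree_edge_def)
  next
    case False
    then have ne: "?w \<noteq> []" and "a = inv (last ?w)"
      using tg by (auto simp: reduced_def successively_append_iff)
    then obtain u b where w: "?w = u @ [b]" "a = inv b" by (cases ?w rule: rev_cases) auto
    have b: "b \<in> carrier G" "u \<in> lists A" using tree_path_lists[OF tg(1)] w by (auto simp: gens_carrier)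
    have "word_value G u \<otimes> b = g" using tg w by simp
    moreover have "word_value G u \<in> carrier G" using b by simp
    ultimately have "g \<otimes> a = word_value G u"
      using w(2) b(1) m_assoc[of "word_value G u" b "inv b"] by simp
    moreover have "tree_word G A T (word_value G u) = u"
      using prefix_closed_nf_tree_word g w unfolding prefix_closed_nf_def by blast
    ultimately show ?thesis using w b by (simp add: tree_edge_def)
  qed
qed

end

end

subsection \<open>The tree of a prefix-closed normal form\<close>

context generated_group begin

definition nf_tree :: "('a \<Rightarrow> 'a list) \<Rightarrow> ('a \<times> 'a) set set" where
  "nf_tree y = {undirected_edge G (g, a) | g a. g \<in> carrier G \<and> a \<in> A \<and> tree_edge G y g a}"

lemma undirected_edge_in_nf_tree:
  assumes g: "g \<in> carrier G" and a: "a \<in> A"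
  shows "undirected_edge G (g, a) \<in> nf_tree y \<longleftrightarrow> tree_edge G y g a"
proof
  assume "undirected_edge G (g, a) \<in> nf_tree y"
  then obtain h b where hb: "h \<in> carrier G" "b \<in> A" "tree_edge G y h b"
    "undirected_edge G (g, a) = undirected_edge G (h, b)"
    unfolding nf_tree_def by blast
  then have "(g, a) = (h, b) \<or> (g, a) = (h \<otimes> b, inv b)"
    by (auto simp: undirected_edge_def reverse_edge_def)
  moreover have "tree_edge G y (h \<otimes> b) (inv b)"
    using hb(1-3) by (auto simp: tree_edge_def gens_carrier m_assoc)
  ultimately show "tree_edge G y g a" using hb by auto
next
  assume "tree_edge G y g a"
  then show "undirected_edge G (g, a) \<in> nf_tree y"
    unfolding nf_tree_def using g a by blast
qed

context
  fixes y assumes y: "prefix_closed_nf G A y"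
begin

lemma nf_lists: "g \<in> carrier G \<Longrightarrow> y g \<in> lists A"
  and nf_value: "g \<in> carrier G \<Longrightarrow> word_value G (y g) = g"
  using y by (simp_all add: prefix_closed_nf_def)

lemma nf_prefix: "g \<in> carrier G \<Longrightarrow> y g = u @ v \<Longrightarrow> y (word_value G u) = u"
proof (induction v arbitrary: u)
  case Nil
  then show ?case using nf_value[of g] by simp
next
  case (Cons a v)
  have "y (word_value G (u @ [a])) = u @ [a]" using Cons.IH[of "u @ [a]"] Cons.prems by simp
  moreover have "word_value G (u @ [a]) \<in> carrier G"
    using nf_lists[OF Cons.prems(1)] Cons.prems(2) by (intro path_end_carrier) auto
  ultimately show ?case using y unfolding prefix_closed_nf_def by blast
qed

lemma nf_one: "y \<one> = []"
  using nf_prefix[of \<one> "[]" "y \<one>"] by simp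

lemma tree_path_nf: "g \<in> carrier G \<Longrightarrow> tree_path (nf_tree y) \<one> (y g)"
proof -
  assume g: "g \<in> carrier G"
  have "y g = u @ v \<Longrightarrow> tree_path (nf_tree y) \<one> u" for u v
  proof (induction u arbitrary: v rule: rev_induct)
    case (snoc a u)
    have l: "u \<in> lists A" "a \<in> A" using nf_lists[OF g] snoc.prems by auto
    have "y (word_value G u) = u" "y (word_value G (u @ [a])) = u @ [a]"
      using nf_prefix[OF g, of u "a # v"] nf_prefix[OF g, of "u @ [a]" v] snoc.prems by auto
    then have "tree_edge G y (word_value G u) a" by (simp add: tree_edge_def)
    then have "undirected_edge G (word_value G u, a) \<in> nf_tree y"
      using l by (subst undirected_edge_in_nf_tree) (simp_all del: in_lists_conv_set)
    then show ?case using snoc l by simp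
  qed simp
  from this[of "y g" "[]"] show ?thesis by simp
qed

text \<open>A letter followed by its inverse would give one group element two prefixes of \<open>y g\<close> as
  normal forms.\<close>

lemma reduced_nf: "g \<in> carrier G \<Longrightarrow> reduced G (y g)"
proof (rule ccontr)
  assume g: "g \<in> carrier G" and "\<not> reduced G (y g)"
  then obtain u a v where yg: "y g = u @ a # inv a # v"
    unfolding reduced_def using not_successively_split by blast
  then have l: "u \<in> lists A" "a \<in> carrier G" using nf_lists[OF g] by (auto simp: gens_carrier)
  have "word_value G (u @ [a, inv a]) = word_value G u"
    using path_end_carrier[OF one_closed l(1)] l(2) by (simp add: m_assoc)
  moreover have "y (word_value G (u @ [a, inv a])) = u @ [a, inv a]" "y (word_value G u) = u"
    using nf_prefix[OF g, of "u @ [a, inv a]" v] nf_prefix[OF g, of u "a # inv a # v"] yg by auto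
  ultimately show False by simp
qed

text \<open>A path without backtracking can only go down the tree once it has gone down one edge, so
  it climbs to a common ancestor \<open>h\<close> of its end points and descends from there.\<close>

lemma reduced_tree_path_up_down:
  assumes "g \<in> carrier G" "tree_path (nf_tree y) g w" "reduced G w"
  shows "\<exists>h u v. w = u @ v \<and> y g = y h @ inverse_word G u \<and> y (path_end G g w) = y h @ v"
  using assms
proof (induction w arbitrary: g)
  case Nil
  then show ?case by (intro exI[of _ g] exI[of _ "[]"]) (simp add: inverse_word_def)
next
  case (Cons a w)
  have a: "a \<in> A" "a \<in> carrier G" "g \<otimes> a \<in> carrier G" "w \<in> lists A"
    using Cons.prems tree_path_lists[OF Cons.prems(2)] by (auto simp: gens_carrier)
  have te: "tree_edge G y g a"
    using Cons.prems a undirected_edge_in_nf_tree by auto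
  have "tree_path (nf_tree y) (g \<otimes> a) w" "reduced G w"
    using Cons.prems by (cases w; simp add: reduced_def)+
  then obtain h u v where IH: "w = u @ v" "y (g \<otimes> a) = y h @ inverse_word G u"
      "y (path_end G (g \<otimes> a) w) = y h @ v"
    using Cons.IH[of "g \<otimes> a"] a(3) by blast
  consider "y g = y (g \<otimes> a) @ [inv a]" | "y (g \<otimes> a) = y g @ [a]"
    using te by (auto simp: tree_edge_def)
  then show ?case
  proof cases
    case 1
    then show ?thesis using IH
      by (intro exI[of _ h] exI[of _ "a # u"] exI[of _ v]) (simp add: inverse_word_def)
  next
    case 2
    have "u = []"
    proof (rule ccontr)
      assume "u \<noteq> []"
      then obtain b u' where u: "u = b # u'" by (cases u) auto
      then have "a = inv b" "b \<in> carrier G" using 2 IH a by (auto simp: inverse_word_def gens_carrier)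
      then have "b = inv a" by simp
      then show False using Cons.prems(3) IH(1) u by (simp add: reduced_def)
    qed
    then show ?thesis using IH 2
      by (intro exI[of _ g] exI[of _ "[]"] exI[of _ "a # v"]) (simp add: inverse_word_def)
  qed
qed

text \<open>On a closed path the way up and the way down spell inverse words, so the path backtracks at its
  turning point.\<close>

lemma maximal_tree_nf_tree: "maximal_tree G A (nf_tree y)"
  unfolding maximal_tree_def
proof (intro conjI notI)
  let ?S = "edge_subgraph G A (nf_tree y)"
  have reach: "g \<rightarrow>\<^sup>*\<^bsub>?S\<^esub> path_end G g w" if "g \<in> carrier G" "tree_path (nf_tree y) g w" for g w
    unfolding wf_digraph.reachable_awalk[OF wf_digraph_edge_subgraph] awalk_edge_subgraph
    using that by blast
  show "nf_tree y \<subseteq> undirected_edge G ` arcs (cayley_graph G A)"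
    by (auto simp: nf_tree_def cayley_graph_def)
  have "u \<rightarrow>\<^sup>*\<^bsub>?S\<^esub> v" if "u \<in> carrier G" "v \<in> carrier G" for u v
  proof -
    have "\<one> \<rightarrow>\<^sup>*\<^bsub>?S\<^esub> v" using reach[OF one_closed tree_path_nf[OF that(2)]] nf_value that by simp
    moreover have "u \<rightarrow>\<^sup>*\<^bsub>?S\<^esub> \<one>"
      using reach[of "word_value G (y u)" "inverse_word G (y u)"] nf_value[OF that(1)]
        tree_path_inverse_word[OF one_closed tree_path_nf[OF that(1)]] that(1)
        path_end_inverse_word[OF one_closed nf_lists[OF that(1)]] by simp
    ultimately show ?thesis
      using wf_digraph.reachable_trans[OF wf_digraph_edge_subgraph] by blast
  qed
  then show "strongly_connected ?S"
    unfolding strongly_connected_def by (auto simp: edge_subgraph_def cayley_graph_def)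
  assume "\<exists>p. pre_digraph.cycle ?S p \<and> no_backtracking G p"
  then obtain p g where "pre_digraph.awalk ?S g p g" "p \<noteq> []" and nb: "no_backtracking G p"
    unfolding pre_digraph.cycle_def by blast
  then obtain w where w: "g \<in> carrier G" "tree_path (nf_tree y) g w" "p = path_from G g w"
      "path_end G g w = g" "w \<noteq> []"
    unfolding awalk_edge_subgraph by (metis path_from.simps(1))
  then have red: "reduced G w"
    using nb no_backtracking_path_from tree_path_lists by blast
  obtain h u v where huv: "w = u @ v" "y g = y h @ inverse_word G u" "y g = y h @ v"
    using reduced_tree_path_up_down[OF w(1,2) red] w(4) by auto
  then have v: "v = inverse_word G u" by simp
  have u: "u \<in> lists A" using tree_path_lists[OF w(2)] huv by simp
  show False
  proof (cases u rule: rev_cases)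
    case Nil
    then show ?thesis using v huv w by (simp add: inverse_word_def)
  next
    case (snoc u' a)
    then show ?thesis using v huv red by (simp add: inverse_word_def reduced_def successively_append_iff)
  qed
qed

lemma tree_word_nf_tree: "g \<in> carrier G \<Longrightarrow> tree_word G A (nf_tree y) g = y g"
  using tree_word_eqI[OF maximal_tree_nf_tree tree_path_nf reduced_nf] nf_value by metis

end

end

section \<open>Stackings in terms of words\<close>

text \<open>The relation that generates \<^const>\<open>flow_order\<close>, for the flow function whose path at the edge
  \<open>(g, a)\<close> is labelled by \<open>\<phi> g a\<close>, on the tree of \<open>y\<close>.\<close>

definition flow_relation ::
    "('a, 'm) monoid_scheme \<Rightarrow> 'a set \<Rightarrow> ('a \<Rightarrow> 'a list) \<Rightarrow> ('a \<Rightarrow> 'a \<Rightarrow> 'a list) \<Rightarrow>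
      (('a \<times> 'a) \<times> ('a \<times> 'a)) set" where
  "flow_relation G A y \<phi> =
    {((h, b), (g, a)). g \<in> carrier G \<and> a \<in> A \<and> (h, b) \<in> set (path_from G g (\<phi> g a)) \<and>
      \<not> tree_edge G y g a \<and> \<not> tree_edge G y h b}"

text \<open>A bounded flow function in terms of words: the end points of the path at \<open>(g, a)\<close> are correct
  exactly if \<open>\<phi> g a\<close> and \<open>a\<close> have the same value.\<close>

definition stacking ::
    "('a, 'm) monoid_scheme \<Rightarrow> 'a set \<Rightarrow> ('a \<Rightarrow> 'a list) \<Rightarrow> ('a \<Rightarrow> 'a \<Rightarrow> 'a list) \<Rightarrow> bool" where
  "stacking G A y \<phi> \<longleftrightarrow>
    prefix_closed_nf G A y \<and>
    (\<forall>g\<in>carrier G. \<forall>a\<in>A. \<phi> g a \<in> lists A \<and> word_value G (\<phi> g a) = a \<and>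
      (tree_edge G y g a \<longrightarrow> \<phi> g a = [a])) \<and>
    (\<exists>k. \<forall>g\<in>carrier G. \<forall>a\<in>A. length (\<phi> g a) \<le> k) \<and>
    wf (flow_relation G A y \<phi>)"

definition stacking_language ::
    "('a, 'm) monoid_scheme \<Rightarrow> 'a set \<Rightarrow> ('a \<Rightarrow> 'a list) \<Rightarrow> ('a \<Rightarrow> 'a \<Rightarrow> 'a list) \<Rightarrow> 'a list list set"
  where
  "stacking_language G A y \<phi> = {[y g, [a], \<phi> g a] | g a. g \<in> carrier G \<and> a \<in> A}"

context generated_group begin

lemma flow_order_eq:
  assumes tree: "\<And>g a. g \<in> carrier G \<Longrightarrow> a \<in> A \<Longrightarrow> undirected_edge G (g, a) \<in> T \<longleftrightarrow> tree_edge G y g a"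
    and path: "\<And>g a. g \<in> carrier G \<Longrightarrow> a \<in> A \<Longrightarrow> \<phi> g a \<in> lists A \<and> \<Phi> (g, a) = path_from G g (\<phi> g a)"
  shows "flow_order G A T \<Phi> =
    (flow_relation G A y \<phi>)\<^sup>+"
proof -
  have "{(e', e). e \<in> arcs (cayley_graph G A) \<and> e' \<in> arcs (cayley_graph G A) \<and> e' \<in> set (\<Phi> e) \<and>
      undirected_edge G e \<notin> T \<and> undirected_edge G e' \<notin> T} =
    (flow_relation G A y \<phi>)" (is "?R = ?S")
  proof (rule Set.set_eqI)
    fix ee :: "('a \<times> 'a) \<times> ('a \<times> 'a)"
    obtain h b g a where ee: "ee = ((h, b), (g, a))" by (metis surj_pair)
    have "((h, b), (g, a)) \<in> ?R \<longleftrightarrow> ((h, b), (g, a)) \<in> ?S"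
    proof (cases "g \<in> carrier G \<and> a \<in> A \<and> (h, b) \<in> set (path_from G g (\<phi> g a))")
      case True
      then have "h \<in> carrier G" "b \<in> A" using set_path_from path by blast+
      then show ?thesis using True tree path by (simp add: cayley_graph_def flow_relation_def)
    next
      case False
      then show ?thesis using path by (auto simp: cayley_graph_def flow_relation_def)
    qed
    then show "ee \<in> ?R \<longleftrightarrow> ee \<in> ?S" unfolding ee .
  qed
  then show ?thesis unfolding flow_order_def by simp
qed

theorem stacking_if_bounded_flow_function:
  assumes "bounded_flow_function G A T \<Phi>"
  shows "stacking G A (tree_word G A T) (\<lambda>g a. map snd (\<Phi> (g, a)))"
proof -
  let ?\<phi> = "\<lambda>g a. map snd (\<Phi> (g, a))"
  from assms have T: "maximal_tree G A T"
    and walk: "\<And>g a. g \<in> carrier G \<Longrightarrow> a \<in> A \<Longrightarrow>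
      pre_digraph.awalk (cayley_graph G A) g (\<Phi> (g, a)) (g \<otimes> a)"
    and triv: "\<And>g a. g \<in> carrier G \<Longrightarrow> a \<in> A \<Longrightarrow> undirected_edge G (g, a) \<in> T \<Longrightarrow> \<Phi> (g, a) = [(g, a)]"
    and wf: "wf (flow_order G A T \<Phi>)"
    and k: "\<exists>k. \<forall>g\<in>carrier G. \<forall>a\<in>A. length (\<Phi> (g, a)) \<le> k"
    unfolding bounded_flow_function_def flow_function_def by (auto simp: cayley_graph_def)
  have path: "?\<phi> g a \<in> lists A \<and> \<Phi> (g, a) = path_from G g (?\<phi> g a)"
    and val: "word_value G (?\<phi> g a) = a" if ga: "g \<in> carrier G" "a \<in> A" for g a
  proof -
    obtain w where w: "w \<in> lists A" "\<Phi> (g, a) = path_from G g w" "g \<otimes> a = path_end G g w"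
      using walk[OF ga] unfolding awalk_cayley_graph by blast
    then show "?\<phi> g a \<in> lists A \<and> \<Phi> (g, a) = path_from G g (?\<phi> g a)" by simp
    have "g \<otimes> a = g \<otimes> word_value G w" using w(3) path_end_word_value[OF ga(1) w(1)] by simp
    then have "a = word_value G w"
      using ga w(1) by (simp add: gens_carrier)
    then show "word_value G (?\<phi> g a) = a" using w by simp
  qed
  note tree = tree_edge_tree_word[OF T]
  have "wf ((flow_relation G A (tree_word G A T) ?\<phi>)\<^sup>+)"
    using wf flow_order_eq[of T "tree_word G A T" ?\<phi> \<Phi>] tree path by simp
  then have "wf (flow_relation G A (tree_word G A T) ?\<phi>)"
    by (rule wf_subset) auto
  then show ?thesis
    unfolding stacking_def
    using prefix_closed_nf_tree_word[OF T] path val triv tree k by simp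
qed

theorem bounded_flow_function_if_stacking:
  assumes "stacking G A y \<phi>"
  shows "\<exists>T \<Phi>. bounded_flow_function G A T \<Phi> \<and> stacking_graph G A T \<Phi> = stacking_language G A y \<phi>"
proof -
  let ?T = "nf_tree y"
  define \<Phi> where "\<Phi> = (\<lambda>(g, a). path_from G g (\<phi> g a))"
  from assms obtain k where y: "prefix_closed_nf G A y"
    and \<phi>: "\<And>g a. g \<in> carrier G \<Longrightarrow> a \<in> A \<Longrightarrow> \<phi> g a \<in> lists A"
      "\<And>g a. g \<in> carrier G \<Longrightarrow> a \<in> A \<Longrightarrow> word_value G (\<phi> g a) = a"
      "\<And>g a. g \<in> carrier G \<Longrightarrow> a \<in> A \<Longrightarrow> tree_edge G y g a \<Longrightarrow> \<phi> g a = [a]"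
      "\<And>g a. g \<in> carrier G \<Longrightarrow> a \<in> A \<Longrightarrow> length (\<phi> g a) \<le> k"
    and wf: "wf (flow_relation G A y \<phi>)"
    unfolding stacking_def by blast
  have order: "flow_order G A ?T \<Phi> =
    (flow_relation G A y \<phi>)\<^sup>+"
    by (rule flow_order_eq) (use undirected_edge_in_nf_tree \<phi> in \<open>auto simp: \<Phi>_def\<close>)
  have "wf (flow_order G A ?T \<Phi>)" unfolding order using wf by (rule wf_trancl)
  moreover from this have "irrefl (flow_order G A ?T \<Phi>)" by (auto simp: irrefl_def)
  moreover have "trans (flow_order G A ?T \<Phi>)" unfolding order by (rule trans_trancl)
  moreover have "pre_digraph.awalk (cayley_graph G A) g (\<Phi> (g, a)) (g \<otimes> a)"
    if ga: "g \<in> carrier G" "a \<in> A" for g a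
  proof -
    have "g \<otimes> a = path_end G g (\<phi> g a)" using path_end_word_value[OF ga(1) \<phi>(1)[OF ga]] \<phi>(2)[OF ga] by simp
    then show ?thesis unfolding awalk_cayley_graph using \<phi>(1)[OF ga] ga by (auto simp: \<Phi>_def)
  qed
  ultimately have "bounded_flow_function G A ?T \<Phi>"
    unfolding bounded_flow_function_def flow_function_def
    using maximal_tree_nf_tree[OF y] \<phi> undirected_edge_in_nf_tree
    by (auto simp: cayley_graph_def \<Phi>_def intro!: exI[of _ k])
  moreover have "stacking_graph G A ?T \<Phi> = stacking_language G A y \<phi>"
    unfolding stacking_graph_def stacking_language_def
    by (rule Collect_cong) (metis (mono_tags) \<Phi>_def case_prod_conv map_snd_path_from tree_word_nf_tree[OF y])
  ultimately show ?thesis by blast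
qed

end

lemma stackable_iff:
  "stackable G A \<longleftrightarrow> generated_group G A \<and> (\<exists>y \<phi>. stacking G A y \<phi>)"
  unfolding stackable_def
  by (meson generated_group.stacking_if_bounded_flow_function
      generated_group.bounded_flow_function_if_stacking)

lemma stacking_graph_eq:
  "stacking_graph G A T \<Phi> =
    stacking_language G A (tree_word G A T) (\<lambda>g a. map snd (\<Phi> (g, a)))"
  by (simp add: stacking_graph_def stacking_language_def)

lemma autostackable_iff:
  "autostackable G A \<longleftrightarrow> generated_group G A \<and>
    (\<exists>y \<phi>. stacking G A y \<phi> \<and> synchronously_regular 3 A (stacking_language G A y \<phi>))"
  unfolding autostackable_def
  by (metis generated_group.stacking_if_bounded_flow_function stacking_graph_eq
      generated_group.bounded_flow_function_if_stacking)

lemma algorithmically_stackable_iff: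
  "algorithmically_stackable G A \<longleftrightarrow> generated_group G A \<and>
    (\<exists>y \<phi>. stacking G A y \<phi> \<and> decidable_tuples 3 A (stacking_language G A y \<phi>))"
  unfolding algorithmically_stackable_def
  by (metis generated_group.stacking_if_bounded_flow_function stacking_graph_eq
      generated_group.bounded_flow_function_if_stacking)

section \<open>Normal forms for syllable words\<close>

locale graph_of_groups =
  fixes I :: "nat set" and E :: "nat set set" and G :: "nat \<Rightarrow> ('a, 'm) monoid_scheme"
  assumes group_vertex: "i \<in> I \<Longrightarrow> group (G i)"
    and edges: "e \<in> E \<Longrightarrow> e \<subseteq> I \<and> card e = 2"
begin

definition adj :: "nat \<Rightarrow> nat \<Rightarrow> bool" where
  "adj i j \<longleftrightarrow> {i, j} \<in> E"

lemma adj_commute: "adj i j \<longleftrightarrow> adj j i"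
  by (simp add: adj_def insert_commute)

lemma not_adj_self [simp]: "\<not> adj i i"
  using edges[of "{i}"] by (auto simp: adj_def)

lemma adj_in: "adj i j \<Longrightarrow> i \<in> I \<and> j \<in> I"
  using edges[of "{i, j}"] by (auto simp: adj_def)

text \<open>If \<open>F\<close> is the set of vertices whose syllables may not be appended to a word, then \<open>forbid F i\<close> is
  this set after a syllable at \<open>i\<close> has been appended. Another syllable at \<open>i\<close> would merge with the
  last one. A syllable at an adjacent vertex \<open>k\<close> can be moved in front of the last one; there it is
  either not allowed, or it shows that the word is not lexicographically least, because \<open>k < i\<close>.\<close>

definition forbid :: "nat set \<Rightarrow> nat \<Rightarrow> nat set" where
  "forbid F i = insert i {k. adj k i \<and> (k \<in> F \<or> k < i)}"

text \<open>Syllable words that represent normal forms are stored in reverse order, because right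
  multiplication acts on their last syllables.\<close>

fun forbidden :: "(nat \<times> 'a) list \<Rightarrow> nat set" where
  "forbidden [] = {}"
| "forbidden ((i, s) # r) = forbid (forbidden r) i"

fun normal :: "(nat \<times> 'a) list \<Rightarrow> bool" where
  "normal [] \<longleftrightarrow> True"
| "normal ((i, s) # r) \<longleftrightarrow>
    i \<in> I \<and> s \<in> carrier (G i) \<and> s \<noteq> \<one>\<^bsub>G i\<^esub> \<and> i \<notin> forbidden r \<and> normal r"

definition extend :: "(nat \<times> 'a) list \<Rightarrow> nat \<Rightarrow> 'a \<Rightarrow> (nat \<times> 'a) list" where
  "extend r i h = (if h = \<one>\<^bsub>G i\<^esub> then r else (i, h) # r)"

text \<open>Right multiplication of a normal word by a syllable. A syllable that may not be appended moves to
  the left, past syllables of adjacent vertices, until it merges with a syllable of its own vertex or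
  reaches the place that the order of the vertices assigns to it.\<close>

fun act :: "(nat \<times> 'a) list \<Rightarrow> nat \<Rightarrow> 'a \<Rightarrow> (nat \<times> 'a) list" where
  "act [] j h = extend [] j h"
| "act ((i, s) # r) j h =
    (if i = j then extend r j (s \<otimes>\<^bsub>G j\<^esub> h)
     else if j \<in> forbidden ((i, s) # r) then (i, s) # act r j h
     else extend ((i, s) # r) j h)"

lemma mem_forbid [simp]: "k \<in> forbid F i \<longleftrightarrow> k = i \<or> adj k i \<and> (k \<in> F \<or> k < i)"
  by (auto simp: forbid_def)

lemma mult_vertex [simp]:
  "i \<in> I \<Longrightarrow> g \<in> carrier (G i) \<Longrightarrow> h \<in> carrier (G i) \<Longrightarrow> g \<otimes>\<^bsub>G i\<^esub> h \<in> carrier (G i)"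
  and one_vertex [simp]: "i \<in> I \<Longrightarrow> \<one>\<^bsub>G i\<^esub> \<in> carrier (G i)"
  and r_one_vertex [simp]: "i \<in> I \<Longrightarrow> g \<in> carrier (G i) \<Longrightarrow> g \<otimes>\<^bsub>G i\<^esub> \<one>\<^bsub>G i\<^esub> = g"
  and l_one_vertex [simp]: "i \<in> I \<Longrightarrow> g \<in> carrier (G i) \<Longrightarrow> \<one>\<^bsub>G i\<^esub> \<otimes>\<^bsub>G i\<^esub> g = g"
  using group_vertex[of i]
  by (simp_all add: group.is_monoid monoid.m_closed monoid.one_closed)

lemma assoc_vertex:
  "i \<in> I \<Longrightarrow> g \<in> carrier (G i) \<Longrightarrow> h \<in> carrier (G i) \<Longrightarrow> k \<in> carrier (G i) \<Longrightarrow>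
    g \<otimes>\<^bsub>G i\<^esub> h \<otimes>\<^bsub>G i\<^esub> k = g \<otimes>\<^bsub>G i\<^esub> (h \<otimes>\<^bsub>G i\<^esub> k)"
  using group_vertex[of i] by (simp add: group.is_monoid monoid.m_assoc)

lemma act_not_forbidden: "j \<notin> forbidden r \<Longrightarrow> act r j h = extend r j h"
  by (cases r rule: forbidden.cases) auto

lemma act_extend:
  "j \<in> I \<Longrightarrow> g \<in> carrier (G j) \<Longrightarrow> h \<in> carrier (G j) \<Longrightarrow> j \<notin> forbidden r \<Longrightarrow>
    act (extend r j g) j h = extend r j (g \<otimes>\<^bsub>G j\<^esub> h)"
  by (auto simp: extend_def act_not_forbidden)

lemma normal_extend:
  "normal r \<Longrightarrow> j \<in> I \<Longrightarrow> h \<in> carrier (G j) \<Longrightarrow> j \<notin> forbidden r \<Longrightarrow> normal (extend r j h)"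
  by (simp add: extend_def)

text \<open>When a syllable at \<open>j\<close> has moved past a last syllable at \<open>i\<close>, the latter may still follow the
  changed word.\<close>

lemma act_keeps_allowed:
  assumes "normal r" "adj i j" "i \<notin> forbidden r" "j \<in> forbidden r \<or> j < i"
  shows "i \<notin> forbidden (act r j h)"
  using assms
proof (induction r)
  case Nil
  then show ?case by (auto simp: extend_def)
next
  case (Cons x r)
  obtain k s where x: "x = (k, s)" by (cases x)
  show ?case using Cons by (auto simp: x extend_def)
qed

lemma normal_act:
  assumes "normal r" "j \<in> I" "h \<in> carrier (G j)"
  shows "normal (act r j h)"
  using assms
proof (induction r)
  case Nil
  then show ?case by (simp add: normal_extend)
next
  case (Cons x r)
  obtain k s where x: "x = (k, s)" by (cases x)
  show ?case
  proof (cases "k = j")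
    case True
    then show ?thesis using Cons by (simp add: x normal_extend)
  next
    case False
    then show ?thesis using Cons act_keeps_allowed[of r k j h]
      by (auto simp: x adj_commute extend_def)
  qed
qed

lemma act_one: "normal r \<Longrightarrow> j \<in> I \<Longrightarrow> act r j \<one>\<^bsub>G j\<^esub> = r"
  by (induction r) (auto simp: extend_def)

text \<open>When a syllable at \<open>j\<close> has moved past a last syllable at \<open>i\<close>, so does the next syllable at \<open>j\<close>. For
  \<open>j < i\<close> this holds by the order. For \<open>i < j\<close> there is, to the right of all syllables at \<open>j\<close>, a syllable
  of a vertex above \<open>j\<close> from which on all syllables commute with \<open>j\<close>; it is not affected by the
  multiplication and keeps \<open>j\<close> forbidden.\<close>

lemma act_keeps_forbidden:
  assumes "normal r" "j \<in> forbidden r" "adj i j" "i < j" "i \<notin> forbidden r"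
  shows "j \<in> forbidden (act r j h)"
  using assms
proof (induction r arbitrary: i)
  case (Cons x r)
  obtain k s where x: "x = (k, s)" by (cases x)
  show ?case
    using Cons.prems Cons.IH[of k] by (auto simp: x extend_def adj_commute)
qed simp

lemma act_act:
  assumes "normal r" "j \<in> I" "g \<in> carrier (G j)" "h \<in> carrier (G j)"
  shows "act (act r j g) j h = act r j (g \<otimes>\<^bsub>G j\<^esub> h)"
  using assms
proof (induction r)
  case Nil
  then show ?case using act_extend[of j g h "[]"] by simp
next
  case (Cons x r)
  obtain k s where x: "x = (k, s)" by (cases x)
  consider "k = j" | "k \<noteq> j" "j \<notin> forbidden (x # r)" | "k \<noteq> j" "j \<in> forbidden (x # r)" by blast
  then show ?case
  proof cases
    case 1
    then show ?thesis using Cons by (simp add: x act_extend assoc_vertex)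
  next
    case 2
    then show ?thesis using Cons.prems by (simp add: act_not_forbidden act_extend)
  next
    case 3
    then have "j \<in> forbidden ((k, s) # act r j g)"
      using Cons.prems act_keeps_forbidden[of r j k g] by (auto simp: x adj_commute)
    then show ?thesis using 3 Cons by (auto simp: x)
  qed
qed

text \<open>The corresponding fact for two adjacent vertices \<open>i\<close> and \<open>j\<close>: if syllables at both of them move past
  a last syllable at \<open>l\<close>, then the one at \<open>j\<close> still does so after the one at \<open>i\<close> has been moved.\<close>

lemma act_adj_keeps_forbidden:
  assumes "normal r" "j \<in> forbidden r" "l \<notin> forbidden r" "adj l i" "adj l j" "adj i j" "l < j"
    "i \<in> forbidden r \<or> i < l"
  shows "j \<in> forbidden (act r i h)"
  using assms
proof (induction r arbitrary: l)
  case (Cons x r)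
  obtain m t where x: "x = (m, t)" by (cases x)
  consider "m = i" | "m = j" | "m \<noteq> i" "m \<noteq> j" "i \<in> forbidden (x # r)"
    | "m \<noteq> i" "m \<noteq> j" "i \<notin> forbidden (x # r)" by blast
  then show ?case
  proof cases
    case 3
    then show ?thesis
      using Cons.prems Cons.IH[of m] by (auto simp: x adj_commute)
  qed (use Cons.prems in \<open>auto simp: x extend_def adj_commute\<close>)
qed simp

text \<open>The relations of the graph product act trivially. The induction hypothesis enters where both
  syllables move past the last one; in all other cases the words can be compared directly.\<close>

lemma act_commute:
  assumes "normal r" "adj i j" "h \<in> carrier (G i)" "k \<in> carrier (G j)"
  shows "act (act r i h) j k = act (act r j k) i h"
  using assms
proof (induction r arbitrary: i j h k)
  case Nil
  then have ij: "i \<in> I" "j \<in> I" "i \<noteq> j" using adj_in by auto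
  show ?case
    using Nil ij by (cases "i < j") (auto simp: extend_def adj_commute)
next
  case (Cons x r)
  obtain l s where x: "x = (l, s)" by (cases x)
  have ij: "i \<in> I" "j \<in> I" "i \<noteq> j" using adj_in Cons.prems by auto
  \<comment> \<open>The last syllable lies in one of the two vertex groups.\<close>
  have top: "act (act ((i, s) # r) i h) j k = act (act ((i, s) # r) j k) i h"
    if "normal ((i, s) # r)" "adj i j" "h \<in> carrier (G i)" "k \<in> carrier (G j)" "i \<in> I" "j \<in> I"
    for i j h k
  proof (cases "j \<in> forbidden ((i, s) # r)")
    case True
    then show ?thesis using that
      by (cases "s \<otimes>\<^bsub>G i\<^esub> h = \<one>\<^bsub>G i\<^esub>") (auto simp: extend_def)
  next
    case False
    then show ?thesis using that
      by (auto simp: extend_def act_not_forbidden adj_commute act_one)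
  qed
  \<comment> \<open>Only one of the two vertices is forbidden after \<open>x # r\<close>.\<close>
  have mixed: "act (act (x # r) i h) j k = act (act (x # r) j k) i h"
    if "l \<noteq> i" "l \<noteq> j" "adj i j" "i \<in> forbidden (x # r)" "j \<notin> forbidden (x # r)" "normal (x # r)"
    for i j h k
  proof -
    have "j \<notin> forbidden (act (x # r) i h)"
      using that by (intro act_keeps_allowed) (auto simp: adj_commute)
    then show ?thesis using that by (auto simp: x act_not_forbidden extend_def)
  qed
  have low: "act (act (x # r) i h) j k = act (act (x # r) j k) i h"
    if "i < j" "adj i j" "i \<notin> forbidden (x # r)" "j \<notin> forbidden (x # r)" "normal (x # r)" for i j h k
    using that by (auto simp: x act_not_forbidden extend_def)
  consider "l = i" | "l = j" | "l \<noteq> i" "l \<noteq> j" "i \<in> forbidden (x # r)" "j \<in> forbidden (x # r)"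
    | "l \<noteq> i" "l \<noteq> j" "i \<in> forbidden (x # r)" "j \<notin> forbidden (x # r)"
    | "l \<noteq> i" "l \<noteq> j" "i \<notin> forbidden (x # r)" "j \<in> forbidden (x # r)"
    | "i \<notin> forbidden (x # r)" "j \<notin> forbidden (x # r)" by blast
  then show ?case
  proof cases
    case 1
    then show ?thesis using top[of i j h k] Cons.prems ij by (simp add: x)
  next
    case 2
    then show ?thesis using top[of j i k h] Cons.prems ij by (simp add: x adj_commute)
  next
    case 3
    have "j \<in> forbidden ((l, s) # act r i h)"
      using 3 Cons.prems act_adj_keeps_forbidden[of r j l i h] by (auto simp: x adj_commute)
    moreover have "i \<in> forbidden ((l, s) # act r j k)"
      using 3 Cons.prems act_adj_keeps_forbidden[of r i l j k] by (auto simp: x adj_commute)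
    moreover have "act (act r i h) j k = act (act r j k) i h"
      using Cons by (auto simp: x)
    ultimately show ?thesis using 3 by (auto simp: x)
  next
    case 4 then show ?thesis using mixed[of i j] Cons.prems by blast
  next
    case 5 then show ?thesis using mixed[of j i] Cons.prems by (metis adj_commute)
  next
    case 6
    then show ?thesis using low[of i j] low[of j i] Cons.prems ij by (metis adj_commute linorder_neqE_nat)
  qed
qed

definition act_word :: "(nat \<times> 'a) list \<Rightarrow> (nat \<times> 'a) list \<Rightarrow> (nat \<times> 'a) list" where
  "act_word r v = foldl (\<lambda>r (j, h). act r j h) r v"

lemma act_word_simps [simp]:
  "act_word r [] = r"
  "act_word r ((j, h) # v) = act_word (act r j h) v"
  "act_word r (u @ v) = act_word (act_word r u) v"
  by (simp_all add: act_word_def)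

lemma normal_act_word: "normal r \<Longrightarrow> v \<in> syllable_words I G \<Longrightarrow> normal (act_word r v)"
  by (induction v arbitrary: r) (auto simp: syllable_words_def normal_act)

lemma act_word_free_product_rel:
  "(v, w) \<in> free_product_rel I G \<Longrightarrow> normal r \<Longrightarrow> act_word r v = act_word r w"
proof (induction arbitrary: r rule: free_product_rel.induct)
  case (one u v i)
  then show ?case using normal_act_word[of r u] by (simp add: act_one)
next
  case (mult u v i g h)
  then show ?case using normal_act_word[of r u] by (simp add: act_act)
qed auto

subsection \<open>The free product\<close>

abbreviation syllables :: "(nat \<times> 'a) list set" where
  "syllables \<equiv> syllable_words I G"

abbreviation free :: "(nat \<times> 'a) list set monoid" where
  "free \<equiv> free_product I G"

definition word_class :: "(nat \<times> 'a) list \<Rightarrow> (nat \<times> 'a) list set" where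
  "word_class v = free_product_rel I G `` {v}"

definition inv_syllables :: "(nat \<times> 'a) list \<Rightarrow> (nat \<times> 'a) list" where
  "inv_syllables v = rev (map (\<lambda>(i, g). (i, inv\<^bsub>G i\<^esub> g)) v)"

lemma syllables_simps [simp]:
  "[] \<in> syllables"
  "(i, g) # v \<in> syllables \<longleftrightarrow> i \<in> I \<and> g \<in> carrier (G i) \<and> v \<in> syllables"
  "u @ v \<in> syllables \<longleftrightarrow> u \<in> syllables \<and> v \<in> syllables"
  by (auto simp: syllable_words_def)

lemma inv_syllables_in: "v \<in> syllables \<Longrightarrow> inv_syllables v \<in> syllables"
  by (induction v) (auto simp: inv_syllables_def group_vertex group.inv_closed)

lemma free_product_rel_in:
  "(v, w) \<in> free_product_rel I G \<Longrightarrow> v \<in> syllables \<and> w \<in> syllables"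
  by (induction rule: free_product_rel.induct) auto

lemma equiv_free_product_rel: "equiv syllables (free_product_rel I G)"
proof (rule equivI)
  show "free_product_rel I G \<subseteq> syllables \<times> syllables" using free_product_rel_in by auto
  show "refl_on syllables (free_product_rel I G)"
    by (simp add: refl_on_def free_product_rel.refl)
  show "sym (free_product_rel I G)" by (rule symI) (rule free_product_rel.sym)
  show "trans (free_product_rel I G)" by (rule transI) (rule free_product_rel.trans)
qed

lemma free_product_rel_context:
  "(v, w) \<in> free_product_rel I G \<Longrightarrow> x \<in> syllables \<Longrightarrow> y \<in> syllables \<Longrightarrow>
    (x @ v @ y, x @ w @ y) \<in> free_product_rel I G"
proof (induction rule: free_product_rel.induct)
  case (refl w)
  then show ?case by (simp add: free_product_rel.refl)
next
  case (sym v w)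
  then show ?case by (blast intro: free_product_rel.sym)
next
  case (trans u v w)
  then show ?case by (blast intro: free_product_rel.trans)
next
  case (one u v i)
  then show ?case using free_product_rel.one[of "x @ u" I G "v @ y" i] by simp
next
  case (mult u v i g h)
  then show ?case using free_product_rel.mult[of "x @ u" I G "v @ y" i g h] by simp
qed

lemma free_product_rel_append:
  assumes "(v, v') \<in> free_product_rel I G" "(w, w') \<in> free_product_rel I G"
  shows "(v @ w, v' @ w') \<in> free_product_rel I G"
proof -
  have "(v @ w, v' @ w) \<in> free_product_rel I G"
    using free_product_rel_context[OF assms(1), of "[]" w] free_product_rel_in[OF assms(2)] by simp
  moreover have "(v' @ w, v' @ w') \<in> free_product_rel I G"
    using free_product_rel_context[OF assms(2), of v' "[]"] free_product_rel_in[OF assms(1)] by simp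
  ultimately show ?thesis by (rule free_product_rel.trans)
qed

lemma word_class_eq_iff:
  "v \<in> syllables \<Longrightarrow> w \<in> syllables \<Longrightarrow> word_class v = word_class w \<longleftrightarrow> (v, w) \<in> free_product_rel I G"
  unfolding word_class_def using eq_equiv_class_iff[OF equiv_free_product_rel] by blast

lemma carrier_free: "carrier free = word_class ` syllables"
  by (auto simp: free_product_def quotient_def word_class_def)

lemma one_free: "\<one>\<^bsub>free\<^esub> = word_class []"
  by (simp add: free_product_def word_class_def)

lemma mult_free:
  assumes "v \<in> syllables" "w \<in> syllables"
  shows "word_class v \<otimes>\<^bsub>free\<^esub> word_class w = word_class (v @ w)"
proof -
  have *: "word_class (x @ y) = word_class (v @ w)" if "x \<in> word_class v" "y \<in> word_class w" for x y
  proof -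
    have "(v @ w, x @ y) \<in> free_product_rel I G"
      using that free_product_rel_append unfolding word_class_def by auto
    then show ?thesis
      using word_class_eq_iff free_product_rel_in by (metis free_product_rel.sym)
  qed
  have ne: "word_class v \<noteq> {}" "word_class w \<noteq> {}"
    using assms free_product_rel.refl by (fastforce simp: word_class_def)+
  have "(\<Union>x\<in>word_class v. \<Union>y\<in>word_class w. word_class (x @ y)) =
      (\<Union>x\<in>word_class v. \<Union>y\<in>word_class w. word_class (v @ w))"
    by (rule SUP_cong[OF HOL.refl], rule SUP_cong[OF HOL.refl], rule *)
  also have "\<dots> = word_class (v @ w)" using ne by simp
  finally have "(\<Union>x\<in>word_class v. \<Union>y\<in>word_class w. word_class (x @ y)) = word_class (v @ w)" .
  then show ?thesis by (simp add: free_product_def word_class_def)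
qed

lemma inv_syllables_rel:
  "v \<in> syllables \<Longrightarrow> (inv_syllables v @ v, []) \<in> free_product_rel I G"
proof (induction v)
  case Nil
  then show ?case by (simp add: inv_syllables_def free_product_rel.refl)
next
  case (Cons x v)
  obtain i g where x: "x = (i, g)" by (cases x)
  have ig: "i \<in> I" "g \<in> carrier (G i)" "v \<in> syllables" "inv\<^bsub>G i\<^esub> g \<in> carrier (G i)"
    "inv\<^bsub>G i\<^esub> g \<otimes>\<^bsub>G i\<^esub> g = \<one>\<^bsub>G i\<^esub>"
    using Cons.prems by (auto simp: x group_vertex group.inv_closed group.l_inv)
  let ?u = "inv_syllables v"
  have u: "?u \<in> syllables" using ig inv_syllables_in by simp
  have "(?u @ [(i, inv\<^bsub>G i\<^esub> g), (i, g)] @ v, ?u @ [(i, \<one>\<^bsub>G i\<^esub>)] @ v) \<in> free_product_rel I G"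
    using free_product_rel.mult[of ?u I G v i "inv\<^bsub>G i\<^esub> g" g] ig u by simp
  moreover have "(?u @ [(i, \<one>\<^bsub>G i\<^esub>)] @ v, ?u @ v) \<in> free_product_rel I G"
    using ig u by (intro free_product_rel.one)
  ultimately have "(?u @ [(i, inv\<^bsub>G i\<^esub> g), (i, g)] @ v, []) \<in> free_product_rel I G"
    using Cons.IH ig by (blast intro: free_product_rel.trans)
  then show ?case by (simp add: inv_syllables_def x)
qed

lemma group_free: "group free"
proof (rule groupI)
  fix P Q R assume "P \<in> carrier free" "Q \<in> carrier free" "R \<in> carrier free"
  then show "P \<otimes>\<^bsub>free\<^esub> Q \<otimes>\<^bsub>free\<^esub> R = P \<otimes>\<^bsub>free\<^esub> (Q \<otimes>\<^bsub>free\<^esub> R)"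
    by (auto simp: carrier_free mult_free)
next
  fix P assume "P \<in> carrier free"
  then obtain v where v: "v \<in> syllables" "P = word_class v" by (auto simp: carrier_free)
  then have "word_class (inv_syllables v) \<otimes>\<^bsub>free\<^esub> P = \<one>\<^bsub>free\<^esub>"
    using inv_syllables_rel[of v] inv_syllables_in[of v]
    by (simp add: mult_free one_free word_class_eq_iff)
  then show "\<exists>Q\<in>carrier free. Q \<otimes>\<^bsub>free\<^esub> P = \<one>\<^bsub>free\<^esub>"
    using v inv_syllables_in by (auto simp: carrier_free)
qed (auto simp: carrier_free mult_free one_free)

lemma inv_free: "v \<in> syllables \<Longrightarrow> inv\<^bsub>free\<^esub> (word_class v) = word_class (inv_syllables v)"
  using inv_syllables_rel[of v] inv_syllables_in[of v]
  by (intro group.inv_equality[OF group_free])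
    (auto simp: carrier_free mult_free one_free word_class_eq_iff)

lemma act_word_inv_syllables:
  assumes "v \<in> syllables" "normal r"
  shows "act_word (act_word r v) (inv_syllables v) = r"
proof -
  have "word_class (v @ inv_syllables v) = word_class []"
    using group.r_inv[OF group_free, of "word_class v"] assms inv_syllables_in[of v]
    by (simp add: carrier_free inv_free mult_free one_free)
  then have "(v @ inv_syllables v, []) \<in> free_product_rel I G"
    using assms inv_syllables_in[of v] by (subst (asm) word_class_eq_iff) auto
  from act_word_free_product_rel[OF this assms(2)] show ?thesis by simp
qed

end

subsection \<open>The graph product\<close>

lemma (in group) normal_normal_closure:
  assumes "S \<subseteq> carrier G"
  shows "normal_closure G S \<lhd> G"
proof -
  let ?\<N> = "{N. N \<lhd> G \<and> S \<subseteq> N}"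
  have ne: "carrier G \<in> ?\<N>"
    using assms by (auto simp: normal_inv_iff subgroup_self)
  have "subgroup (\<Inter>?\<N>) G"
    using ne by (intro subgroups_Inter) (auto simp: normal_imp_subgroup)
  moreover have "x \<otimes> h \<otimes> inv x \<in> \<Inter>?\<N>" if "x \<in> carrier G" "h \<in> \<Inter>?\<N>" for x h
    using that normal_inv_iff by auto
  ultimately show ?thesis
    unfolding normal_closure_def normal_inv_iff by blast
qed

lemma subset_normal_closure: "S \<subseteq> normal_closure G S"
  by (auto simp: normal_closure_def)

lemma normal_closure_subset: "N \<lhd> G \<Longrightarrow> S \<subseteq> N \<Longrightarrow> normal_closure G S \<subseteq> N"
  by (auto simp: normal_closure_def)

context graph_of_groups begin

abbreviation relators :: "(nat \<times> 'a) list set set" where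
  "relators \<equiv> graph_product_relators I E G"

abbreviation relators_closure :: "(nat \<times> 'a) list set set" where
  "relators_closure \<equiv> normal_closure free relators"

abbreviation product :: "(nat \<times> 'a) list set set monoid" where
  "product \<equiv> graph_product I E G"

abbreviation incl :: "nat \<Rightarrow> 'a \<Rightarrow> (nat \<times> 'a) list set set" where
  "incl \<equiv> graph_product_incl I E G"

definition word_coset :: "(nat \<times> 'a) list \<Rightarrow> (nat \<times> 'a) list set set" where
  "word_coset v = relators_closure #>\<^bsub>free\<^esub> word_class v"

lemma relatorsE:
  assumes "x \<in> relators"
  obtains i j g h where "i \<in> I" "j \<in> I" "adj i j" "g \<in> carrier (G i)" "h \<in> carrier (G j)"
    "x = word_class ([(i, g)] @ [(j, h)] @ inv_syllables [(i, g)] @ inv_syllables [(j, h)])"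
proof -
  from assms obtain i j g h where *: "i \<in> I" "j \<in> I" "adj i j" "g \<in> carrier (G i)" "h \<in> carrier (G j)"
    "x = word_class [(i, g)] \<otimes>\<^bsub>free\<^esub> word_class [(j, h)] \<otimes>\<^bsub>free\<^esub> inv\<^bsub>free\<^esub> (word_class [(i, g)])
      \<otimes>\<^bsub>free\<^esub> inv\<^bsub>free\<^esub> (word_class [(j, h)])"
    unfolding graph_product_relators_def Let_def free_product_incl_def word_class_def adj_def by blast
  moreover have "inv_syllables [(i, g)] \<in> syllables" "inv_syllables [(j, h)] \<in> syllables"
    using * by (simp_all add: inv_syllables_in)
  ultimately show ?thesis using that by (simp add: inv_free mult_free)
qed

lemma relators_in: "relators \<subseteq> carrier free"
proof
  fix x assume "x \<in> relators"
  then show "x \<in> carrier free"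
    by (elim relatorsE) (simp add: carrier_free inv_syllables_in)
qed

lemma normal_relators_closure: "relators_closure \<lhd> free"
  using group.normal_normal_closure[OF group_free relators_in] .

text \<open>The elements of the free product that act trivially on all normal words form a normal
  subgroup, which contains the relators because syllables of adjacent vertices act by commuting
  maps.\<close>

lemma relators_closure_acts_trivially:
  assumes "P \<in> relators_closure" "normal r"
  obtains u where "u \<in> syllables" "P = word_class u" "act_word r u = r"
proof -
  let ?K = "{word_class u | u. u \<in> syllables \<and> (\<forall>r. normal r \<longrightarrow> act_word r u = r)}"
  have "?K \<lhd> free"
    unfolding group.normal_inv_iff[OF group_free]
  proof (intro conjI ballI)
    show "subgroup ?K free"
    proof (rule group.subgroupI[OF group_free])
      show "?K \<subseteq> carrier free" by (auto simp: carrier_free)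
      show "?K \<noteq> {}" by (auto intro!: exI[of _ "[]"])
    next
      fix P assume "P \<in> ?K"
      then obtain u where u: "u \<in> syllables" "P = word_class u" "\<And>r. normal r \<Longrightarrow> act_word r u = r"
        by blast
      have "act_word r (inv_syllables u) = r" if "normal r" for r
        using act_word_inv_syllables[OF u(1) that] u(3)[OF that] by simp
      then show "inv\<^bsub>free\<^esub> P \<in> ?K" using u inv_syllables_in by (auto simp: inv_free)
    next
      fix P Q assume "P \<in> ?K" "Q \<in> ?K"
      then obtain u v where "u \<in> syllables" "P = word_class u" "\<And>r. normal r \<Longrightarrow> act_word r u = r"
        "v \<in> syllables" "Q = word_class v" "\<And>r. normal r \<Longrightarrow> act_word r v = r"
        by blast
      then show "P \<otimes>\<^bsub>free\<^esub> Q \<in> ?K" by (auto simp: mult_free intro!: exI[of _ "u @ v"])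
    qed
    fix X P assume "X \<in> carrier free" "P \<in> ?K"
    then obtain x u where x: "x \<in> syllables" "X = word_class x"
      and u: "u \<in> syllables" "P = word_class u" "\<And>r. normal r \<Longrightarrow> act_word r u = r"
      by (auto simp: carrier_free)
    have "act_word r (x @ u @ inv_syllables x) = r" if "normal r" for r
      using u(3)[of "act_word r x"] act_word_inv_syllables[OF x(1) that] normal_act_word[OF that x(1)]
      by simp
    then show "X \<otimes>\<^bsub>free\<^esub> P \<otimes>\<^bsub>free\<^esub> inv\<^bsub>free\<^esub> X \<in> ?K"
      using x u inv_syllables_in[OF x(1)]
      by (auto simp: mult_free inv_free intro!: exI[of _ "x @ u @ inv_syllables x"])
  qed
  moreover have "relators \<subseteq> ?K"
  proof
    fix x assume "x \<in> relators"
    then obtain i j g h where ij: "i \<in> I" "j \<in> I" "adj i j" "g \<in> carrier (G i)" "h \<in> carrier (G j)"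
      and x: "x = word_class ([(i, g)] @ [(j, h)] @ inv_syllables [(i, g)] @ inv_syllables [(j, h)])"
      by (elim relatorsE)
    let ?u = "[(i, g)]" and ?v = "[(j, h)]"
    have uv: "?u \<in> syllables" "?v \<in> syllables" using ij by simp_all
    have "act_word r (?u @ ?v @ inv_syllables ?u @ inv_syllables ?v) = r" if r: "normal r" for r
    proof -
      have "act_word r (?u @ ?v) = act_word r (?v @ ?u)"
        using act_commute[OF r ij(3-5)] by simp
      then have "act_word r (?u @ ?v @ inv_syllables ?u @ inv_syllables ?v) =
        act_word (act_word (act_word (act_word r ?v) ?u) (inv_syllables ?u)) (inv_syllables ?v)"
        by simp
      also have "\<dots> = act_word (act_word r ?v) (inv_syllables ?v)"
        using act_word_inv_syllables[OF uv(1) normal_act_word[OF r uv(2)]] by simp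
      also have "\<dots> = r" using act_word_inv_syllables[OF uv(2) r] .
      finally show ?thesis .
    qed
    moreover have "?u @ ?v @ inv_syllables ?u @ inv_syllables ?v \<in> syllables"
      using uv inv_syllables_in by simp
    ultimately show "x \<in> ?K" using x by blast
  qed
  ultimately have "relators_closure \<subseteq> ?K" by (rule normal_closure_subset)
  then show ?thesis using assms that by blast
qed

lemma group_product: "group product"
  unfolding graph_product_def using normal.factorgroup_is_group[OF normal_relators_closure] .

lemma carrier_product: "carrier product = word_coset ` syllables"
  by (auto simp: graph_product_def FactGroup_def RCOSETS_def word_coset_def carrier_free)

lemma mult_product:
  assumes "v \<in> syllables" "w \<in> syllables"
  shows "word_coset v \<otimes>\<^bsub>product\<^esub> word_coset w = word_coset (v @ w)"
  using normal.rcos_sum[OF normal_relators_closure, of "word_class v" "word_class w"] assms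
  by (simp add: graph_product_def FactGroup_def word_coset_def carrier_free mult_free)

lemma one_product: "\<one>\<^bsub>product\<^esub> = word_coset []"
  using group.coset_mult_one[OF group_free subgroup.subset[OF normal_imp_subgroup[OF normal_relators_closure]]]
  by (simp add: graph_product_def FactGroup_def word_coset_def one_free)

lemma incl_eq: "incl i g = word_coset [(i, g)]"
  by (simp add: graph_product_incl_def word_coset_def word_class_def free_product_incl_def)

text \<open>The action on normal words depends only on the element of the graph product.\<close>

lemma word_coset_eq:
  assumes "word_coset v = word_coset w" "v \<in> syllables" "w \<in> syllables" "normal r"
  shows "act_word r v = act_word r w"
proof -
  have "word_class v \<in> word_coset v"
    using group.rcos_self[OF group_free, of "word_class v"] assms(2)
      normal_imp_subgroup[OF normal_relators_closure]
    by (simp add: word_coset_def carrier_free)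
  then obtain P where P: "P \<in> relators_closure" "word_class v = P \<otimes>\<^bsub>free\<^esub> word_class w"
    unfolding assms(1) by (auto simp: word_coset_def r_coset_def)
  from relators_closure_acts_trivially[OF P(1) assms(4)] obtain u
    where u: "u \<in> syllables" "P = word_class u" "act_word r u = r" .
  have "(v, u @ w) \<in> free_product_rel I G"
    using P u assms by (simp add: mult_free word_class_eq_iff)
  from act_word_free_product_rel[OF this assms(4)] show ?thesis using u by simp
qed

definition nf :: "(nat \<times> 'a) list set set \<Rightarrow> (nat \<times> 'a) list" where
  "nf x = act_word [] (SOME v. v \<in> syllables \<and> x = word_coset v)"

lemma nf_word_coset: "v \<in> syllables \<Longrightarrow> nf (word_coset v) = act_word [] v"
proof -
  assume v: "v \<in> syllables"
  let ?P = "\<lambda>w. w \<in> syllables \<and> word_coset v = word_coset w"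
  have "?P (SOME w. ?P w)" using v by (intro someI[of ?P v]) simp
  then show ?thesis unfolding nf_def using word_coset_eq[of v "SOME w. ?P w" "[]"] v by simp
qed

lemma incl_commute:
  assumes "adj i j" "g \<in> carrier (G i)" "h \<in> carrier (G j)"
  shows "incl i g \<otimes>\<^bsub>product\<^esub> incl j h = incl j h \<otimes>\<^bsub>product\<^esub> incl i g"
proof -
  have ij: "i \<in> I" "j \<in> I" using adj_in assms by auto
  interpret F: group free by (rule group_free)
  let ?a = "word_class [(i, g)]" and ?b = "word_class [(j, h)]"
  let ?c = "?a \<otimes>\<^bsub>free\<^esub> ?b \<otimes>\<^bsub>free\<^esub> inv\<^bsub>free\<^esub> ?a \<otimes>\<^bsub>free\<^esub> inv\<^bsub>free\<^esub> ?b"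
  have ab: "?a \<in> carrier free" "?b \<in> carrier free" using assms ij by (auto simp: carrier_free)
  have "?c \<in> relators"
    using ij assms unfolding graph_product_relators_def Let_def free_product_incl_def word_class_def adj_def
    by blast
  then have c: "?c \<in> relators_closure" by (rule subsetD[OF subset_normal_closure])
  have sub: "subgroup relators_closure free" using normal_imp_subgroup[OF normal_relators_closure] .
  have eq: "?c \<otimes>\<^bsub>free\<^esub> (?b \<otimes>\<^bsub>free\<^esub> ?a) = ?a \<otimes>\<^bsub>free\<^esub> ?b"
  proof -
    have "inv\<^bsub>free\<^esub> ?b \<otimes>\<^bsub>free\<^esub> (?b \<otimes>\<^bsub>free\<^esub> ?a) = ?a"
      using ab F.m_assoc[of "inv\<^bsub>free\<^esub> ?b" ?b ?a] by simp
    moreover have "?c \<otimes>\<^bsub>free\<^esub> (?b \<otimes>\<^bsub>free\<^esub> ?a) = ?a \<otimes>\<^bsub>free\<^esub> ?b \<otimes>\<^bsub>free\<^esub> (inv\<^bsub>free\<^esub> ?a \<otimes>\<^bsub>free\<^esub>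
        (inv\<^bsub>free\<^esub> ?b \<otimes>\<^bsub>free\<^esub> (?b \<otimes>\<^bsub>free\<^esub> ?a)))"
      using ab by (simp only: F.m_assoc F.m_closed F.inv_closed)
    ultimately show ?thesis using ab by simp
  qed
  have "c' \<in> carrier free \<Longrightarrow> c' \<in> relators_closure \<Longrightarrow> x \<in> carrier free \<Longrightarrow>
      relators_closure #>\<^bsub>free\<^esub> (c' \<otimes>\<^bsub>free\<^esub> x) = relators_closure #>\<^bsub>free\<^esub> x" for c' x
    using F.coset_mult_assoc[of relators_closure c' x] F.coset_join2[OF _ sub, of c']
      subgroup.subset[OF sub] by simp
  from this[OF _ c, of "?b \<otimes>\<^bsub>free\<^esub> ?a"]
  have "relators_closure #>\<^bsub>free\<^esub> (?a \<otimes>\<^bsub>free\<^esub> ?b) = relators_closure #>\<^bsub>free\<^esub> (?b \<otimes>\<^bsub>free\<^esub> ?a)"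
    unfolding eq using ab by simp
  then have "word_coset [(i, g), (j, h)] = word_coset [(j, h), (i, g)]"
    using ij assms by (simp add: word_coset_def mult_free)
  then show ?thesis
    using ij assms by (simp add: incl_eq mult_product)
qed

lemma incl_mult:
  assumes "i \<in> I" "g \<in> carrier (G i)" "h \<in> carrier (G i)"
  shows "incl i g \<otimes>\<^bsub>product\<^esub> incl i h = incl i (g \<otimes>\<^bsub>G i\<^esub> h)"
proof -
  have "word_class [(i, g), (i, h)] = word_class [(i, g \<otimes>\<^bsub>G i\<^esub> h)]"
    using free_product_rel.mult[of "[]" I G "[]" i g h] assms by (simp add: word_class_eq_iff)
  then have "word_coset [(i, g), (i, h)] = word_coset [(i, g \<otimes>\<^bsub>G i\<^esub> h)]"
    by (simp add: word_coset_def)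
  then show ?thesis using assms by (simp add: incl_eq mult_product)
qed

end

text \<open>All that is needed of the graph product: a group generated by the vertex groups in which
  adjacent vertex groups commute, together with a normal form on which right multiplication by a
  syllable is \<open>act\<close>.\<close>

locale graph_product_nf = graph_of_groups I E G + H: group H
  for I :: "nat set" and E :: "nat set set" and G :: "nat \<Rightarrow> ('a, 'm) monoid_scheme"
    and H :: "'h monoid" +
  fixes \<iota> :: "nat \<Rightarrow> 'a \<Rightarrow> 'h" and nform :: "'h \<Rightarrow> (nat \<times> 'a) list"
  assumes incl_closed: "i \<in> I \<Longrightarrow> g \<in> carrier (G i) \<Longrightarrow> \<iota> i g \<in> carrier H"
    and incl_hom: "i \<in> I \<Longrightarrow> g \<in> carrier (G i) \<Longrightarrow> h \<in> carrier (G i) \<Longrightarrow>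
      \<iota> i g \<otimes>\<^bsub>H\<^esub> \<iota> i h = \<iota> i (g \<otimes>\<^bsub>G i\<^esub> h)"
    and incl_adj: "adj i j \<Longrightarrow> g \<in> carrier (G i) \<Longrightarrow> h \<in> carrier (G j) \<Longrightarrow>
      \<iota> i g \<otimes>\<^bsub>H\<^esub> \<iota> j h = \<iota> j h \<otimes>\<^bsub>H\<^esub> \<iota> i g"
    and generated [consumes 1]: "x \<in> carrier H \<Longrightarrow> P \<one>\<^bsub>H\<^esub> \<Longrightarrow>
      (\<And>x i g. x \<in> carrier H \<Longrightarrow> P x \<Longrightarrow> i \<in> I \<Longrightarrow> g \<in> carrier (G i) \<Longrightarrow> P (x \<otimes>\<^bsub>H\<^esub> \<iota> i g)) \<Longrightarrow> P x"
    and nform_one: "nform \<one>\<^bsub>H\<^esub> = []"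
    and nform_mult: "x \<in> carrier H \<Longrightarrow> i \<in> I \<Longrightarrow> g \<in> carrier (G i) \<Longrightarrow>
      nform (x \<otimes>\<^bsub>H\<^esub> \<iota> i g) = act (nform x) i g"

theorem (in graph_of_groups) graph_product_nf: "graph_product_nf I E G product incl nf"
proof -
  interpret H: group product by (rule group_product)
  show ?thesis
  proof unfold_locales
    show "incl i g \<in> carrier product" if "i \<in> I" "g \<in> carrier (G i)" for i g
      using that by (auto simp: incl_eq carrier_product)
    show "nf \<one>\<^bsub>product\<^esub> = []" by (simp add: one_product nf_word_coset)
    show "nf (x \<otimes>\<^bsub>product\<^esub> incl i g) = act (nf x) i g"
      if "x \<in> carrier product" "i \<in> I" "g \<in> carrier (G i)" for x i g
      using that by (auto simp: incl_eq carrier_product mult_product nf_word_coset)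
    show "P x" if "x \<in> carrier product" and one: "P \<one>\<^bsub>product\<^esub>" and
      step: "\<And>x i g. x \<in> carrier product \<Longrightarrow> P x \<Longrightarrow> i \<in> I \<Longrightarrow> g \<in> carrier (G i) \<Longrightarrow>
        P (x \<otimes>\<^bsub>product\<^esub> incl i g)" for x P
    proof -
      have "P (word_coset v)" if "v \<in> syllables" for v
        using that
      proof (induction v rule: rev_induct)
        case Nil
        then show ?case using one by (simp add: one_product)
      next
        case (snoc y v)
        obtain i g where "y = (i, g)" by (cases y)
        then show ?case using snoc step[of "word_coset v" i g]
          by (simp add: incl_eq mult_product carrier_product)
      qed
      then show ?thesis using that(1) by (auto simp: carrier_product)
    qed
    show "incl i g \<otimes>\<^bsub>product\<^esub> incl i h = incl i (g \<otimes>\<^bsub>G i\<^esub> h)"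
      if "i \<in> I" "g \<in> carrier (G i)" "h \<in> carrier (G i)" for i g h
      using that by (rule incl_mult)
    show "incl i g \<otimes>\<^bsub>product\<^esub> incl j h = incl j h \<otimes>\<^bsub>product\<^esub> incl i g"
      if "adj i j" "g \<in> carrier (G i)" "h \<in> carrier (G j)" for i j g h
      using that by (rule incl_commute)
  qed
qed

section \<open>Regular languages by finite right congruences\<close>

text \<open>The rules that reduce \<open>w \<in> lists \<Sigma>\<close> to a statement about the letters of \<open>w\<close> are switched off
  where words are treated as a whole.\<close>

context
  notes in_listsD [rule del] and in_listsI [rule del]
begin

text \<open>The kernel of \<open>f\<close> is a right congruence of finite index. The values of \<open>f\<close> can be of any type, so
  that the states of an automaton may be tuples of data about the word that has been read.\<close>

definition finite_state :: "'b set \<Rightarrow> ('b list \<Rightarrow> 'c) \<Rightarrow> bool" where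
  "finite_state \<Sigma> f \<longleftrightarrow> finite (f ` lists \<Sigma>) \<and>
    (\<forall>u\<in>lists \<Sigma>. \<forall>v\<in>lists \<Sigma>. \<forall>b\<in>\<Sigma>. f u = f v \<longrightarrow> f (u @ [b]) = f (v @ [b]))"

definition saturates :: "'b set \<Rightarrow> ('b list \<Rightarrow> 'c) \<Rightarrow> 'b list set \<Rightarrow> bool" where
  "saturates \<Sigma> f L \<longleftrightarrow> (\<forall>u\<in>lists \<Sigma>. \<forall>v\<in>lists \<Sigma>. f u = f v \<longrightarrow> (u \<in> L \<longleftrightarrow> v \<in> L))"

lemma finite_stateI:
  assumes "finite (f ` lists \<Sigma>)"
    "\<And>u v b. u \<in> lists \<Sigma> \<Longrightarrow> v \<in> lists \<Sigma> \<Longrightarrow> b \<in> \<Sigma> \<Longrightarrow> f u = f v \<Longrightarrow> f (u @ [b]) = f (v @ [b])"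
  shows "finite_state \<Sigma> f"
  unfolding finite_state_def using assms by blast

lemma finite_state_finite: "finite_state \<Sigma> f \<Longrightarrow> finite (f ` lists \<Sigma>)"
  unfolding finite_state_def by blast

lemma finite_stateD:
  "finite_state \<Sigma> f \<Longrightarrow> u \<in> lists \<Sigma> \<Longrightarrow> v \<in> lists \<Sigma> \<Longrightarrow> b \<in> \<Sigma> \<Longrightarrow> f u = f v \<Longrightarrow> f (u @ [b]) = f (v @ [b])"
  unfolding finite_state_def by blast

lemma saturatesI:
  assumes "\<And>u v. u \<in> lists \<Sigma> \<Longrightarrow> v \<in> lists \<Sigma> \<Longrightarrow> f u = f v \<Longrightarrow> u \<in> L \<Longrightarrow> v \<in> L"
  shows "saturates \<Sigma> f L"
  unfolding saturates_def using assms by metis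

lemma saturatesD:
  "saturates \<Sigma> f L \<Longrightarrow> u \<in> lists \<Sigma> \<Longrightarrow> v \<in> lists \<Sigma> \<Longrightarrow> f u = f v \<Longrightarrow> u \<in> L \<Longrightarrow> v \<in> L"
  unfolding saturates_def by blast

lemma finite_state_append:
  assumes "finite_state \<Sigma> f" "u \<in> lists \<Sigma>" "v \<in> lists \<Sigma>" "w \<in> lists \<Sigma>" "f u = f v"
  shows "f (u @ w) = f (v @ w)"
  using assms(4)
proof (induction w rule: rev_induct)
  case (snoc b w)
  then have "u @ w \<in> lists \<Sigma>" "v @ w \<in> lists \<Sigma>" "b \<in> \<Sigma>" "f (u @ w) = f (v @ w)"
    using assms by auto
  then have "f ((u @ w) @ [b]) = f ((v @ w) @ [b])"
    by (intro finite_stateD[OF assms(1)])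
  then show ?case by simp
qed (use assms in simp)

lemma finite_state_Pair:
  assumes "finite_state \<Sigma> f" "finite_state \<Sigma> g"
  shows "finite_state \<Sigma> (\<lambda>u. (f u, g u))"
proof -
  have "(\<lambda>u. (f u, g u)) ` lists \<Sigma> \<subseteq> (f ` lists \<Sigma>) \<times> (g ` lists \<Sigma>)" by auto
  moreover have "finite ((f ` lists \<Sigma>) \<times> (g ` lists \<Sigma>))"
    using finite_state_finite[OF assms(1)] finite_state_finite[OF assms(2)] by (rule finite_cartesian_product)
  ultimately have "finite ((\<lambda>u. (f u, g u)) ` lists \<Sigma>)" by (rule finite_subset)
  then show ?thesis
  proof (rule finite_stateI)
    fix u v b assume *: "u \<in> lists \<Sigma>" "v \<in> lists \<Sigma>" "b \<in> \<Sigma>" "(f u, g u) = (f v, g v)"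
    then show "(f (u @ [b]), g (u @ [b])) = (f (v @ [b]), g (v @ [b]))"
      using finite_stateD[OF assms(1) *(1-3)] finite_stateD[OF assms(2) *(1-3)] by simp
  qed
qed

text \<open>A machine with infinitely many states still yields a right congruence of finite index if its
  states can be collapsed to finitely many ones in a way that is compatible with its steps.\<close>

lemma finite_state_foldl:
  assumes init: "P s\<^sub>0" and step: "\<And>s b. P s \<Longrightarrow> b \<in> \<Sigma> \<Longrightarrow> P (step s b)"
    and fin: "finite (c ` {s. P s})"
    and cong: "\<And>s t b. P s \<Longrightarrow> P t \<Longrightarrow> b \<in> \<Sigma> \<Longrightarrow> c s = c t \<Longrightarrow> c (step s b) = c (step t b)"
  shows "finite_state \<Sigma> (\<lambda>w. c (foldl step s\<^sub>0 w))"
proof -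
  have P: "P (foldl step s\<^sub>0 w)" if "w \<in> lists \<Sigma>" for w
    using that init by (induction w rule: rev_induct) (auto intro: step)
  have "(\<lambda>w. c (foldl step s\<^sub>0 w)) ` lists \<Sigma> \<subseteq> c ` {s. P s}" using P by blast
  then have "finite ((\<lambda>w. c (foldl step s\<^sub>0 w)) ` lists \<Sigma>)" using fin by (rule finite_subset)
  then show ?thesis
  proof (rule finite_stateI)
    fix u v b assume *: "u \<in> lists \<Sigma>" "v \<in> lists \<Sigma>" "b \<in> \<Sigma>" "c (foldl step s\<^sub>0 u) = c (foldl step s\<^sub>0 v)"
    show "c (foldl step s\<^sub>0 (u @ [b])) = c (foldl step s\<^sub>0 (v @ [b]))"
      using cong[OF P[OF *(1)] P[OF *(2)] *(3,4)] by simp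
  qed
qed

text \<open>The values of \<open>f\<close> are the states of an automaton for \<open>L\<close>; the step from a state is computed with an
  arbitrary word \<open>rep q\<close> that leads to it.\<close>

theorem regular_languageI:
  assumes f: "finite_state \<Sigma> f" and sat: "saturates \<Sigma> f L" and L: "L \<subseteq> lists \<Sigma>"
  shows "regular_language \<Sigma> L"
proof -
  let ?S = "f ` lists \<Sigma>"
  have "finite ?S" using f by (simp add: finite_state_def)
  from finite_imp_inj_to_nat_seg[OF this] obtain e :: "'b \<Rightarrow> nat" where e: "inj_on e ?S" by blast
  define rep where "rep q = (SOME u. u \<in> lists \<Sigma> \<and> e (f u) = q)" for q
  define \<delta> where "\<delta> q b = e (f (rep q @ [b]))" for q b
  have rep: "rep (e (f u)) \<in> lists \<Sigma> \<and> f (rep (e (f u))) = f u" if "u \<in> lists \<Sigma>" for u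
  proof -
    have "rep (e (f u)) \<in> lists \<Sigma> \<and> e (f (rep (e (f u)))) = e (f u)"
      unfolding rep_def by (rule someI[of _ u]) (use that in simp)
    then show ?thesis using inj_onD[OF e] that by blast
  qed
  have step: "\<delta> (e (f u)) b = e (f (u @ [b]))" if "u \<in> lists \<Sigma>" "b \<in> \<Sigma>" for u b
    unfolding \<delta>_def using finite_stateD[OF f, of "rep (e (f u))" u b] rep[OF that(1)] that by simp
  have fold: "foldl \<delta> (e (f [])) w = e (f w)" if "w \<in> lists \<Sigma>" for w
    using that
  proof (induction w rule: rev_induct)
    case (snoc b w)
    then show ?case using step[of w b] by simp
  qed simp
  let ?Q = "e ` ?S" and ?F = "e ` f ` L"
  have "L = {w \<in> lists \<Sigma>. foldl \<delta> (e (f [])) w \<in> ?F}"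
  proof (intro subset_antisym subsetI)
    fix w assume "w \<in> L"
    then show "w \<in> {w \<in> lists \<Sigma>. foldl \<delta> (e (f [])) w \<in> ?F}" using L fold by auto
  next
    fix w assume "w \<in> {w \<in> lists \<Sigma>. foldl \<delta> (e (f [])) w \<in> ?F}"
    then obtain v where v: "w \<in> lists \<Sigma>" "v \<in> L" "e (f w) = e (f v)" using fold by auto
    then have "f w = f v" using inj_onD[OF e] L by blast
    then show "w \<in> L" using saturatesD[OF sat, of v w] v L by auto
  qed
  moreover have "\<forall>q\<in>?Q. \<forall>b\<in>\<Sigma>. \<delta> q b \<in> ?Q"
  proof (intro ballI)
    fix q b assume "q \<in> ?Q" "b \<in> \<Sigma>"
    then obtain u where "u \<in> lists \<Sigma>" "q = e (f u)" by blast
    moreover from this have "u @ [b] \<in> lists \<Sigma>" using \<open>b \<in> \<Sigma>\<close> by simp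
    ultimately show "\<delta> q b \<in> ?Q" using step \<open>b \<in> \<Sigma>\<close> by simp
  qed
  moreover have "finite ?Q" "e (f []) \<in> ?Q" "?F \<subseteq> ?Q"
    using \<open>finite ?S\<close> L by auto
  ultimately show ?thesis unfolding regular_language_def by blast
qed

lemma regular_languageE:
  assumes "regular_language \<Sigma> L"
  obtains f :: "'b list \<Rightarrow> nat" where "finite_state \<Sigma> f" "saturates \<Sigma> f L" "L \<subseteq> lists \<Sigma>"
proof -
  from assms obtain Q q\<^sub>0 F \<delta> where Q: "finite (Q :: nat set)" "q\<^sub>0 \<in> Q" "\<forall>q\<in>Q. \<forall>x\<in>\<Sigma>. \<delta> q x \<in> Q"
      and L: "L = {w \<in> lists \<Sigma>. foldl \<delta> q\<^sub>0 w \<in> F}"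
    unfolding regular_language_def by blast
  have "finite_state \<Sigma> (\<lambda>w. id (foldl \<delta> q\<^sub>0 w))"
    by (rule finite_state_foldl[where P = "\<lambda>q. q \<in> Q"]) (use Q in simp_all)
  moreover have "saturates \<Sigma> (foldl \<delta> q\<^sub>0) L"
    by (rule saturatesI) (simp add: L)
  moreover have "L \<subseteq> lists \<Sigma>" unfolding L by blast
  ultimately show ?thesis using that[of "foldl \<delta> q\<^sub>0"] by simp
qed

lemma regular_language_Un:
  assumes "regular_language \<Sigma> L" "regular_language \<Sigma> M"
  shows "regular_language \<Sigma> (L \<union> M)"
proof -
  obtain f :: "'a list \<Rightarrow> nat" where f: "finite_state \<Sigma> f" "saturates \<Sigma> f L" "L \<subseteq> lists \<Sigma>"
    using assms(1) by (rule regular_languageE)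
  obtain g :: "'a list \<Rightarrow> nat" where g: "finite_state \<Sigma> g" "saturates \<Sigma> g M" "M \<subseteq> lists \<Sigma>"
    using assms(2) by (rule regular_languageE)
  show ?thesis
  proof (rule regular_languageI[OF finite_state_Pair[OF f(1) g(1)]])
    show "saturates \<Sigma> (\<lambda>u. (f u, g u)) (L \<union> M)"
      by (rule saturatesI) (use saturatesD[OF f(2)] saturatesD[OF g(2)] in blast)
    show "L \<union> M \<subseteq> lists \<Sigma>" using f(3) g(3) by blast
  qed
qed

lemma regular_language_UN:
  assumes "finite S" "\<And>s. s \<in> S \<Longrightarrow> regular_language \<Sigma> (L s)"
  shows "regular_language \<Sigma> (\<Union>s\<in>S. L s)"
  using assms
proof (induction S)
  case empty
  have "regular_language \<Sigma> {}"
    by (rule regular_languageI[of _ "\<lambda>_. ()"]) (auto simp: finite_state_def saturates_def)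
  then show ?case by simp
qed (simp add: regular_language_Un)

lemma regular_language_map:
  assumes h: "inj_on h \<Sigma>" and L: "regular_language \<Sigma> L"
  shows "regular_language (h ` \<Sigma>) (map h ` L)"
proof -
  obtain f :: "'a list \<Rightarrow> nat" where f: "finite_state \<Sigma> f" "saturates \<Sigma> f L" "L \<subseteq> lists \<Sigma>"
    using L by (rule regular_languageE)
  let ?k = "inv_into \<Sigma> h"
  have k: "map ?k w \<in> lists \<Sigma> \<and> map h (map ?k w) = w" if "w \<in> lists (h ` \<Sigma>)" for w
    using that by (induction w) (auto simp: inv_into_into f_inv_into_f)
  have kh: "map ?k (map h w) = w" if "w \<in> lists \<Sigma>" for w
    using that h by (induction w) auto
  have mem: "w \<in> map h ` L \<longleftrightarrow> map ?k w \<in> L" if "w \<in> lists (h ` \<Sigma>)" for w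
  proof
    assume "w \<in> map h ` L"
    then show "map ?k w \<in> L" using kh f(3) by auto
  next
    assume "map ?k w \<in> L"
    then show "w \<in> map h ` L" using k[OF that] by (metis image_eqI)
  qed
  show ?thesis
  proof (rule regular_languageI)
    have "(\<lambda>w. f (map ?k w)) ` lists (h ` \<Sigma>) \<subseteq> f ` lists \<Sigma>" using k by blast
    then have "finite ((\<lambda>w. f (map ?k w)) ` lists (h ` \<Sigma>))"
      using finite_state_finite[OF f(1)] by (rule finite_subset)
    then show "finite_state (h ` \<Sigma>) (\<lambda>w. f (map ?k w))"
    proof (rule finite_stateI)
      fix u v b assume *: "u \<in> lists (h ` \<Sigma>)" "v \<in> lists (h ` \<Sigma>)" "b \<in> h ` \<Sigma>" "f (map ?k u) = f (map ?k v)"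
      show "f (map ?k (u @ [b])) = f (map ?k (v @ [b]))"
        using finite_stateD[OF f(1) _ _ inv_into_into[OF *(3)] *(4)] k[OF *(1)] k[OF *(2)] by simp
    qed
    show "saturates (h ` \<Sigma>) (\<lambda>w. f (map ?k w)) (map h ` L)"
    proof (rule saturatesI)
      fix u v assume *: "u \<in> lists (h ` \<Sigma>)" "v \<in> lists (h ` \<Sigma>)" "f (map ?k u) = f (map ?k v)" "u \<in> map h ` L"
      show "v \<in> map h ` L"
        using saturatesD[OF f(2) _ _ *(3)] k[OF *(1)] k[OF *(2)] mem[OF *(1)] mem[OF *(2)] *(4) by simp
    qed
    have "map h w \<in> lists (h ` \<Sigma>)" if "w \<in> lists \<Sigma>" for w
      using that by (induction w) auto
    then show "map h ` L \<subseteq> lists (h ` \<Sigma>)" using f(3) by blast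
  qed
qed

section \<open>Synchronously regular sets with two bounded components\<close>

definition padded_nth :: "'a list \<Rightarrow> nat \<Rightarrow> 'a option" where
  "padded_nth u m = (if m < length u then Some (u ! m) else None)"

definition padded_rows :: "'a list \<Rightarrow> 'a list \<Rightarrow> 'a list \<Rightarrow> nat \<Rightarrow> nat \<Rightarrow> 'a option list list" where
  "padded_rows u v x m n = map (\<lambda>k. [padded_nth u k, padded_nth v k, padded_nth x k]) [m..<n]"

lemma pad_word_triple:
  "pad_word [u, v, x] = padded_rows u v x 0 (max (length u) (max (length v) (length x)))"
  by (simp add: pad_word_def padded_rows_def padded_nth_def)

lemma padded_nth_min: "length y \<le> k \<Longrightarrow> padded_nth y (min m k) = padded_nth y m"
  by (auto simp: padded_nth_def min_def)

lemma padded_rows_Suc: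
  "m \<le> n \<Longrightarrow> padded_rows u v x m (Suc n) =
    padded_rows u v x m n @ [[padded_nth u n, padded_nth v n, padded_nth x n]]"
  by (simp add: padded_rows_def)

lemma padded_rows_butlast:
  "padded_rows (u @ [c]) v x 0 (length u) = padded_rows u v x 0 (length u)"
  by (auto simp: padded_rows_def padded_nth_def nth_append)

lemma length_padded_rows [simp]: "length (padded_rows u v x m n) = n - m"
  by (simp add: padded_rows_def)

lemma padded_rows_split:
  assumes "m \<le> n" "n \<le> k"
  shows "padded_rows u v x m k = padded_rows u v x m n @ padded_rows u v x n k"
proof -
  have "[m..<k] = [m..<n] @ [n..<k]" using upt_add_eq_append[of m n "k - n"] assms by simp
  then show ?thesis by (simp add: padded_rows_def)
qed

lemma map_padded_nth:
  "length u \<le> n \<Longrightarrow> map the (takeWhile (\<lambda>l. l \<noteq> None) (map (padded_nth u) [0..<n])) = u"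
proof -
  assume n: "length u \<le> n"
  then have "[0..<n] = [0..<length u] @ [length u..<n]" using upt_add_eq_append[of 0 "length u" "n - length u"] by simp
  then have "map (padded_nth u) [0..<n] = map (padded_nth u) [0..<length u] @ map (padded_nth u) [length u..<n]"
    by simp
  moreover have "map (padded_nth u) [0..<length u] = map Some u"
    by (rule nth_equalityI) (auto simp: padded_nth_def)
  moreover have "map (padded_nth u) [length u..<n] = replicate (n - length u) None"
    by (rule nth_equalityI) (auto simp: padded_nth_def)
  ultimately show ?thesis by (simp add: takeWhile_append comp_def map_idI)
qed

lemma padded_rows_inject:
  assumes "padded_rows u v x 0 n = padded_rows u' v' x' 0 m"
    "length u \<le> n" "length v \<le> n" "length x \<le> n" "length u' \<le> m" "length v' \<le> m" "length x' \<le> m"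
  shows "u = u' \<and> v = v' \<and> x = x'"
proof -
  define column where
    "column i r = map the (takeWhile (\<lambda>l. l \<noteq> None) (map (\<lambda>l. l ! i) r))" for i and r :: "'a option list list"
  have "column 0 (padded_rows u v x 0 n) = u" "column 1 (padded_rows u v x 0 n) = v"
    "column 2 (padded_rows u v x 0 n) = x"
    if "length u \<le> n" "length v \<le> n" "length x \<le> n" for u v x n
    using map_padded_nth[OF that(1)] map_padded_nth[OF that(2)] map_padded_nth[OF that(3)]
    by (simp_all add: padded_rows_def column_def comp_def)
  from this[OF assms(2-4)] this[OF assms(5-7)] show ?thesis using assms(1) by simp
qed

lemma pad_word_inject:
  assumes "length us = 3" "pad_word us = pad_word [u, v, x]"
  shows "us = [u, v, x]"
proof -
  obtain u' v' x' where us: "us = [u', v', x']" using assms(1)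
    by (auto simp: numeral_3_eq_3 length_Suc_conv)
  have "u' = u \<and> v' = v \<and> x' = x"
    by (rule padded_rows_inject[OF assms(2)[unfolded us pad_word_triple]]) simp_all
  then show ?thesis using us by simp
qed

lemma row_in_padded_alphabet:
  "u \<in> lists A \<Longrightarrow> v \<in> lists A \<Longrightarrow> x \<in> lists A \<Longrightarrow> k < max (length u) (max (length v) (length x)) \<Longrightarrow>
    [padded_nth u k, padded_nth v k, padded_nth x k] \<in> padded_alphabet 3 A"
  by (auto simp: padded_alphabet_def padded_nth_def numeral_3_eq_3 in_lists_conv_set)

lemma pad_word_in_lists:
  "u \<in> lists A \<Longrightarrow> v \<in> lists A \<Longrightarrow> x \<in> lists A \<Longrightarrow> pad_word [u, v, x] \<in> lists (padded_alphabet 3 A)"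
  using row_in_padded_alphabet[of u A v x] by (auto simp: pad_word_triple padded_rows_def intro!: in_listsI)

text \<open>Beyond the bounded components an automaton for the padded triples only reads letters of
  \<open>u\<close>, so it can be fed from \<open>u\<close> alone if the position is remembered up to that bound.\<close>

lemma regular_language_slice:
  assumes reg: "synchronously_regular 3 A M" and M: "\<forall>us\<in>M. length us = 3"
    and a: "a \<in> A" and x: "x \<in> lists A"
  shows "regular_language A {u \<in> lists A. [u, [a], x] \<in> M}" (is "regular_language A ?L")
proof -
  let ?\<Sigma> = "padded_alphabet 3 A"
  obtain f :: "'a option list list \<Rightarrow> nat"
    where f: "finite_state ?\<Sigma> f" "saturates ?\<Sigma> f (pad_word ` M)"
    using reg unfolding synchronously_regular_def by (rule regular_languageE)
  define K where "K = max 1 (length x)"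
  let ?pre = "\<lambda>u. padded_rows u [a] x 0 (length u)"
  have pre: "?pre u \<in> lists ?\<Sigma>" if "u \<in> lists A" for u
    using row_in_padded_alphabet[OF that, of "[a]" x] a x by (auto simp: padded_rows_def intro!: in_listsI)
  have tail_eq: "padded_rows u [a] x (length u) k = padded_rows [] [a] x (length u) k" for u k
    unfolding padded_rows_def by (rule map_cong) (simp_all add: padded_nth_def)
  have pad: "pad_word [u, [a], x] = ?pre u @ padded_rows [] [a] x (min (length u) K) K" for u
  proof -
    have "pad_word [u, [a], x] = padded_rows u [a] x 0 (max (length u) K)"
      by (simp add: pad_word_triple K_def)
    also have "\<dots> = ?pre u @ padded_rows [] [a] x (length u) (max (length u) K)"
      by (simp add: padded_rows_split[of 0 "length u" "max (length u) K"] tail_eq)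
    also have "padded_rows [] [a] x (length u) (max (length u) K) =
        padded_rows [] [a] x (min (length u) K) K"
      by (cases "length u \<le> K") (simp_all add: padded_rows_def)
    finally show ?thesis .
  qed
  have tail: "padded_rows [] [a] x k K \<in> lists ?\<Sigma>" for k
    using row_in_padded_alphabet[of "[]" A "[a]" x] a x
    by (auto simp: padded_rows_def K_def intro!: in_listsI)
  let ?g = "\<lambda>u. (min (length u) K, f (?pre u))"
  have snoc: "?pre (u @ [b]) = ?pre u @ [[Some b, padded_nth [a] (min (length u) K), padded_nth x (min (length u) K)]]"
    for u b
    using padded_rows_Suc[of 0 "length u" "u @ [b]" "[a]" x]
    by (simp add: padded_rows_butlast padded_nth_min K_def) (simp add: padded_nth_def)
  show ?thesis
  proof (rule regular_languageI)
    have "?g ` lists A \<subseteq> {..K} \<times> f ` lists ?\<Sigma>" using pre by (intro image_subsetI) simp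
    moreover have "finite ({..K} \<times> f ` lists ?\<Sigma>)"
      using finite_state_finite[OF f(1)] by simp
    ultimately have "finite (?g ` lists A)" by (rule finite_subset)
    then show "finite_state A ?g"
    proof (rule finite_stateI)
      fix u v b assume that: "u \<in> lists A" "v \<in> lists A" "b \<in> A" "?g u = ?g v"
      have "[Some b, padded_nth [a] k, padded_nth x k] \<in> ?\<Sigma>" for k
        using a x that(3) by (auto simp: padded_alphabet_def padded_nth_def numeral_3_eq_3 in_lists_conv_set)
      then have "f (?pre (u @ [b])) = f (?pre (v @ [b]))"
        unfolding snoc using finite_stateD[OF f(1) pre[OF that(1)] pre[OF that(2)]] that(4) by simp
      moreover have "min (Suc (length u)) K = min (Suc (length v)) K"
        using that(4) by (auto simp: min_def split: if_splits)
      ultimately show "?g (u @ [b]) = ?g (v @ [b])" by simp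
    qed
    show "saturates A ?g ?L"
    proof (rule saturatesI)
      fix u v assume uv: "u \<in> lists A" "v \<in> lists A" "?g u = ?g v" and u: "u \<in> ?L"
      have "f (pad_word [u, [a], x]) = f (pad_word [v, [a], x])"
        unfolding pad using uv finite_state_append[OF f(1) pre[OF uv(1)] pre[OF uv(2)] tail] by simp
      moreover have "pad_word [u, [a], x] \<in> lists ?\<Sigma>" "pad_word [v, [a], x] \<in> lists ?\<Sigma>"
        using uv a x by (auto intro!: pad_word_in_lists)
      moreover have "pad_word [u, [a], x] \<in> pad_word ` M" using u by blast
      ultimately have "pad_word [v, [a], x] \<in> pad_word ` M"
        using saturatesD[OF f(2)] by blast
      then obtain us where us: "us \<in> M" "pad_word us = pad_word [v, [a], x]" by (metis image_iff)
      then have "us = [v, [a], x]" using M pad_word_inject by blast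
      then show "v \<in> ?L" using us uv by simp
    qed
    show "?L \<subseteq> lists A" by auto
  qed
qed

text \<open>A machine that compares the second and the third component of a padded triple with \<open>[a]\<close> and \<open>x\<close> and
  collects the first component \<open>u\<close> together with the number \<open>n\<close> of letters read. The padding of the
  first component has begun exactly if \<open>length u < n\<close>.\<close>

fun padded_step ::
    "'a \<Rightarrow> 'a list \<Rightarrow> (nat \<times> 'a list) option \<Rightarrow> 'a option list \<Rightarrow> (nat \<times> 'a list) option" where
  "padded_step a x None l = None"
| "padded_step a x (Some (n, u)) l =
    (if l ! 1 = padded_nth [a] n \<and> l ! 2 = padded_nth x n
     then (case l ! 0 of None \<Rightarrow> Some (Suc n, u)
           | Some c \<Rightarrow> if length u = n then Some (Suc n, u @ [c]) else None)
     else None)"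

lemma foldl_padded_step:
  assumes "v \<in> lists (padded_alphabet 3 A)"
  shows "foldl (padded_step a x) (Some (0, [])) v = Some (n, u) \<longleftrightarrow>
    n = length v \<and> u \<in> lists A \<and> length u \<le> n \<and> v = padded_rows u [a] x 0 n"
  using assms
proof (induction v arbitrary: n u rule: rev_induct)
  case Nil
  then show ?case by (auto simp: padded_rows_def)
next
  case (snoc l v)
  let ?r = "foldl (padded_step a x) (Some (0, []))"
  have v: "v \<in> lists (padded_alphabet 3 A)" and l: "l \<in> padded_alphabet 3 A" using snoc.prems by auto
  obtain l0 l1 l2 where l': "l = [l0, l1, l2]"
    using l by (auto simp: padded_alphabet_def numeral_3_eq_3 length_Suc_conv)
  have l0: "l0 = Some c \<Longrightarrow> c \<in> A" for c using l by (auto simp: padded_alphabet_def l')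
  have IH: "?r v = Some (n, u) \<longleftrightarrow>
    n = length v \<and> u \<in> lists A \<and> length u \<le> n \<and> v = padded_rows u [a] x 0 n" for n u
    using snoc.IH[OF v] .
  note rows = padded_rows_Suc[of 0 _ _ "[a]" x, simplified]
    and rows_snoc = padded_rows_butlast[of _ _ "[a]" x]
  show ?case
  proof
    assume "?r (v @ [l]) = Some (n, u)"
    then obtain m w where mw: "?r v = Some (m, w)" "padded_step a x (Some (m, w)) l = Some (n, u)"
      by (cases "?r v") auto
    note IHm = mw(1)[unfolded IH]
    from IHm have m: "m = length v" "w \<in> lists A" "length w \<le> m" by blast+
    from IHm have vm: "padded_rows w [a] x 0 m = v" by (elim conjE) (rule HOL.sym)
    show "n = length (v @ [l]) \<and> u \<in> lists A \<and> length u \<le> n \<and> v @ [l] = padded_rows u [a] x 0 n"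
    proof (cases l0)
      case None
      then have nu: "n = Suc m" "u = w" "l1 = padded_nth [a] m" "l2 = padded_nth x m"
        using mw(2) by (auto simp: l' split: if_splits)
      have "padded_nth w m = None" using m by (simp add: padded_nth_def)
      then have "padded_rows w [a] x 0 (Suc m) = v @ [l]"
        unfolding rows using vm nu None by (simp add: l')
      then show ?thesis using m nu by simp
    next
      case (Some c)
      then have nu: "n = Suc m" "u = w @ [c]" "length w = m" "l1 = padded_nth [a] m" "l2 = padded_nth x m"
        using mw(2) by (auto simp: l' split: if_splits)
      have "padded_nth (w @ [c]) m = Some c" by (simp add: padded_nth_def nu(3)[symmetric])
      then have "padded_rows (w @ [c]) [a] x 0 (Suc m) = v @ [l]"
        unfolding rows using vm nu Some rows_snoc[of w c] by (simp add: l')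
      then show ?thesis using m nu Some l0 by simp
    qed
  next
    assume "n = length (v @ [l]) \<and> u \<in> lists A \<and> length u \<le> n \<and> v @ [l] = padded_rows u [a] x 0 n"
    then have n: "n = Suc (length v)" and u: "u \<in> lists A" "length u \<le> Suc (length v)"
      and R: "v @ [l] = padded_rows u [a] x 0 (Suc (length v))" by auto
    have v': "padded_rows u [a] x 0 (length v) = v" and ls: "l0 = padded_nth u (length v)"
        "l1 = padded_nth [a] (length v)" "l2 = padded_nth x (length v)"
      using R rows[of u "length v"] by (auto simp: l')
    show "?r (v @ [l]) = Some (n, u)"
    proof (cases "length u \<le> length v")
      case True
      then have "?r v = Some (length v, u)" unfolding IH using u v' by simp
      moreover have "padded_step a x (Some (length v, u)) l = Some (n, u)"
        using ls True n by (simp add: l' padded_nth_def)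
      ultimately show ?thesis by simp
    next
      case False
      then obtain w c where w: "u = w @ [c]" "length w = length v"
        using u by (cases u rule: rev_cases) auto
      have "padded_rows w [a] x 0 (length v) = v" using v' rows_snoc[of w c] w by simp
      then have "?r v = Some (length v, w)"
        unfolding IH using w u by simp
      moreover have "padded_step a x (Some (length v, w)) l = Some (n, u)"
        using ls w(1) n by (simp add: l' padded_nth_def w(2)[symmetric])
      ultimately show ?thesis by simp
    qed
  qed
qed

text \<open>The machine \<open>padded_step\<close> becomes finite if \<open>u\<close> is replaced by its class with respect to \<open>L\<close> and the
  position is only counted up to the length \<open>K\<close> of the bounded components.\<close>

lemma regular_language_pad_word:
  assumes L: "regular_language A L" and a: "a \<in> A" and x: "x \<in> lists A"
  shows "regular_language (padded_alphabet 3 A) ((\<lambda>u. pad_word [u, [a], x]) ` L)" (is "regular_language ?\<Sigma> ?M")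
proof -
  obtain f :: "'a list \<Rightarrow> nat" where f: "finite_state A f" "saturates A f L" and LA: "L \<subseteq> lists A"
    using L by (rule regular_languageE)
  define K where "K = max 1 (length x)"
  define P where "P = (\<lambda>s :: (nat \<times> 'a list) option. case s of None \<Rightarrow> True | Some (n, u) \<Rightarrow> u \<in> lists A \<and> length u \<le> n)"
  define c where "c = map_option (\<lambda>(n, u). (min n K, length u = n, f u))"
  let ?r = "foldl (padded_step a x) (Some (0, []))"
  have fs: "finite_state ?\<Sigma> (\<lambda>v. c (?r v))"
  proof (rule finite_state_foldl[where P = P and c = c and step = "padded_step a x"])
    show "P (Some (0, []))" unfolding P_def by simp
    show "P (padded_step a x s l)" if "P s" "l \<in> ?\<Sigma>" for s l
    proof -
      have "c \<in> A" if "l ! 0 = Some c" for c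
        using \<open>l \<in> ?\<Sigma>\<close> that nth_mem[of 0 l] by (auto simp: padded_alphabet_def)
      then show ?thesis using that(1)
        by (cases s; cases "l ! 0") (auto simp: P_def split: if_splits)
    qed
    have "c ` {s. P s} \<subseteq> insert None (Some ` ({..K} \<times> UNIV \<times> f ` lists A))"
    proof (rule image_subsetI)
      fix s assume "s \<in> {s. P s}"
      then show "c s \<in> insert None (Some ` ({..K} \<times> UNIV \<times> f ` lists A))"
        by (cases s) (auto simp: c_def P_def)
    qed
    moreover have "finite (insert None (Some ` ({..K} \<times> (UNIV :: bool set) \<times> f ` lists A)))"
      using finite_state_finite[OF f(1)] by simp
    ultimately show "finite (c ` {s. P s})" by (rule finite_subset)
    show "c (padded_step a x s l) = c (padded_step a x t l)"
      if PP: "P s" "P t" and l: "l \<in> ?\<Sigma>" and eq: "c s = c t" for s t l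
    proof (cases s)
      case None
      then show ?thesis using eq by (simp add: c_def)
    next
      case (Some nu)
      obtain n u where s: "s = Some (n, u)" using Some by (cases nu) auto
      obtain m w where t: "t = Some (m, w)" using eq s by (cases t) (auto simp: c_def)
      have e: "min n K = min m K" "length u = n \<longleftrightarrow> length w = m" "f u = f w"
        using eq by (auto simp: c_def s t)
      have uw: "u \<in> lists A" "length u \<le> n" "w \<in> lists A" "length w \<le> m"
        using PP by (auto simp: P_def s t)
      have nth: "padded_nth [a] n = padded_nth [a] m" "padded_nth x n = padded_nth x m"
        using e(1) by (auto simp: padded_nth_def K_def min_def split: if_splits)
      have lA: "b \<in> A" if "l ! 0 = Some b" for b
        using l that nth_mem[of 0 l] by (auto simp: padded_alphabet_def)
      have "f (u @ [b]) = f (w @ [b])" if "b \<in> A" for b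
        using finite_stateD[OF f(1) uw(1,3) that e(3)] .
      moreover have "min (Suc n) K = min (Suc m) K" using e(1) by (auto simp: min_def split: if_splits)
      ultimately show ?thesis using e uw nth lA
        by (cases "l ! 0") (auto simp: s t c_def)
    qed
  qed
  have mem: "v \<in> ?M \<longleftrightarrow> (\<exists>n u. ?r v = Some (n, u) \<and> u \<in> L \<and> K \<le> n)" if v: "v \<in> lists ?\<Sigma>" for v
  proof
    assume "v \<in> ?M"
    then obtain u where "u \<in> L" "v = padded_rows u [a] x 0 (max (length u) K)"
      by (auto simp: pad_word_triple K_def)
    then show "\<exists>n u. ?r v = Some (n, u) \<and> u \<in> L \<and> K \<le> n"
      using foldl_padded_step[OF v, of a x "max (length u) K" u] LA by auto
  next
    assume "\<exists>n u. ?r v = Some (n, u) \<and> u \<in> L \<and> K \<le> n"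
    then obtain n u where nu: "u \<in> L" "K \<le> n" "length u \<le> n" and rows: "padded_rows u [a] x 0 n = v"
      using foldl_padded_step[OF v, of a x] by metis
    have "n = max (length u) K"
    proof (rule ccontr)
      assume "n \<noteq> max (length u) K"
      then have n: "length u < n" "K < n" using nu by auto
      then obtain k where k: "n = Suc k" by (cases n) auto
      then have "v = padded_rows u [a] x 0 k @ [[padded_nth u k, padded_nth [a] k, padded_nth x k]]"
        using rows padded_rows_Suc[of 0 k u "[a]" x] by simp
      moreover have "[padded_nth u k, padded_nth [a] k, padded_nth x k] = replicate 3 None"
        using n k by (simp add: padded_nth_def K_def numeral_3_eq_3)
      ultimately have "replicate 3 None \<in> ?\<Sigma>" using v by simp
      then show False by (simp add: padded_alphabet_def)
    qed
    then have "v = pad_word [u, [a], x]" using rows by (simp add: pad_word_triple K_def)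
    then show "v \<in> ?M" using nu by blast
  qed
  show ?thesis
  proof (rule regular_languageI[OF fs])
    show "?M \<subseteq> lists ?\<Sigma>" using LA a x by (auto intro!: pad_word_in_lists)
    show "saturates ?\<Sigma> (\<lambda>v. c (?r v)) ?M"
    proof (rule saturatesI)
      fix v' w' assume vw: "v' \<in> lists ?\<Sigma>" "w' \<in> lists ?\<Sigma>" "c (?r v') = c (?r w')" "v' \<in> ?M"
      show "w' \<in> ?M"
      proof -
        obtain n u where nu: "?r v' = Some (n, u)" "u \<in> L" "K \<le> n" using mem[OF vw(1)] vw(4) by blast
        then obtain m z where mz: "?r w' = Some (m, z)" using vw(3) by (cases "?r w'") (auto simp: c_def)
        have "z \<in> lists A" using foldl_padded_step[OF vw(2), of a x m z] mz by blast
        moreover have "f u = f z" "K \<le> m" using vw(3) nu mz by (auto simp: c_def min_def split: if_splits)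
        ultimately have "z \<in> L" using saturatesD[OF f(2), of u z] nu LA by blast
        then show ?thesis using mem[OF vw(2)] mz \<open>K \<le> m\<close> by blast
      qed
    qed
  qed
qed

theorem synchronously_regular_UN:
  assumes "finite S" "\<And>a x. (a, x) \<in> S \<Longrightarrow> a \<in> A \<and> x \<in> lists A \<and> regular_language A (L a x)"
  shows "synchronously_regular 3 A (\<Union>(a, x)\<in>S. (\<lambda>u. [u, [a], x]) ` L a x)"
proof -
  have "regular_language (padded_alphabet 3 A) (\<Union>s\<in>S. (\<lambda>u. pad_word [u, [fst s], snd s]) ` L (fst s) (snd s))"
    using assms(1)
  proof (rule regular_language_UN)
    fix s assume "s \<in> S"
    then show "regular_language (padded_alphabet 3 A) ((\<lambda>u. pad_word [u, [fst s], snd s]) ` L (fst s) (snd s))"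
      using assms(2)[of "fst s" "snd s"] by (intro regular_language_pad_word) auto
  qed
  moreover have "(\<Union>s\<in>S. (\<lambda>u. pad_word [u, [fst s], snd s]) ` L (fst s) (snd s)) =
    pad_word ` (\<Union>(a, x)\<in>S. (\<lambda>u. [u, [a], x]) ` L a x)"
    by (auto simp: image_UN image_image split_def)
  ultimately show ?thesis by (simp add: synchronously_regular_def)
qed

end

section \<open>Recursive functions on codes of words\<close>

subsection \<open>Arithmetic\<close>

lemma recursive_comp1:
  assumes "recursive_fun 1 (\<lambda>xs. f (hd xs))" "recursive_fun n g"
  shows "recursive_fun n (\<lambda>xs. f (g xs))"
  using recursive_fun.comp[of "[g]" "\<lambda>xs. f (hd xs)" n] assms by simp

lemma recursive_comp2:
  assumes "recursive_fun 2 (\<lambda>xs. f (xs ! 0) (xs ! 1))" "recursive_fun n g" "recursive_fun n h"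
  shows "recursive_fun n (\<lambda>xs. f (g xs) (h xs))"
  using recursive_fun.comp[of "[g, h]" "\<lambda>xs. f (xs ! 0) (xs ! 1)" n] assms by (simp add: numeral_2_eq_2)

lemma recursive_Suc: "recursive_fun n g \<Longrightarrow> recursive_fun n (\<lambda>xs. Suc (g xs))"
  using recursive_comp1[of Suc n g] recursive_fun.suc by simp

lemma recursive_const: "recursive_fun n (\<lambda>xs. c)"
  by (induction c) (auto intro: recursive_fun.zero recursive_Suc)

lemma recursive_hd: "recursive_fun 1 hd"
  by (rule recursive_fun.ext[OF recursive_fun.proj[of 0 1]]) (auto simp: length_Suc_conv)

lemma recursive_rec_nat1:
  assumes "recursive_fun 2 (\<lambda>xs. g (xs ! 0) (xs ! 1))"
  shows "recursive_fun 1 (\<lambda>xs. rec_nat c g (hd xs))"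
  using recursive_fun.prim_rec[OF recursive_const[of 0 c], of "\<lambda>xs. g (xs ! 0) (xs ! 1)"] assms
  by (simp add: numeral_2_eq_2)

lemma recursive_rec_nat2:
  assumes "recursive_fun 1 (\<lambda>xs. f (hd xs))" "recursive_fun 3 (\<lambda>xs. g (xs ! 2) (xs ! 0) (xs ! 1))"
  shows "recursive_fun 2 (\<lambda>xs. rec_nat (f (xs ! 1)) (g (xs ! 1)) (xs ! 0))"
proof -
  have "recursive_fun (Suc 1)
    (\<lambda>xs. rec_nat (f (hd (tl xs))) (\<lambda>k r. g ((k # r # tl xs) ! 2) ((k # r # tl xs) ! 0) ((k # r # tl xs) ! 1)) (hd xs))"
    using recursive_fun.prim_rec[OF assms(1), of "\<lambda>xs. g (xs ! 2) (xs ! 0) (xs ! 1)"] assms(2)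
    by (simp add: numeral_3_eq_3)
  then have "recursive_fun 2
    (\<lambda>xs. rec_nat (f (hd (tl xs))) (\<lambda>k r. g ((k # r # tl xs) ! 2) ((k # r # tl xs) ! 0) ((k # r # tl xs) ! 1)) (hd xs))"
    by (simp add: numeral_2_eq_2)
  then show ?thesis
    by (rule recursive_fun.ext) (auto simp: numeral_2_eq_2 length_Suc_conv)
qed

lemma recursive_nth: "i < n \<Longrightarrow> recursive_fun n (\<lambda>xs. xs ! i)"
  by (rule recursive_fun.proj)

lemma recursive_add: "recursive_fun 2 (\<lambda>xs. xs ! 0 + xs ! 1)"
proof -
  have "rec_nat m (\<lambda>k r. Suc r) n = n + m" for m n :: nat by (induction n) auto
  then show ?thesis
    using recursive_rec_nat2[of "\<lambda>m. m" "\<lambda>m k r. Suc r"] recursive_hd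
      recursive_Suc[OF recursive_nth[of 1 3]] by simp
qed

lemma recursive_pred: "recursive_fun 1 (\<lambda>xs. hd xs - 1)"
proof -
  have "rec_nat 0 (\<lambda>k r. k) n = n - 1" for n by (cases n) auto
  then show ?thesis
    using recursive_rec_nat1[of "\<lambda>k r. k" 0] recursive_nth[of 0 2] by simp
qed

lemma recursive_diff: "recursive_fun 2 (\<lambda>xs. xs ! 0 - xs ! 1)"
proof -
  have "rec_nat m (\<lambda>k r. r - 1) n = m - n" for m n :: nat by (induction n) auto
  then have "recursive_fun 2 (\<lambda>xs. xs ! 1 - xs ! 0)"
    using recursive_rec_nat2[of "\<lambda>m. m" "\<lambda>m k r. r - 1"] recursive_hd
      recursive_comp1[OF recursive_pred recursive_nth[of 1 3]] by simp
  then show ?thesis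
    using recursive_comp2[of "\<lambda>m n. n - m", OF _ recursive_nth[of 1 2] recursive_nth[of 0 2]] by simp
qed

lemma recursive_triangle: "recursive_fun 1 (\<lambda>xs. triangle (hd xs))"
proof -
  have "rec_nat 0 (\<lambda>k r. r + Suc k) n = triangle n" for n by (induction n) auto
  moreover have "recursive_fun 2 (\<lambda>xs. xs ! 1 + Suc (xs ! 0))"
    using recursive_comp2[OF recursive_add recursive_nth[of 1 2] recursive_Suc[OF recursive_nth[of 0 2]]]
    by simp
  ultimately show ?thesis using recursive_rec_nat1[of "\<lambda>k r. r + Suc k" 0] by simp
qed

lemma recursive_prod_encode: "recursive_fun 2 (\<lambda>xs. prod_encode (xs ! 0, xs ! 1))"
  unfolding prod_encode_def prod.case
  by (intro recursive_comp2[OF recursive_add] recursive_comp1[OF recursive_triangle] recursive_nth) simp_all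

lemma triangle_mono: "m \<le> n \<Longrightarrow> triangle m \<le> triangle n"
  by (induction n rule: dec_induct) auto

text \<open>The sum of the components of a pair is found by minimization, as the index of the
  last triangle number that does not exceed the code.\<close>

lemma Least_triangle:
  "(LEAST k. Suc (prod_encode (m, n)) - triangle (Suc k) = 0) = m + n"
proof (rule Least_equality)
  show "Suc (prod_encode (m, n)) - triangle (Suc (m + n)) = 0"
    by (simp add: prod_encode_def)
  fix k assume k: "Suc (prod_encode (m, n)) - triangle (Suc k) = 0"
  show "m + n \<le> k"
  proof (rule ccontr)
    assume "\<not> m + n \<le> k"
    then have "triangle (Suc k) \<le> triangle (m + n)" by (intro triangle_mono) simp
    then show False using k by (simp add: prod_encode_def)
  qed
qed

definition prod_sum :: "nat \<Rightarrow> nat" where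
  "prod_sum x = (LEAST k. Suc x - triangle (Suc k) = 0)"

lemma prod_sum_eq: "prod_sum (prod_encode (m, n)) = m + n"
  unfolding prod_sum_def by (rule Least_triangle)

lemma recursive_prod_sum: "recursive_fun 1 (\<lambda>xs. prod_sum (hd xs))"
proof -
  have "recursive_fun (Suc 1) (\<lambda>xs. Suc (xs ! 1) - triangle (Suc (xs ! 0)))"
    by (intro recursive_comp2[OF recursive_diff] recursive_comp1[OF recursive_triangle]
        recursive_Suc recursive_nth) simp_all
  moreover have "\<exists>k. Suc x - triangle (Suc k) = 0" for x
    by (rule exI[of _ x]) simp
  ultimately have "recursive_fun 1 (\<lambda>xs. LEAST k. Suc ((k # xs) ! 1) - triangle (Suc ((k # xs) ! 0)) = 0)"
    by (intro recursive_fun.minimize) (auto simp del: triangle_Suc)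
  then show ?thesis
    by (rule recursive_fun.ext) (auto simp: length_Suc_conv prod_sum_def simp del: triangle_Suc)
qed

lemma fst_prod_decode_eq: "fst (prod_decode x) = x - triangle (prod_sum x)"
  and snd_prod_decode_eq: "snd (prod_decode x) = prod_sum x - fst (prod_decode x)"
proof -
  obtain m n where x: "x = prod_encode (m, n)" by (metis prod_decode_inverse surj_pair)
  then show "fst (prod_decode x) = x - triangle (prod_sum x)"
    "snd (prod_decode x) = prod_sum x - fst (prod_decode x)"
    by (simp_all add: prod_sum_eq) (simp add: prod_encode_def)
qed

subsection \<open>Unary computable functions\<close>

text \<open>Functions of several arguments are treated as unary functions on codes of pairs, which makes the
  class closed under composition without bookkeeping of arities.\<close>

definition computable :: "(nat \<Rightarrow> nat) \<Rightarrow> bool" where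
  "computable f \<longleftrightarrow> recursive_fun 1 (\<lambda>xs. f (hd xs))"

lemma computable_triangle: "computable triangle"
  and computable_prod_sum: "computable prod_sum"
  unfolding computable_def by (rule recursive_triangle recursive_prod_sum)+

lemma computable_id: "computable (\<lambda>x. x)"
  using recursive_hd by (simp add: computable_def)

lemma computable_const: "computable (\<lambda>x. c)"
  by (simp add: computable_def recursive_const)

lemma computable_comp: "computable f \<Longrightarrow> computable g \<Longrightarrow> computable (\<lambda>x. f (g x))"
  unfolding computable_def by (rule recursive_comp1)

lemma computable_Suc: "computable f \<Longrightarrow> computable (\<lambda>x. Suc (f x))"
  unfolding computable_def by (rule recursive_Suc)

lemma computable_add: "computable f \<Longrightarrow> computable g \<Longrightarrow> computable (\<lambda>x. f x + g x)"
  unfolding computable_def by (rule recursive_comp2[OF recursive_add])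

lemma computable_diff: "computable f \<Longrightarrow> computable g \<Longrightarrow> computable (\<lambda>x. f x - g x)"
  unfolding computable_def by (rule recursive_comp2[OF recursive_diff])

lemma computable_pair: "computable f \<Longrightarrow> computable g \<Longrightarrow> computable (\<lambda>x. prod_encode (f x, g x))"
  unfolding computable_def by (rule recursive_comp2[OF recursive_prod_encode])

lemma computable_fst: "computable f \<Longrightarrow> computable (\<lambda>x. fst (prod_decode (f x)))"
  unfolding fst_prod_decode_eq
  by (rule computable_diff[OF _ computable_comp[OF computable_triangle computable_comp[OF computable_prod_sum]]])

lemma computable_snd: "computable f \<Longrightarrow> computable (\<lambda>x. snd (prod_decode (f x)))"
  unfolding snd_prod_decode_eq
  by (rule computable_diff[OF computable_comp[OF computable_prod_sum] computable_fst])

lemma computable_if_0: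
  assumes "computable p" "computable f" "computable g"
  shows "computable (\<lambda>x. if p x = 0 then f x else g x)"
proof -
  have "computable (\<lambda>x. rec_nat 0 (\<lambda>k r. Suc 0) (p x))"
    using assms(1) unfolding computable_def
    by (intro recursive_comp1[OF recursive_rec_nat1] recursive_const)
  moreover have "recursive_fun 2 (\<lambda>xs. rec_nat (fst (prod_decode (xs ! 1))) (\<lambda>k r. snd (prod_decode (xs ! 1))) (xs ! 0))"
  proof (rule recursive_rec_nat2)
    show "recursive_fun 1 (\<lambda>xs. fst (prod_decode (hd xs)))"
      using computable_fst[OF computable_id] by (simp add: computable_def)
    have "recursive_fun 1 (\<lambda>xs. snd (prod_decode (hd xs)))"
      using computable_snd[OF computable_id] by (simp add: computable_def)
    then show "recursive_fun 3 (\<lambda>xs. snd (prod_decode (xs ! 2)))"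
      by (rule recursive_comp1) (rule recursive_nth, simp)
  qed
  moreover have "computable (\<lambda>x. prod_encode (f x, g x))" using assms by (intro computable_pair)
  ultimately have "computable (\<lambda>x. rec_nat (fst (prod_decode (prod_encode (f x, g x))))
      (\<lambda>k r. snd (prod_decode (prod_encode (f x, g x)))) (p x))"
    using assms(1) recursive_comp2[of "\<lambda>y z. rec_nat (fst (prod_decode z)) (\<lambda>k r. snd (prod_decode z)) y"]
    unfolding computable_def by blast
  moreover have "rec_nat a (\<lambda>k r. b) n = (if n = 0 then a else b)" for a b n :: nat by (cases n) auto
  ultimately show ?thesis by simp
qed

lemma computable_if_eq:
  assumes "computable p" "computable q" "computable f" "computable g"
  shows "computable (\<lambda>x. if p x = q x then f x else g x)"
proof -
  have "computable (\<lambda>x. if (p x - q x) + (q x - p x) = 0 then f x else g x)"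
    using assms by (intro computable_if_0 computable_add computable_diff)
  moreover have "(m - n) + (n - m) = 0 \<longleftrightarrow> m = n" for m n :: nat by auto
  ultimately show ?thesis by simp
qed

text \<open>Finite case distinctions are computable whatever their values are; this covers all data about
  the finitely many vertices, letters and sets of forbidden vertices.\<close>

lemma computable_on_finite:
  assumes "finite S"
  shows "\<exists>g. computable g \<and> (\<forall>x\<in>S. g x = f x)"
  using assms
proof (induction S)
  case empty
  then show ?case using computable_id by auto
next
  case (insert c S)
  then obtain g where g: "computable g" "\<forall>x\<in>S. g x = f x" by blast
  have "computable (\<lambda>x. if x = c then f c else g x)"
    by (intro computable_if_eq computable_id computable_const g(1))
  then show ?case using g by (intro exI[of _ "\<lambda>x. if x = c then f c else g x"]) auto
qed

lemma computable_funpow: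
  assumes "computable f" "computable g" "computable h"
  shows "computable (\<lambda>x. (f ^^ g x) (h x))"
proof -
  have "rec_nat m (\<lambda>k r. f r) n = (f ^^ n) m" for m n by (induction n) auto
  moreover have "recursive_fun 3 (\<lambda>xs. f (xs ! 1))"
    using assms(1) unfolding computable_def by (rule recursive_comp1) (rule recursive_nth, simp)
  ultimately have "recursive_fun 2 (\<lambda>xs. (f ^^ (xs ! 0)) (xs ! 1))"
    using recursive_rec_nat2[of "\<lambda>m. m" "\<lambda>m k r. f r"] recursive_hd by simp
  then show ?thesis
    using assms(2,3) unfolding computable_def by (rule recursive_comp2)
qed

text \<open>A left fold runs over the list by iterating a step on the pair of the state and
  the remaining list; the code of the list bounds its length.\<close>

lemma computable_foldl:
  assumes step: "computable step"
  shows "\<exists>F. computable F \<and>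
    (\<forall>s xs. F (prod_encode (s, list_encode xs)) = foldl (\<lambda>s x. step (prod_encode (s, x))) s xs)"
proof -
  define T where "T = (\<lambda>z. if snd (prod_decode z) = 0 then z
    else prod_encode (step (prod_encode (fst (prod_decode z), fst (prod_decode (snd (prod_decode z) - 1)))),
      snd (prod_decode (snd (prod_decode z) - 1))))"
  have "computable T"
    unfolding T_def
    by (intro computable_if_0 computable_pair computable_comp[OF step] computable_fst computable_snd
        computable_diff computable_id computable_const)
  then have "computable (\<lambda>z. fst (prod_decode ((T ^^ snd (prod_decode z)) z)))"
    by (intro computable_fst computable_funpow computable_snd computable_id)
  moreover have "(T ^^ n) (prod_encode (s, list_encode xs)) =
      prod_encode (foldl (\<lambda>s x. step (prod_encode (s, x))) s xs, 0)" if "length xs \<le> n" for n s xs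
    using that
  proof (induction xs arbitrary: n s)
    case Nil
    have "T (prod_encode (s, 0)) = prod_encode (s, 0)" by (simp add: T_def)
    then have "(T ^^ n) (prod_encode (s, 0)) = prod_encode (s, 0)"
      by (induction n) (auto simp: funpow_swap1)
    then show ?case by simp
  next
    case (Cons x xs)
    then obtain k where k: "n = Suc k" "length xs \<le> k" by (cases n) auto
    have "T (prod_encode (s, list_encode (x # xs))) = prod_encode (step (prod_encode (s, x)), list_encode xs)"
      by (simp add: T_def)
    then show ?case using Cons.IH[OF k(2)] k(1) by (simp add: funpow_swap1)
  qed
  moreover have "length xs \<le> list_encode xs" for xs
  proof (induction xs)
    case (Cons x xs)
    then show ?case using le_prod_encode_2[of "list_encode xs" x] by simp
  qed simp
  ultimately show ?thesis
    by (intro exI[of _ "\<lambda>z. fst (prod_decode ((T ^^ snd (prod_decode z)) z))"]) simp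
qed

lemma computable_rev:
  "\<exists>R. computable R \<and> (\<forall>xs. R (list_encode xs) = list_encode (rev xs))"
proof -
  have "computable (\<lambda>z. Suc (prod_encode (snd (prod_decode z), fst (prod_decode z))))"
    by (intro computable_Suc computable_pair computable_fst computable_snd computable_id)
  from computable_foldl[OF this] obtain F where F: "computable F"
    "\<And>s xs. F (prod_encode (s, list_encode xs)) = foldl (\<lambda>s x. Suc (prod_encode (x, s))) s xs"
    by auto
  have "foldl (\<lambda>s x. Suc (prod_encode (x, s))) (list_encode ys) xs = list_encode (rev xs @ ys)" for xs ys
  proof (induction xs arbitrary: ys)
    case (Cons x xs)
    then show ?case using Cons[of "x # ys"] by simp
  qed simp
  from this[of "[]"] have "F (prod_encode (0, list_encode xs)) = list_encode (rev xs)" for xs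
    using F(2) by simp
  moreover have "computable (\<lambda>x. F (prod_encode (0, x)))"
    by (intro computable_comp[OF F(1)] computable_pair computable_const computable_id)
  ultimately show ?thesis by blast
qed

section \<open>Decidable languages\<close>

definition word_code :: "('a \<Rightarrow> nat) \<Rightarrow> 'a list \<Rightarrow> nat" where
  "word_code c u = list_encode (map c u)"

definition decidable_language :: "('a \<Rightarrow> nat) \<Rightarrow> 'a set \<Rightarrow> 'a list set \<Rightarrow> bool" where
  "decidable_language c A L \<longleftrightarrow>
    (\<exists>p. computable p \<and> (\<forall>u\<in>lists A. p (word_code c u) = (if u \<in> L then 1 else 0)))"

lemma word_code_inject:
  assumes "inj_on c A" "u \<in> lists A" "v \<in> lists A"
  shows "word_code c u = word_code c v \<longleftrightarrow> u = v"
  using assms unfolding word_code_def list_encode_eq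
  by (metis inj_on_mapI inj_on_map_eq_map inj_on_subset in_listsD le_sup_iff subsetI)

lemma decidable_language_Un:
  assumes "decidable_language c A L" "decidable_language c A M"
  shows "decidable_language c A (L \<union> M)"
proof -
  obtain p where p: "computable p" "\<And>u. u \<in> lists A \<Longrightarrow> p (word_code c u) = (if u \<in> L then 1 else 0)"
    using assms(1) unfolding decidable_language_def by blast
  obtain q where q: "computable q" "\<And>u. u \<in> lists A \<Longrightarrow> q (word_code c u) = (if u \<in> M then 1 else 0)"
    using assms(2) unfolding decidable_language_def by blast
  have "computable (\<lambda>x. if p x = 0 then q x else 1)"
    by (intro computable_if_0 p(1) q(1) computable_const)
  then show ?thesis
    unfolding decidable_language_def
    by (intro exI[of _ "\<lambda>x. if p x = 0 then q x else 1"]) (simp add: p q)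
qed

lemma decidable_language_UN:
  assumes "finite S" "\<And>s. s \<in> S \<Longrightarrow> decidable_language c A (L s)"
  shows "decidable_language c A (\<Union>s\<in>S. L s)"
  using assms
proof (induction S)
  case empty
  have "decidable_language c A {}"
    unfolding decidable_language_def by (rule exI[of _ "\<lambda>_. 0"]) (simp add: computable_const)
  then show ?case by simp
qed (simp add: decidable_language_Un)

lemma decidable_language_slice:
  assumes "decidable_tuples 3 A M"
  obtains c where "inj_on c A"
    "\<And>a x. a \<in> A \<Longrightarrow> x \<in> lists A \<Longrightarrow> decidable_language c A {u \<in> lists A. [u, [a], x] \<in> M}"
proof -
  from assms obtain c f where c: "inj_on c A" and f: "recursive_fun 3 f"
    and "\<forall>us. length us = 3 \<and> set us \<subseteq> lists A \<longrightarrow>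
      f (map (\<lambda>u. list_encode (map c u)) us) = (if us \<in> M then 1 else 0)"
    unfolding decidable_tuples_def by (elim exE conjE)
  then have dec: "f (map (word_code c) us) = (if us \<in> M then 1 else 0)"
    if "length us = 3" "set us \<subseteq> lists A" for us
    using that unfolding word_code_def by simp
  have "decidable_language c A {u \<in> lists A. [u, [a], x] \<in> M}" if ax: "a \<in> A" "x \<in> lists A" for a x
  proof -
    let ?p = "\<lambda>n. f [n, word_code c [a], word_code c x]"
    have "computable ?p"
      using recursive_fun.comp[of "[hd, \<lambda>_. word_code c [a], \<lambda>_. word_code c x]" f 1] f recursive_hd
      by (simp add: computable_def recursive_const numeral_3_eq_3)
    moreover have "?p (word_code c u) = (if u \<in> {u \<in> lists A. [u, [a], x] \<in> M} then 1 else 0)"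
      if "u \<in> lists A" for u
      using dec[of "[u, [a], x]"] ax that by simp
    ultimately show ?thesis unfolding decidable_language_def by blast
  qed
  then show ?thesis using that c by blast
qed

text \<open>The pairs \<open>(a, x)\<close> are finitely many, so a triple is decided by comparing its last two components
  with them and deciding the first component by the matching slice.\<close>

lemma decidable_tuples_UN:
  assumes c: "inj_on c A" and "finite S"
    and S: "\<And>a x. (a, x) \<in> S \<Longrightarrow> a \<in> A \<and> x \<in> lists A \<and> decidable_language c A (L a x)"
  shows "decidable_tuples 3 A (\<Union>(a, x)\<in>S. (\<lambda>u. [u, [a], x]) ` L a x)"
proof -
  let ?M = "\<lambda>S. \<Union>(a, x)\<in>S. (\<lambda>u. [u, [a], x]) ` L a x"
  let ?code = "\<lambda>u v x. prod_encode (word_code c u, prod_encode (word_code c v, word_code c x))"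
  have mem: "[u, v, x] \<in> ?M S \<longleftrightarrow> (\<exists>a. (a, x) \<in> S \<and> v = [a] \<and> u \<in> L a x)" for u v x S
    by (auto simp: image_iff)
  have "\<exists>p. computable p \<and> (\<forall>u\<in>lists A. \<forall>v\<in>lists A. \<forall>x\<in>lists A.
      p (?code u v x) = (if [u, v, x] \<in> ?M S then 1 else 0))"
    using assms(2) S
  proof (induction S)
    case empty
    then show ?case by (intro exI[of _ "\<lambda>_. 0"]) (simp add: computable_const)
  next
    case (insert s S)
    obtain a y where s: "s = (a, y)" by (cases s)
    have ay: "a \<in> A" "y \<in> lists A" "[a] \<in> lists A" and dec: "decidable_language c A (L a y)"
      using insert.prems[of a y] s by simp_all
    obtain q where q: "computable q" "\<forall>u\<in>lists A. q (word_code c u) = (if u \<in> L a y then 1 else 0)"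
      using dec unfolding decidable_language_def by (elim exE conjE)
    have "\<exists>p. computable p \<and> (\<forall>u\<in>lists A. \<forall>v\<in>lists A. \<forall>x\<in>lists A.
        p (?code u v x) = (if [u, v, x] \<in> ?M S then 1 else 0))"
      by (rule insert.IH) (rule insert.prems, simp)
    then obtain p where p: "computable p"
      "\<forall>u\<in>lists A. \<forall>v\<in>lists A. \<forall>x\<in>lists A. p (?code u v x) = (if [u, v, x] \<in> ?M S then 1 else 0)"
      by (elim exE conjE)
    let ?p = "\<lambda>z. if snd (prod_decode z) = prod_encode (word_code c [a], word_code c y)
      then q (fst (prod_decode z)) else p z"
    have "computable ?p"
      by (intro computable_if_eq computable_snd computable_const computable_comp[OF q(1)]
          computable_fst computable_id p(1))
    moreover have "?p (?code u v x) = (if [u, v, x] \<in> ?M (insert s S) then 1 else 0)"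
      if uvx: "u \<in> lists A" "v \<in> lists A" "x \<in> lists A" for u v x
    proof (cases "v = [a] \<and> x = y")
      case True
      then have "[u, v, x] \<in> ?M (insert s S) \<longleftrightarrow> u \<in> L a y"
        using insert.hyps(2) unfolding mem s by auto
      then show ?thesis using bspec[OF q(2) uvx(1)] True by simp
    next
      case False
      then have "[u, v, x] \<in> ?M (insert s S) \<longleftrightarrow> [u, v, x] \<in> ?M S"
        unfolding mem s by auto
      moreover
      have "\<not> (word_code c v = word_code c [a] \<and> word_code c x = word_code c y)"
        using False word_code_inject[OF c uvx(2) ay(3)] word_code_inject[OF c uvx(3) ay(2)] by blast
      then have "?p (?code u v x) = p (?code u v x)" by (subst if_not_P) simp_all
      ultimately show ?thesis using p(2)[rule_format, OF uvx] by (simp only:)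
    qed
    ultimately show ?case by blast
  qed
  then obtain p where p: "computable p"
    "\<forall>u\<in>lists A. \<forall>v\<in>lists A. \<forall>x\<in>lists A. p (?code u v x) = (if [u, v, x] \<in> ?M S then 1 else 0)"
    by (elim exE conjE)
  let ?f = "\<lambda>xs. p (prod_encode (xs ! 0, prod_encode (xs ! 1, xs ! 2)))"
  have "recursive_fun 3 (\<lambda>xs. prod_encode (xs ! 1, xs ! 2))"
    by (rule recursive_comp2[OF recursive_prod_encode]) (simp_all add: recursive_nth)
  then have "recursive_fun 3 (\<lambda>xs. prod_encode (xs ! 0, prod_encode (xs ! 1, xs ! 2)))"
    by (intro recursive_comp2[OF recursive_prod_encode]) (simp_all add: recursive_nth)
  from recursive_comp1[OF p(1)[unfolded computable_def] this] have f: "recursive_fun 3 ?f" .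
  have dec: "?f (map (\<lambda>u. list_encode (map c u)) us) = (if us \<in> ?M S then 1 else 0)"
    if us: "length us = 3 \<and> set us \<subseteq> lists A" for us
  proof -
    obtain u v x where "us = [u, v, x]" using us by (auto simp: numeral_3_eq_3 length_Suc_conv)
    then show ?thesis using p(2)[rule_format, of u v x] us by (simp add: word_code_def)
  qed
  show ?thesis
    unfolding decidable_tuples_def
    by (intro exI[of _ c] exI[of _ ?f] conjI c f allI impI) (rule dec)
qed

section \<open>The stacking of a graph product\<close>

context graph_product_nf begin

fun syllables_value :: "(nat \<times> 'a) list \<Rightarrow> 'h" where
  "syllables_value [] = \<one>\<^bsub>H\<^esub>"
| "syllables_value ((i, s) # r) = syllables_value r \<otimes>\<^bsub>H\<^esub> \<iota> i s"

lemma incl_one: "i \<in> I \<Longrightarrow> \<iota> i \<one>\<^bsub>G i\<^esub> = \<one>\<^bsub>H\<^esub>"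
  using incl_hom[of i "\<one>\<^bsub>G i\<^esub>" "\<one>\<^bsub>G i\<^esub>"] incl_closed[of i "\<one>\<^bsub>G i\<^esub>"]
  by (simp add: H.l_cancel_one)

lemma inv_vertex:
  assumes "i \<in> I" "g \<in> carrier (G i)"
  shows "inv\<^bsub>G i\<^esub> g \<in> carrier (G i)" "inv\<^bsub>G i\<^esub> g \<otimes>\<^bsub>G i\<^esub> g = \<one>\<^bsub>G i\<^esub>" "g \<otimes>\<^bsub>G i\<^esub> inv\<^bsub>G i\<^esub> g = \<one>\<^bsub>G i\<^esub>"
    "inv\<^bsub>G i\<^esub> (inv\<^bsub>G i\<^esub> g) = g"
  using assms group_vertex[of i] by (simp_all add: group.inv_closed group.l_inv group.r_inv group.inv_inv)

lemma inv_incl: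
  assumes "i \<in> I" "g \<in> carrier (G i)"
  shows "inv\<^bsub>H\<^esub> (\<iota> i g) = \<iota> i (inv\<^bsub>G i\<^esub> g)"
  using assms inv_vertex[OF assms]
  by (intro H.inv_equality) (simp_all add: incl_hom incl_one incl_closed)

lemma syllables_value_closed: "normal r \<Longrightarrow> syllables_value r \<in> carrier H"
  by (induction r rule: syllables_value.induct) (auto simp: incl_closed)

lemma syllables_value_extend:
  "normal r \<Longrightarrow> i \<in> I \<Longrightarrow> g \<in> carrier (G i) \<Longrightarrow>
    syllables_value (extend r i g) = syllables_value r \<otimes>\<^bsub>H\<^esub> \<iota> i g"
  by (simp add: extend_def incl_one syllables_value_closed)

text \<open>A syllable moves only past syllables with which it commutes.\<close>

lemma syllables_value_act:
  assumes "normal r" "j \<in> I" "h \<in> carrier (G j)"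
  shows "syllables_value (act r j h) = syllables_value r \<otimes>\<^bsub>H\<^esub> \<iota> j h"
  using assms
proof (induction r)
  case Nil
  then show ?case using syllables_value_extend[of "[]"] by simp
next
  case (Cons x r)
  obtain i s where x: "x = (i, s)" by (cases x)
  have r: "normal r" "i \<in> I" "s \<in> carrier (G i)" "i \<notin> forbidden r" using Cons.prems by (simp_all add: x)
  note c = syllables_value_closed[OF r(1)] incl_closed[OF r(2,3)] incl_closed[OF assms(2,3)]
  consider "i = j" | "i \<noteq> j" "j \<in> forbidden (x # r)" | "i \<noteq> j" "j \<notin> forbidden (x # r)" by blast
  then show ?case
  proof cases
    case 1
    then show ?thesis using r c assms
      by (simp add: x syllables_value_extend H.m_assoc incl_hom)
  next
    case 2
    then have "adj j i" by (simp add: x)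
    then have "\<iota> j h \<otimes>\<^bsub>H\<^esub> \<iota> i s = \<iota> i s \<otimes>\<^bsub>H\<^esub> \<iota> j h"
      using incl_adj r assms by blast
    moreover have "act (x # r) j h = (i, s) # act r j h" using 2 by (simp add: x)
    ultimately show ?thesis using Cons.IH r c assms by (simp add: x H.m_assoc)
  next
    case 3
    then have "act (x # r) j h = extend (x # r) j h" by (simp add: act_not_forbidden)
    then show ?thesis using syllables_value_extend[OF Cons.prems] by simp
  qed
qed

lemma normal_nform: "x \<in> carrier H \<Longrightarrow> normal (nform x)"
  by (induction x rule: generated) (simp_all add: nform_one nform_mult normal_act)

lemma syllables_value_nform: "x \<in> carrier H \<Longrightarrow> syllables_value (nform x) = x"
  by (induction x rule: generated)
    (simp_all add: nform_one nform_mult syllables_value_act normal_nform)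

lemma nform_syllables_value: "normal r \<Longrightarrow> nform (syllables_value r) = r"
proof (induction r rule: syllables_value.induct)
  case (2 i s r)
  then show ?case
    by (simp add: nform_mult syllables_value_closed act_not_forbidden extend_def)
qed (simp add: nform_one)

lemma nform_incl: "i \<in> I \<Longrightarrow> s \<in> carrier (G i) \<Longrightarrow> s \<noteq> \<one>\<^bsub>G i\<^esub> \<Longrightarrow> nform (\<iota> i s) = [(i, s)]"
  using nform_mult[of "\<one>\<^bsub>H\<^esub>" i s] incl_closed[of i s] by (simp add: nform_one extend_def)

text \<open>The two kinds of edges with a label at \<open>j\<close>: those in the coset of the vertex group at a word to
  which a syllable at \<open>j\<close> may be appended, and those whose label commutes with the last syllable.\<close>

lemma extend_cases:
  assumes "normal r" "j \<in> I"
  obtains (coset) r\<^sub>0 h where "normal r\<^sub>0" "j \<notin> forbidden r\<^sub>0" "h \<in> carrier (G j)" "r = extend r\<^sub>0 j h"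
  | (shuffle) i s r' where "r = (i, s) # r'" "i \<noteq> j" "j \<in> forbidden r" "adj j i"
proof (cases "j \<in> forbidden r")
  case False
  then show ?thesis using coset[of r "\<one>\<^bsub>G j\<^esub>"] assms by (simp add: extend_def)
next
  case True
  then obtain i s r' where r: "r = (i, s) # r'" by (cases r rule: forbidden.cases) auto
  show ?thesis
  proof (cases "i = j")
    case True
    then show ?thesis using coset[of r' s] assms r by (simp add: extend_def)
  next
    case False
    then show ?thesis using shuffle[of i s r'] True r by simp
  qed
qed

end

locale graph_product_stackings = graph_product_nf I E G H \<iota> nform
  for I :: "nat set" and E :: "nat set set" and G :: "nat \<Rightarrow> ('a, 'm) monoid_scheme"
    and H :: "'h monoid" and \<iota> nform +
  fixes A :: "nat \<Rightarrow> 'a set" and y :: "nat \<Rightarrow> 'a \<Rightarrow> 'a list"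
    and \<phi> :: "nat \<Rightarrow> 'a \<Rightarrow> 'a \<Rightarrow> 'a list"
  assumes finite_vertices: "finite I"
    and gens: "i \<in> I \<Longrightarrow> generated_group (G i) (A i)"
    and stackings: "i \<in> I \<Longrightarrow> stacking (G i) (A i) (y i) (\<phi> i)"
begin

definition letters :: "(nat \<times> 'a) set" where
  "letters = Sigma I A"

definition embed :: "nat \<times> 'a \<Rightarrow> 'h" where
  "embed = (\<lambda>(i, a). \<iota> i a)"

definition product_gens :: "'h set" where
  "product_gens = embed ` letters"

fun spell :: "(nat \<times> 'a) list \<Rightarrow> (nat \<times> 'a) list" where
  "spell [] = []"
| "spell ((i, s) # r) = spell r @ map (Pair i) (y i s)"

definition product_nf :: "'h \<Rightarrow> 'h list" where
  "product_nf x = map embed (spell (nform x))"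

text \<open>Inside a coset of a vertex group the flow is translated from this group. Elsewhere the label is
  moved past the last letter of the last syllable.\<close>

fun product_flow_letters :: "(nat \<times> 'a) list \<Rightarrow> nat \<times> 'a \<Rightarrow> (nat \<times> 'a) list" where
  "product_flow_letters [] (j, a) = map (Pair j) (\<phi> j \<one>\<^bsub>G j\<^esub> a)"
| "product_flow_letters ((i, s) # r) (j, a) =
    (if i = j then map (Pair j) (\<phi> j s a)
     else if j \<in> forbidden ((i, s) # r)
     then [(i, inv\<^bsub>G i\<^esub> (last (y i s))), (j, a), (i, last (y i s))]
     else map (Pair j) (\<phi> j \<one>\<^bsub>G j\<^esub> a))"

definition product_flow :: "'h \<Rightarrow> 'h \<Rightarrow> 'h list" where
  "product_flow x b = map embed (product_flow_letters (nform x) (inv_into letters embed b))"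

lemma gen_carrier: "i \<in> I \<Longrightarrow> a \<in> A i \<Longrightarrow> a \<in> carrier (G i)"
  using generated_group.gens_carrier[OF gens] .

lemma gen_not_one: "i \<in> I \<Longrightarrow> a \<in> A i \<Longrightarrow> a \<noteq> \<one>\<^bsub>G i\<^esub>"
  using generated_group.one_notin_gens[OF gens] by blast

lemma gen_inv: "i \<in> I \<Longrightarrow> a \<in> A i \<Longrightarrow> inv\<^bsub>G i\<^esub> a \<in> A i"
  using generated_group.inv_gens[OF gens] .

lemma prefix_closed: "i \<in> I \<Longrightarrow> prefix_closed_nf (G i) (A i) (y i)"
  using stackings by (simp add: stacking_def)

lemma vertex_nf_lists: "i \<in> I \<Longrightarrow> g \<in> carrier (G i) \<Longrightarrow> y i g \<in> lists (A i)"
  using generated_group.nf_lists[OF gens prefix_closed] by simp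

lemma vertex_nf_value: "i \<in> I \<Longrightarrow> g \<in> carrier (G i) \<Longrightarrow> word_value (G i) (y i g) = g"
  using generated_group.nf_value[OF gens prefix_closed] by simp

lemma vertex_nf_one: "i \<in> I \<Longrightarrow> y i \<one>\<^bsub>G i\<^esub> = []"
  using generated_group.nf_one[OF gens prefix_closed] by simp

lemma vertex_nf_prefix:
  "i \<in> I \<Longrightarrow> g \<in> carrier (G i) \<Longrightarrow> y i g = u @ v \<Longrightarrow> y i (word_value (G i) u) = u"
  using generated_group.nf_prefix[OF gens prefix_closed] by blast

lemma vertex_word_value: "i \<in> I \<Longrightarrow> u \<in> lists (A i) \<Longrightarrow> word_value (G i) u \<in> carrier (G i)"
  using generated_group.path_end_carrier[OF gens] by simp

lemma vertex_flow:
  assumes "i \<in> I" "g \<in> carrier (G i)" "a \<in> A i"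
  shows "\<phi> i g a \<in> lists (A i)" "word_value (G i) (\<phi> i g a) = a"
    "tree_edge (G i) (y i) g a \<Longrightarrow> \<phi> i g a = [a]"
  using stackings[OF assms(1)] assms(2,3) unfolding stacking_def by blast+

lemma embed_simp [simp]: "embed (i, a) = \<iota> i a"
  by (simp add: embed_def)

lemma letters_iff [simp]: "(i, a) \<in> letters \<longleftrightarrow> i \<in> I \<and> a \<in> A i"
  by (simp add: letters_def)

lemma embed_closed: "l \<in> letters \<Longrightarrow> embed l \<in> carrier H"
  by (cases l) (simp add: incl_closed gen_carrier)

lemma inj_on_embed: "inj_on embed letters"
proof (rule inj_onI)
  fix l m assume lm: "l \<in> letters" "m \<in> letters" "embed l = embed m"
  have nf: "nform (embed l) = [l]" if "l \<in> letters" for l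
    using that gen_carrier gen_not_one by (cases l) (simp add: nform_incl)
  have "[l] = [m]" using nf[OF lm(1)] nf[OF lm(2)] unfolding lm(3) by (rule HOL.trans[OF HOL.sym])
  then show "l = m" by simp
qed

lemma inv_into_embed: "i \<in> I \<Longrightarrow> a \<in> A i \<Longrightarrow> inv_into letters embed (\<iota> i a) = (i, a)"
  using inv_into_f_f[OF inj_on_embed, of "(i, a)"] by simp

lemma product_gensE:
  assumes "b \<in> product_gens"
  obtains j a where "j \<in> I" "a \<in> A j" "b = \<iota> j a"
  using assms that by (auto simp: product_gens_def)

lemma incl_product_gens: "i \<in> I \<Longrightarrow> a \<in> A i \<Longrightarrow> \<iota> i a \<in> product_gens"
  unfolding product_gens_def by (rule image_eqI[of _ _ "(i, a)"]) simp_all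

lemma map_incl_lists: "i \<in> I \<Longrightarrow> w \<in> lists (A i) \<Longrightarrow> map (\<iota> i) w \<in> lists product_gens"
  by (induction w) (simp_all add: incl_product_gens)

lemma map_incl_inject:
  "i \<in> I \<Longrightarrow> u \<in> lists (A i) \<Longrightarrow> v \<in> lists (A i) \<Longrightarrow> map (\<iota> i) u = map (\<iota> i) v \<longleftrightarrow> u = v"
proof -
  assume i: "i \<in> I" "u \<in> lists (A i)" "v \<in> lists (A i)"
  have "inj_on (\<iota> i) (A i)"
  proof (rule inj_onI)
    fix a b assume ab: "a \<in> A i" "b \<in> A i" "\<iota> i a = \<iota> i b"
    have "(i, a) = (i, b)"
      using inv_into_embed[OF i(1) ab(1)] inv_into_embed[OF i(1) ab(2)] unfolding ab(3)
      by (rule HOL.trans[OF HOL.sym])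
    then show "a = b" by simp
  qed
  moreover have "set u \<union> set v \<subseteq> A i" using i(2,3) by (auto simp: in_lists_conv_set)
  ultimately have "inj_on (\<iota> i) (set u \<union> set v)" by (rule inj_on_subset)
  then show ?thesis by (rule inj_on_map_eq_map)
qed

lemma generated_group_product: "generated_group H product_gens"
proof -
  have gen: "\<iota> i g \<in> generate H product_gens" if i: "i \<in> I" and g: "g \<in> carrier (G i)" for i g
  proof -
    note generates = generated_group.generates[OF gens[OF i]]
    have "g \<in> generate (G i) (A i)" using g generates by simp
    then show ?thesis
    proof (induction rule: generate.induct)
      case one
      then show ?case using i by (simp add: incl_one generate.one)
    next
      case (incl h)
      then show ?case using i incl_product_gens by (intro generate.incl)
    next
      case (inv h)
      then show ?case using i incl_product_gens[OF i, of "inv\<^bsub>G i\<^esub> h"] gen_inv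
        by (intro generate.incl) simp
    next
      case (eng g h)
      then have "g \<in> carrier (G i)" "h \<in> carrier (G i)"
        using generates by simp_all
      then show ?case using eng.IH generate.eng i by (metis incl_hom)
    qed
  qed
  have sub: "product_gens \<subseteq> carrier H" unfolding product_gens_def using embed_closed by blast
  show ?thesis
  proof (rule generated_group.intro[OF H.is_group generated_group_axioms.intro])
    have "finite letters"
      unfolding letters_def using finite_vertices gens generated_group.finite_gens by blast
    then show "finite product_gens" by (simp add: product_gens_def)
    show "product_gens \<subseteq> carrier H" by (rule sub)
    show "\<one>\<^bsub>H\<^esub> \<notin> product_gens"
    proof
      assume "\<one>\<^bsub>H\<^esub> \<in> product_gens"
      then obtain i a where ia: "i \<in> I" "a \<in> A i" "\<one>\<^bsub>H\<^esub> = \<iota> i a" by (rule product_gensE)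
      have "nform (\<iota> i a) = [(i, a)]" using ia gen_carrier gen_not_one by (intro nform_incl) auto
      then show False using ia(3) nform_one by simp
    qed
    show "inv\<^bsub>H\<^esub> b \<in> product_gens" if "b \<in> product_gens" for b
    proof -
      from that obtain j a where "j \<in> I" "a \<in> A j" "b = \<iota> j a" by (rule product_gensE)
      then show ?thesis using gen_inv gen_carrier by (simp add: inv_incl incl_product_gens)
    qed
    show "generate H product_gens = carrier H"
    proof
      show "generate H product_gens \<subseteq> carrier H" using H.generate_incl[OF sub] .
      show "carrier H \<subseteq> generate H product_gens"
      proof
        fix x assume "x \<in> carrier H"
        then show "x \<in> generate H product_gens"
          by (induction x rule: generated) (simp_all add: generate.one generate.eng gen)
      qed
    qed
  qed
qed

lemma path_end_incl:
  "x \<in> carrier H \<Longrightarrow> i \<in> I \<Longrightarrow> g \<in> carrier (G i) \<Longrightarrow> w \<in> lists (A i) \<Longrightarrow>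
    path_end H (x \<otimes>\<^bsub>H\<^esub> \<iota> i g) (map (\<iota> i) w) = x \<otimes>\<^bsub>H\<^esub> \<iota> i (path_end (G i) g w)"
  by (induction w arbitrary: g) (simp_all add: gen_carrier H.m_assoc incl_closed incl_hom)

lemma path_from_incl:
  "x \<in> carrier H \<Longrightarrow> i \<in> I \<Longrightarrow> g \<in> carrier (G i) \<Longrightarrow> w \<in> lists (A i) \<Longrightarrow>
    path_from H (x \<otimes>\<^bsub>H\<^esub> \<iota> i g) (map (\<iota> i) w) =
    map (\<lambda>(h, a). (x \<otimes>\<^bsub>H\<^esub> \<iota> i h, \<iota> i a)) (path_from (G i) g w)"
  by (induction w arbitrary: g) (simp_all add: gen_carrier H.m_assoc incl_closed incl_hom)

lemma spell_extend: "j \<in> I \<Longrightarrow> spell (extend r j h) = spell r @ map (Pair j) (y j h)"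
  by (simp add: extend_def vertex_nf_one)

lemma embed_Pair [simp]: "embed \<circ> Pair i = \<iota> i"
  by (simp add: fun_eq_iff)

lemma spell_in_lists: "normal r \<Longrightarrow> spell r \<in> lists letters"
proof (induction r rule: spell.induct)
  case (2 i s r)
  have "map (Pair i) w \<in> lists letters" if "w \<in> lists (A i)" for w
    using that 2 by (induction w) auto
  then show ?case using 2 vertex_nf_lists[of i s] by simp
qed simp

lemma embed_word_in_lists: "w \<in> lists letters \<Longrightarrow> map embed w \<in> lists product_gens"
  by (induction w) (auto simp: product_gens_def)

lemma word_value_spell: "normal r \<Longrightarrow> word_value H (map embed (spell r)) = syllables_value r"
proof (induction r rule: spell.induct)
  case (2 i s r)
  then have r: "normal r" "i \<in> I" "s \<in> carrier (G i)" by simp_all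
  have "word_value H (map embed (spell ((i, s) # r))) = path_end H (syllables_value r) (map (\<iota> i) (y i s))"
    using 2 by simp
  also have "\<dots> = path_end H (syllables_value r \<otimes>\<^bsub>H\<^esub> \<iota> i \<one>\<^bsub>G i\<^esub>) (map (\<iota> i) (y i s))"
    using r by (simp add: incl_one syllables_value_closed)
  also have "\<dots> = syllables_value r \<otimes>\<^bsub>H\<^esub> \<iota> i (word_value (G i) (y i s))"
    using r by (intro path_end_incl) (simp_all add: syllables_value_closed vertex_nf_lists)
  also have "\<dots> = syllables_value ((i, s) # r)" using r by (simp add: vertex_nf_value)
  finally show ?case .
qed simp

lemma product_nf_syllables: "normal r \<Longrightarrow> product_nf (syllables_value r) = map embed (spell r)"
  by (simp add: product_nf_def nform_syllables_value)

lemma vertex_nf_last: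
  assumes "i \<in> I" "s \<in> carrier (G i)" "s \<noteq> \<one>\<^bsub>G i\<^esub>"
  obtains t a where "t \<in> carrier (G i)" "a \<in> A i" "s = t \<otimes>\<^bsub>G i\<^esub> a" "y i s = y i t @ [a]"
proof -
  have "y i s \<noteq> []" using vertex_nf_value[OF assms(1,2)] assms(3) by auto
  then obtain u a where u: "y i s = u @ [a]" by (cases "y i s" rule: rev_cases) auto
  let ?t = "word_value (G i) u"
  have l: "u \<in> lists (A i)" "a \<in> A i" using vertex_nf_lists[OF assms(1,2)] u by simp_all
  have "y i ?t = u" using vertex_nf_prefix[OF assms(1,2) u] .
  moreover have "s = ?t \<otimes>\<^bsub>G i\<^esub> a" using vertex_nf_value[OF assms(1,2)] u by simp
  ultimately show ?thesis using that[of ?t a] u l vertex_word_value[OF assms(1)] by simp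
qed

text \<open>Deleting the last letter replaces the last syllable by another element of its vertex group, or
  removes the syllable if this element is the identity.\<close>

lemma prefix_closed_product_nf: "prefix_closed_nf H product_gens product_nf"
  unfolding prefix_closed_nf_def
proof (intro ballI conjI allI impI)
  fix x assume x: "x \<in> carrier H"
  let ?r = "nform x"
  have r: "normal ?r" using normal_nform[OF x] .
  show "product_nf x \<in> lists product_gens"
    unfolding product_nf_def using spell_in_lists[OF r] embed_word_in_lists by blast
  show val: "word_value H (product_nf x) = x"
    unfolding product_nf_def using word_value_spell[OF r] syllables_value_nform[OF x] by simp
  fix u b assume ub: "product_nf x = u @ [b]"
  then obtain i s r' where r': "?r = (i, s) # r'"
    by (cases ?r rule: spell.cases) (auto simp: product_nf_def)
  then have n: "normal r'" "i \<in> I" "s \<in> carrier (G i)" "s \<noteq> \<one>\<^bsub>G i\<^esub>" "i \<notin> forbidden r'" using r by simp_all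
  obtain t a where t: "t \<in> carrier (G i)" "a \<in> A i" "y i s = y i t @ [a]"
    using vertex_nf_last[OF n(2-4)] by blast
  have "u = map embed (spell (extend r' i t))"
    using ub t n(2) by (simp add: product_nf_def r' spell_extend)
  moreover have "normal (extend r' i t)" using n t by (intro normal_extend)
  ultimately show "product_nf (word_value H u) = u"
    using word_value_spell product_nf_syllables by simp
qed

end

context graph_product_stackings begin

lemma product_flow_letters_extend:
  "j \<in> I \<Longrightarrow> normal r \<Longrightarrow> j \<notin> forbidden r \<Longrightarrow>
    product_flow_letters (extend r j h) (j, a) = map (Pair j) (\<phi> j h a)"
  by (cases r rule: forbidden.cases) (auto simp: extend_def)

context
  fixes r j h a
  assumes r: "normal r" "j \<notin> forbidden r" and j: "j \<in> I" and h: "h \<in> carrier (G j)" and a: "a \<in> A j"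
begin

lemma coset_mult:
  "syllables_value (extend r j h) \<otimes>\<^bsub>H\<^esub> \<iota> j a = syllables_value (extend r j (h \<otimes>\<^bsub>G j\<^esub> a))"
  using r j h gen_carrier[OF j a] incl_closed[of j]
  by (simp add: syllables_value_extend syllables_value_closed H.m_assoc incl_hom)

lemma coset_nf:
  "k \<in> carrier (G j) \<Longrightarrow>
    product_nf (syllables_value (extend r j k)) = map embed (spell r) @ map (\<iota> j) (y j k)"
  using r j by (simp add: product_nf_syllables normal_extend spell_extend)

lemma coset_flow:
  "product_flow (syllables_value (extend r j h)) (\<iota> j a) = map (\<iota> j) (\<phi> j h a)"
  using r j h a
  by (simp add: product_flow_def nform_syllables_value normal_extend inv_into_embed
      product_flow_letters_extend)

text \<open>The coset carries a translate of the Cayley graph of the vertex group together with its tree.\<close>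

lemma coset_tree_edge:
  "tree_edge H product_nf (syllables_value (extend r j h)) (\<iota> j a) \<longleftrightarrow> tree_edge (G j) (y j) h a"
proof -
  have ha: "h \<otimes>\<^bsub>G j\<^esub> a \<in> carrier (G j)" using h gen_carrier[OF j a] j by simp
  have l: "y j h @ [a] \<in> lists (A j)" "y j (h \<otimes>\<^bsub>G j\<^esub> a) @ [inv\<^bsub>G j\<^esub> a] \<in> lists (A j)"
    using vertex_nf_lists[OF j h] vertex_nf_lists[OF j ha] a gen_inv[OF j a] by simp_all
  show ?thesis
    using map_incl_inject[OF j vertex_nf_lists[OF j ha] l(1)] map_incl_inject[OF j vertex_nf_lists[OF j h] l(2)]
    unfolding tree_edge_def coset_mult coset_nf[OF h] coset_nf[OF ha] inv_incl[OF j gen_carrier[OF j a]]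
    by simp
qed

lemma coset_path:
  "path_from H (syllables_value (extend r j h)) (map (\<iota> j) (\<phi> j h a)) =
    map (\<lambda>(k, b). (syllables_value (extend r j k), \<iota> j b)) (path_from (G j) h (\<phi> j h a))"
proof -
  have s: "syllables_value (extend r j k) = syllables_value r \<otimes>\<^bsub>H\<^esub> \<iota> j k" if "k \<in> carrier (G j)" for k
    using syllables_value_extend[OF r(1) j that] .
  have "set (path_from (G j) h (\<phi> j h a)) \<subseteq> carrier (G j) \<times> A j"
    using generated_group.set_path_from[OF gens[OF j] h vertex_flow(1)[OF j h a]] .
  then have "map (\<lambda>(k, b). (syllables_value r \<otimes>\<^bsub>H\<^esub> \<iota> j k, \<iota> j b)) (path_from (G j) h (\<phi> j h a)) =
    map (\<lambda>(k, b). (syllables_value (extend r j k), \<iota> j b)) (path_from (G j) h (\<phi> j h a))"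
    by (intro map_cong[OF HOL.refl]) (auto simp: s)
  then show ?thesis
    unfolding s[OF h] using path_from_incl[OF syllables_value_closed[OF r(1)] j h vertex_flow(1)[OF j h a]]
    by simp
qed

end

context
  fixes r i s j a
  assumes r: "normal ((i, s) # r)" and ij: "i \<noteq> j" "j \<in> forbidden ((i, s) # r)" and a: "a \<in> A j"
begin

lemma shuffle_vertices: "i \<in> I" "j \<in> I" "adj j i" "s \<in> carrier (G i)" "s \<noteq> \<one>\<^bsub>G i\<^esub>" "normal r" "i \<notin> forbidden r"
  using r ij adj_in by auto

text \<open>The last letter \<open>c\<close> is split off from the last syllable \<open>s\<close>; \<open>extend r i t\<close> is what remains.\<close>

lemma shuffle_obtain:
  obtains t c where "t \<in> carrier (G i)" "c \<in> A i" "s = t \<otimes>\<^bsub>G i\<^esub> c" "y i s = y i t @ [c]"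
    "product_flow (syllables_value ((i, s) # r)) (\<iota> j a) = [inv\<^bsub>H\<^esub> (\<iota> i c), \<iota> j a, \<iota> i c]"
    "syllables_value ((i, s) # r) \<otimes>\<^bsub>H\<^esub> inv\<^bsub>H\<^esub> (\<iota> i c) = syllables_value (extend r i t)"
proof -
  note v = shuffle_vertices
  obtain t c where t: "t \<in> carrier (G i)" "c \<in> A i" "s = t \<otimes>\<^bsub>G i\<^esub> c" "y i s = y i t @ [c]"
    using vertex_nf_last[OF v(1,4,5)] .
  have c: "c \<in> carrier (G i)" using gen_carrier[OF v(1) t(2)] .
  have "product_flow_letters ((i, s) # r) (j, a) = [(i, inv\<^bsub>G i\<^esub> c), (j, a), (i, c)]"
    using ij t(4) by simp
  then have flow: "product_flow (syllables_value ((i, s) # r)) (\<iota> j a) = [inv\<^bsub>H\<^esub> (\<iota> i c), \<iota> j a, \<iota> i c]"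
    unfolding product_flow_def nform_syllables_value[OF r] inv_into_embed[OF v(2) a] inv_incl[OF v(1) c]
    by simp
  have cl: "\<iota> i t \<in> carrier H" "\<iota> i c \<in> carrier H" using incl_closed v(1) t(1) c by simp_all
  have "syllables_value ((i, s) # r) = syllables_value r \<otimes>\<^bsub>H\<^esub> \<iota> i t \<otimes>\<^bsub>H\<^esub> \<iota> i c"
    using incl_hom[OF v(1) t(1) c] cl syllables_value_closed[OF v(6)] by (simp add: t(3) H.m_assoc)
  then have "syllables_value ((i, s) # r) \<otimes>\<^bsub>H\<^esub> inv\<^bsub>H\<^esub> (\<iota> i c) = syllables_value r \<otimes>\<^bsub>H\<^esub> \<iota> i t"
    using cl syllables_value_closed[OF v(6)] by (simp add: H.m_assoc)
  also have "\<dots> = syllables_value (extend r i t)"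
    using syllables_value_extend[OF v(6,1) t(1)] by simp
  finally show ?thesis using that[OF t flow] by simp
qed

lemma shuffle_nf_last:
  assumes t: "t \<in> carrier (G i)" "c \<in> A i" "s = t \<otimes>\<^bsub>G i\<^esub> c" "y i s = y i t @ [c]"
    and q: "normal q" "i \<notin> forbidden q"
  shows "product_nf (syllables_value ((i, s) # q)) = product_nf (syllables_value (extend q i t)) @ [\<iota> i c]"
proof -
  note v = shuffle_vertices
  have "normal ((i, s) # q)" "normal (extend q i t)" using q t(1) v normal_extend by simp_all
  note product_nf_syllables[OF this(1)] product_nf_syllables[OF this(2)]
  moreover have "map embed (spell ((i, s) # q)) = map embed (spell (extend q i t)) @ [\<iota> i c]"
    unfolding spell_extend[OF v(1)] spell.simps t(4) by simp
  ultimately show ?thesis by (simp only:)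
qed

lemma shuffle_act:
  assumes t: "t \<in> carrier (G i)"
  shows "act (extend r i t) j a = extend (act r j a) i t"
    and "normal (act r j a)" "i \<notin> forbidden (act r j a)"
proof -
  have "j \<in> forbidden r \<or> j < i" using ij by simp
  then show "i \<notin> forbidden (act r j a)"
    using act_keeps_allowed[of r i j a] shuffle_vertices adj_commute by blast
  show "normal (act r j a)"
    using normal_act[OF shuffle_vertices(6,2) gen_carrier[OF shuffle_vertices(2) a]] .
  show "act (extend r i t) j a = extend (act r j a) i t"
    using ij by (auto simp: extend_def)
qed

lemma shuffle_not_tree_edge: "\<not> tree_edge H product_nf (syllables_value ((i, s) # r)) (\<iota> j a)"
proof
  note v = shuffle_vertices
  have ja: "a \<in> carrier (G j)" using gen_carrier[OF v(2) a] .
  obtain t c where t: "t \<in> carrier (G i)" "c \<in> A i" "s = t \<otimes>\<^bsub>G i\<^esub> c" "y i s = y i t @ [c]"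
    using shuffle_obtain .
  have "act ((i, s) # r) j a = (i, s) # act r j a" using ij by simp
  then have prod: "syllables_value ((i, s) # r) \<otimes>\<^bsub>H\<^esub> \<iota> j a = syllables_value ((i, s) # act r j a)"
    using syllables_value_act[OF r v(2) ja] by simp
  have l1: "last (product_nf (syllables_value ((i, s) # act r j a))) = \<iota> i c"
    unfolding shuffle_nf_last[OF t shuffle_act(2,3)[OF t(1)]] by simp
  have l2: "last (product_nf (syllables_value ((i, s) # r))) = \<iota> i c"
    unfolding shuffle_nf_last[OF t v(6,7)] by simp
  have "\<iota> i c \<noteq> \<iota> j b" if "b \<in> A j" for b
  proof
    assume "\<iota> i c = \<iota> j b"
    then have "(i, c) = (j, b)"
      using inj_onD[OF inj_on_embed, of "(i, c)" "(j, b)"] t(2) that v(1,2) by simp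
    then show False using ij by simp
  qed
  moreover assume "tree_edge H product_nf (syllables_value ((i, s) # r)) (\<iota> j a)"
  then have "last (product_nf (syllables_value ((i, s) # act r j a))) = \<iota> j a \<or>
      last (product_nf (syllables_value ((i, s) # r))) = \<iota> j (inv\<^bsub>G j\<^esub> a)"
    unfolding tree_edge_def prod inv_incl[OF v(2) ja] by (metis last_snoc)
  ultimately show False using a gen_inv[OF v(2) a] unfolding l1 l2 by blast
qed

text \<open>Multiplication by \<open>a\<close> leaves the last syllable unchanged, so \<open>c\<close> is the last letter of the normal
  form also after this multiplication. Therefore both outer edges of the path lie in the tree.\<close>

lemma shuffle_edges:
  assumes c: "c \<in> A i" and t: "t \<in> carrier (G i)" "s = t \<otimes>\<^bsub>G i\<^esub> c" "y i s = y i t @ [c]"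
    and xc: "syllables_value ((i, s) # r) \<otimes>\<^bsub>H\<^esub> inv\<^bsub>H\<^esub> (\<iota> i c) = syllables_value (extend r i t)"
  shows "tree_edge H product_nf (syllables_value ((i, s) # r)) (inv\<^bsub>H\<^esub> (\<iota> i c))"
    and "tree_edge H product_nf (syllables_value (extend r i t) \<otimes>\<^bsub>H\<^esub> \<iota> j a) (\<iota> i c)"
proof -
  note v = shuffle_vertices
  have ic: "\<iota> i c \<in> carrier H" using incl_closed[OF v(1) gen_carrier[OF v(1) c]] .
  show "tree_edge H product_nf (syllables_value ((i, s) # r)) (inv\<^bsub>H\<^esub> (\<iota> i c))"
    unfolding tree_edge_def xc using shuffle_nf_last[OF t(1) c t(2,3) v(6,7)] ic by simp
  let ?q = "act r j a"
  have q: "normal ?q" "i \<notin> forbidden ?q" using shuffle_act[OF t(1)] by simp_all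
  have "normal (extend r i t)" using v t by (intro normal_extend)
  then have e: "syllables_value (extend r i t) \<otimes>\<^bsub>H\<^esub> \<iota> j a = syllables_value (extend ?q i t)"
    using syllables_value_act[OF _ v(2) gen_carrier[OF v(2) a]] shuffle_act(1)[OF t(1)] by metis
  have "syllables_value (extend ?q i t) \<otimes>\<^bsub>H\<^esub> \<iota> i c = syllables_value ((i, s) # ?q)"
    using syllables_value_extend[OF q(1) v(1) t(1)] incl_hom[OF v(1) t(1) gen_carrier[OF v(1) c]]
      incl_closed[OF v(1) t(1)] ic syllables_value_closed[OF q(1)]
    by (simp add: t(2) H.m_assoc)
  then show "tree_edge H product_nf (syllables_value (extend r i t) \<otimes>\<^bsub>H\<^esub> \<iota> j a) (\<iota> i c)"
    unfolding tree_edge_def e using shuffle_nf_last[OF t(1) c t(2,3) q] by simp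
qed

end

lemma product_flow_value:
  assumes x: "x \<in> carrier H" and gen: "b \<in> product_gens"
  shows "product_flow x b \<in> lists product_gens" "word_value H (product_flow x b) = b"
    "tree_edge H product_nf x b \<Longrightarrow> product_flow x b = [b]"
proof -
  obtain j a where j: "j \<in> I" and a: "a \<in> A j" and b: "b = \<iota> j a" using product_gensE[OF gen] .
  have n: "normal (nform x)" and xe: "x = syllables_value (nform x)"
    using normal_nform[OF x] syllables_value_nform[OF x] by simp_all
  have "product_flow x b \<in> lists product_gens \<and> word_value H (product_flow x b) = b \<and>
    (tree_edge H product_nf x b \<longrightarrow> product_flow x b = [b])"
    using n j
  proof (cases rule: extend_cases)
    case (coset r h)
    have xr: "x = syllables_value (extend r j h)" using xe coset(4) by simp
    note flow = coset_flow[OF coset(1,2) j coset(3) a, folded xr b]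
    note te = coset_tree_edge[OF coset(1,2) j coset(3) a, folded xr b]
    note vf = vertex_flow[OF j coset(3) a]
    have "word_value H (map (\<iota> j) (\<phi> j h a)) = path_end H (\<one>\<^bsub>H\<^esub> \<otimes>\<^bsub>H\<^esub> \<iota> j \<one>\<^bsub>G j\<^esub>) (map (\<iota> j) (\<phi> j h a))"
      using j by (simp add: incl_one)
    also have "\<dots> = \<one>\<^bsub>H\<^esub> \<otimes>\<^bsub>H\<^esub> \<iota> j (word_value (G j) (\<phi> j h a))"
      by (rule path_end_incl) (use j vf in simp_all)
    also have "\<dots> = b" using incl_closed[OF j gen_carrier[OF j a]] by (simp add: vf(2) b)
    finally have "word_value H (map (\<iota> j) (\<phi> j h a)) = b" .
    then show ?thesis
      unfolding flow te using map_incl_lists[OF j vf(1)] vf(3) b by simp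
  next
    case (shuffle i s r)
    have r: "normal ((i, s) # r)" using n shuffle(1) by simp
    have jf: "j \<in> forbidden ((i, s) # r)" using shuffle(1,3) by simp
    have xr: "x = syllables_value ((i, s) # r)" using xe shuffle(1) by simp
    obtain t c where c: "c \<in> A i" "product_flow x b = [inv\<^bsub>H\<^esub> (\<iota> i c), b, \<iota> i c]"
      using shuffle_obtain[OF r shuffle(2) jf a] unfolding xr b by metis
    have i: "i \<in> I" using r by simp
    have ic: "\<iota> i c \<in> carrier H" "b \<in> carrier H"
      using incl_closed gen_carrier i j a c b by simp_all
    have "b \<otimes>\<^bsub>H\<^esub> \<iota> i c = \<iota> i c \<otimes>\<^bsub>H\<^esub> b"
      unfolding b using incl_adj[OF shuffle(4) gen_carrier[OF j a] gen_carrier[OF i c(1)]] .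
    then have "inv\<^bsub>H\<^esub> (\<iota> i c) \<otimes>\<^bsub>H\<^esub> b \<otimes>\<^bsub>H\<^esub> \<iota> i c = b"
      using ic H.m_assoc[of "inv\<^bsub>H\<^esub> (\<iota> i c)" b "\<iota> i c"] H.m_assoc[of "inv\<^bsub>H\<^esub> (\<iota> i c)" "\<iota> i c" b]
      by simp
    then have "word_value H (product_flow x b) = b" unfolding c(2) using ic by simp
    moreover have "inv\<^bsub>H\<^esub> (\<iota> i c) \<in> product_gens"
      unfolding inv_incl[OF i gen_carrier[OF i c(1)]] using incl_product_gens[OF i gen_inv[OF i c(1)]] .
    then have "product_flow x b \<in> lists product_gens"
      unfolding c(2) using incl_product_gens[OF i c(1)] gen by simp
    moreover have "\<not> tree_edge H product_nf x b"
      using shuffle_not_tree_edge[OF r shuffle(2) jf a] unfolding xr b .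
    ultimately show ?thesis by blast
  qed
  then show "product_flow x b \<in> lists product_gens" "word_value H (product_flow x b) = b"
    "tree_edge H product_nf x b \<Longrightarrow> product_flow x b = [b]" by blast+
qed

lemma product_flow_bounded: "\<exists>k. \<forall>x\<in>carrier H. \<forall>b\<in>product_gens. length (product_flow x b) \<le> k"
proof -
  have "\<forall>i\<in>I. \<exists>k. \<forall>g\<in>carrier (G i). \<forall>a\<in>A i. length (\<phi> i g a) \<le> k"
    using stackings unfolding stacking_def by blast
  then obtain k where k: "\<forall>i\<in>I. \<forall>g\<in>carrier (G i). \<forall>a\<in>A i. length (\<phi> i g a) \<le> k i"
    by (rule bchoice[THEN exE])
  \<comment> \<open>Paths inside a coset are bounded by \<open>k j\<close>, all other paths have three edges.\<close>
  have "length (product_flow x b) \<le> 3 + sum k I" if x: "x \<in> carrier H" and b: "b \<in> product_gens" for x b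
  proof -
    obtain j a where j: "j \<in> I" and a: "a \<in> A j" and b: "b = \<iota> j a" using product_gensE[OF b] .
    have n: "normal (nform x)" and xe: "x = syllables_value (nform x)"
      using normal_nform[OF x] syllables_value_nform[OF x] by simp_all
    show ?thesis
      using n j
    proof (cases rule: extend_cases)
      case (coset r h)
      have xr: "x = syllables_value (extend r j h)" using xe coset(4) by simp
      have "length (product_flow x b) \<le> k j"
        unfolding coset_flow[OF coset(1,2) j coset(3) a, folded xr b] using k j coset(3) a by simp
      also have "\<dots> \<le> sum k I" using member_le_sum[OF j _ finite_vertices, of k] by simp
      finally show ?thesis by simp
    next
      case (shuffle i s r)
      have r: "normal ((i, s) # r)" and jf: "j \<in> forbidden ((i, s) # r)" using n shuffle(1,3) by simp_all
      have xr: "x = syllables_value ((i, s) # r)" using xe shuffle(1) by simp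
      obtain c where "product_flow x b = [inv\<^bsub>H\<^esub> (\<iota> i c), b, \<iota> i c]"
        using shuffle_obtain[OF r shuffle(2) jf a] unfolding xr b by metis
      then show ?thesis by simp
    qed
  qed
  then show ?thesis by blast
qed

text \<open>Inside a coset, the flow stays in the coset and descends because it does so in the vertex group.
  Directly below an edge of the second kind there is only the middle edge of its path, which starts
  at an element with a shorter normal form.\<close>

lemma wf_product_flow: "wf (flow_relation H product_gens product_nf product_flow)" (is "wf ?R")
proof (rule acc_wfI, rule allI)
  have coset_acc: "(syllables_value (extend r j (fst e)), \<iota> j (snd e)) \<in> Wellfounded.acc ?R"
    if r: "normal r" "j \<notin> forbidden r" and j: "j \<in> I" and "e \<in> carrier (G j) \<times> A j" for r j e
  proof -
    let ?S = "flow_relation (G j) (A j) (y j) (\<phi> j)"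
    have "wf ?S" using stackings[OF j] unfolding stacking_def by blast
    then show ?thesis using that(4)
    proof (induction e rule: wf_induct_rule)
      case (less e)
      obtain h a where e: "e = (h, a)" by (cases e)
      have ha: "h \<in> carrier (G j)" "a \<in> A j" using less.prems e by simp_all
      show ?case
      proof (rule accI)
        fix f assume f: "(f, (syllables_value (extend r j (fst e)), \<iota> j (snd e))) \<in> ?R"
        obtain z d where zd: "f = (z, d)" by (cases f)
        have "(z, d) \<in> set (path_from H (syllables_value (extend r j h)) (map (\<iota> j) (\<phi> j h a)))"
          and nt: "\<not> tree_edge H product_nf (syllables_value (extend r j h)) (\<iota> j a)" "\<not> tree_edge H product_nf z d"
          using f unfolding zd e flow_relation_def by (simp_all add: coset_flow[OF r j ha])
        then obtain k b where kb: "(k, b) \<in> set (path_from (G j) h (\<phi> j h a))"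
            "z = syllables_value (extend r j k)" "d = \<iota> j b"
          unfolding coset_path[OF r j ha] by auto
        have kb': "k \<in> carrier (G j)" "b \<in> A j"
          using generated_group.set_path_from[OF gens[OF j] ha(1) vertex_flow(1)[OF j ha]] kb(1) by auto
        have "((k, b), e) \<in> ?S"
          using nt ha kb(1) unfolding e kb(2,3) coset_tree_edge[OF r j ha] coset_tree_edge[OF r j kb']
            by (simp add: flow_relation_def)
        from less.IH[OF this] show "f \<in> Wellfounded.acc ?R" using kb' unfolding zd kb(2,3) by simp
      qed
    qed
  qed
  have all: "(x, b) \<in> Wellfounded.acc ?R" if "x \<in> carrier H" and b: "b \<in> product_gens" for x b
    using that(1)
  proof (induction "length (product_nf x)" arbitrary: x rule: less_induct)
    case less
    note x = less.prems
    obtain j a where j: "j \<in> I" and a: "a \<in> A j" and b: "b = \<iota> j a" using product_gensE[OF b] .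
    have n: "normal (nform x)" and xe: "x = syllables_value (nform x)"
      using normal_nform[OF x] syllables_value_nform[OF x] by simp_all
    show ?case
      using n j
    proof (cases rule: extend_cases)
      case (coset r h)
      have xr: "x = syllables_value (extend r j h)" using xe coset(4) by simp
      show ?thesis
        unfolding xr b using coset_acc[OF coset(1,2) j, of "(h, a)"] coset(3) a by simp
    next
      case (shuffle i s r)
      have r: "normal ((i, s) # r)" and jf: "j \<in> forbidden ((i, s) # r)" using n shuffle(1,3) by simp_all
      have xr: "x = syllables_value ((i, s) # r)" using xe shuffle(1) by simp
      note v = shuffle_vertices[OF r shuffle(2) jf a]
      obtain t c where t: "t \<in> carrier (G i)" "c \<in> A i" "s = t \<otimes>\<^bsub>G i\<^esub> c" "y i s = y i t @ [c]"
          and flow: "product_flow x b = [inv\<^bsub>H\<^esub> (\<iota> i c), b, \<iota> i c]"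
          and xc: "x \<otimes>\<^bsub>H\<^esub> inv\<^bsub>H\<^esub> (\<iota> i c) = syllables_value (extend r i t)"
        using shuffle_obtain[OF r shuffle(2) jf a] unfolding xr b by blast
      note te = shuffle_edges[OF r shuffle(2) jf a t(2,1,3,4) xc[unfolded xr], folded xr xc b]
      let ?z = "x \<otimes>\<^bsub>H\<^esub> inv\<^bsub>H\<^esub> (\<iota> i c)"
      have "product_nf x = product_nf ?z @ [\<iota> i c]"
        unfolding xc using shuffle_nf_last[OF r shuffle(2) jf a t v(6,7)] by (simp only: xr)
      then have len: "length (product_nf ?z) < length (product_nf x)" by simp
      have z: "?z \<in> carrier H"
        unfolding xc using normal_extend[OF v(6,1) t(1) v(7)] by (rule syllables_value_closed)
      show ?thesis
      proof (rule accI)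
        fix f assume f: "(f, (x, b)) \<in> ?R"
        obtain z d where zd: "f = (z, d)" by (cases f)
        from f have "(z, d) \<in> set (path_from H x (product_flow x b))"
          and nt: "\<not> tree_edge H product_nf z d" unfolding zd flow_relation_def by simp_all
        then have "f = (x, inv\<^bsub>H\<^esub> (\<iota> i c)) \<or> f = (?z, b) \<or> f = (?z \<otimes>\<^bsub>H\<^esub> b, \<iota> i c)"
          unfolding flow zd by simp
        then have "f = (?z, b)" using te nt zd by blast
        then show "f \<in> Wellfounded.acc ?R" using less.hyps[OF len z] by simp
      qed
    qed
  qed
  fix e :: "'h \<times> 'h"
  obtain x b where e: "e = (x, b)" by (cases e)
  show "e \<in> Wellfounded.acc ?R"
  proof (cases "x \<in> carrier H \<and> b \<in> product_gens")
    case True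
    then show ?thesis using all e by simp
  next
    case False
    then show ?thesis by - (rule accI, simp add: e flow_relation_def split: prod.splits)
  qed
qed

theorem stacking_product: "stacking H product_gens product_nf product_flow"
  unfolding stacking_def
  by (intro conjI ballI impI prefix_closed_product_nf product_flow_bounded wf_product_flow)
    (rule product_flow_value; assumption)+

end

section \<open>Slices of the stacking map\<close>

text \<open>The stacking language is the union, over letters \<open>a\<close> and words \<open>x\<close>, of the triples whose last two
  components are \<open>a\<close> and \<open>x\<close>; these triples form a slice.\<close>

definition stacking_slice ::
    "('a, 'm) monoid_scheme \<Rightarrow> ('a \<Rightarrow> 'a list) \<Rightarrow> ('a \<Rightarrow> 'a \<Rightarrow> 'a list) \<Rightarrow> 'a \<Rightarrow> 'a list \<Rightarrow> 'a list set"
  where "stacking_slice G y \<phi> a x = y ` {g \<in> carrier G. \<phi> g a = x}"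

context generated_group begin

context
  notes in_listsD [rule del] and in_listsI [rule del]
  fixes y \<phi> assumes stacking: "stacking G A y \<phi>"
begin

lemma stacking_bound: "\<exists>k. \<forall>g\<in>carrier G. \<forall>a\<in>A. \<phi> g a \<in> {x \<in> lists A. length x \<le> k}"
proof -
  have "\<exists>k. \<forall>g\<in>carrier G. \<forall>a\<in>A. length (\<phi> g a) \<le> k" using stacking unfolding stacking_def by blast
  then obtain k where k: "\<forall>g\<in>carrier G. \<forall>a\<in>A. length (\<phi> g a) \<le> k" by (rule exE)
  have "\<phi> g a \<in> {x \<in> lists A. length x \<le> k}" if "g \<in> carrier G" "a \<in> A" for g a
    using stacking k that unfolding stacking_def by simp
  then show ?thesis by blast
qed

lemma finite_bounded_words: "finite {x \<in> lists A. length x \<le> k}"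
  using finite_lists_length_le[OF finite_gens, of k] by (simp add: lists_eq_set)

lemma nf_in_lists: "g \<in> carrier G \<Longrightarrow> y g \<in> lists A"
  using stacking unfolding stacking_def prefix_closed_nf_def by simp

lemma stacking_slice_eq:
  "a \<in> A \<Longrightarrow> {u \<in> lists A. [u, [a], x] \<in> stacking_language G A y \<phi>} = stacking_slice G y \<phi> a x"
  using nf_in_lists unfolding stacking_language_def stacking_slice_def by (auto simp: image_iff)

lemma stacking_language_UN:
  obtains S where "finite S" "S \<subseteq> A \<times> lists A"
    "stacking_language G A y \<phi> = (\<Union>(a, x)\<in>S. (\<lambda>u. [u, [a], x]) ` stacking_slice G y \<phi> a x)"
proof -
  from stacking_bound obtain k
    where k: "\<forall>g\<in>carrier G. \<forall>a\<in>A. \<phi> g a \<in> {x \<in> lists A. length x \<le> k}" by (rule exE)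
  let ?S = "A \<times> {x \<in> lists A. length x \<le> k}"
  have "stacking_language G A y \<phi> = (\<Union>(a, x)\<in>?S. (\<lambda>u. [u, [a], x]) ` stacking_slice G y \<phi> a x)"
  proof (intro subset_antisym subsetI)
    fix us assume "us \<in> stacking_language G A y \<phi>"
    then obtain g a where us: "us = [y g, [a], \<phi> g a]" "g \<in> carrier G" "a \<in> A"
      unfolding stacking_language_def by blast
    then have "y g \<in> stacking_slice G y \<phi> a (\<phi> g a)" by (simp add: stacking_slice_def)
    then show "us \<in> (\<Union>(a, x)\<in>?S. (\<lambda>u. [u, [a], x]) ` stacking_slice G y \<phi> a x)"
      using bspec[OF bspec[OF k us(2)] us(3)] us by (intro UN_I[of "(a, \<phi> g a)"]) simp_all
  next
    fix us assume "us \<in> (\<Union>(a, x)\<in>?S. (\<lambda>u. [u, [a], x]) ` stacking_slice G y \<phi> a x)"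
    then show "us \<in> stacking_language G A y \<phi>"
      unfolding stacking_language_def stacking_slice_def by auto
  qed
  then show ?thesis using that[of ?S] finite_gens finite_bounded_words by blast
qed

lemma nf_set_UN:
  assumes "a \<in> A"
  obtains X where "finite X" "X \<subseteq> lists A" "y ` carrier G = (\<Union>x\<in>X. stacking_slice G y \<phi> a x)"
proof -
  from stacking_bound obtain k
    where k: "\<forall>g\<in>carrier G. \<forall>a\<in>A. \<phi> g a \<in> {x \<in> lists A. length x \<le> k}" by (rule exE)
  have "y ` carrier G = (\<Union>x\<in>{x \<in> lists A. length x \<le> k}. stacking_slice G y \<phi> a x)"
    using k assms unfolding stacking_slice_def by auto
  then show ?thesis using that[of "{x \<in> lists A. length x \<le> k}"] finite_bounded_words by blast
qed

lemma nf_set_no_gens: "A = {} \<Longrightarrow> y ` carrier G = {[]}"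
  using nf_in_lists one_closed by (force simp: image_iff)

text \<open>For a fixed letter, the slices also cover the set of normal forms; if there is no letter, the
  empty word is the only normal form.\<close>

lemma regular_slices:
  assumes "synchronously_regular 3 A (stacking_language G A y \<phi>)"
  shows "a \<in> A \<Longrightarrow> x \<in> lists A \<Longrightarrow> regular_language A (stacking_slice G y \<phi> a x)"
    and "regular_language A (y ` carrier G)"
proof -
  have len: "\<forall>us\<in>stacking_language G A y \<phi>. length us = 3"
    by (auto simp: stacking_language_def)
  show *: "regular_language A (stacking_slice G y \<phi> a x)" if "a \<in> A" "x \<in> lists A" for a x
    using regular_language_slice[OF assms len that] stacking_slice_eq[OF that(1)] by simp
  show "regular_language A (y ` carrier G)"
  proof (cases "A = {}")
    case True
    show ?thesis
      by (rule regular_languageI[of _ "\<lambda>_. ()"])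
        (use True nf_set_no_gens in \<open>auto simp: finite_state_def saturates_def\<close>)
  next
    case False
    then obtain a where a: "a \<in> A" by blast
    obtain X where X: "finite X" "X \<subseteq> lists A" "y ` carrier G = (\<Union>x\<in>X. stacking_slice G y \<phi> a x)"
      using nf_set_UN[OF a] .
    show ?thesis unfolding X(3) using X(2) by (intro regular_language_UN X(1) *[OF a]) auto
  qed
qed

lemma synchronously_regular_if_slices:
  assumes "\<And>a x. a \<in> A \<Longrightarrow> x \<in> lists A \<Longrightarrow> regular_language A (stacking_slice G y \<phi> a x)"
  shows "synchronously_regular 3 A (stacking_language G A y \<phi>)"
proof -
  obtain S where S: "finite S" "S \<subseteq> A \<times> lists A"
    "stacking_language G A y \<phi> = (\<Union>(a, x)\<in>S. (\<lambda>u. [u, [a], x]) ` stacking_slice G y \<phi> a x)"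
    by (rule stacking_language_UN)
  show ?thesis unfolding S(3) using S(2) assms by (intro synchronously_regular_UN[OF S(1)]) auto
qed

lemma decidable_slices:
  assumes "decidable_tuples 3 A (stacking_language G A y \<phi>)"
  obtains c where "inj_on c A"
    "\<And>a x. a \<in> A \<Longrightarrow> x \<in> lists A \<Longrightarrow> decidable_language c A (stacking_slice G y \<phi> a x)"
    "decidable_language c A (y ` carrier G)"
proof (rule decidable_language_slice[OF assms])
  fix c assume c: "inj_on c A" and dec: "\<And>a x. a \<in> A \<Longrightarrow> x \<in> lists A \<Longrightarrow>
      decidable_language c A {u \<in> lists A. [u, [a], x] \<in> stacking_language G A y \<phi>}"
  have *: "decidable_language c A (stacking_slice G y \<phi> a x)" if "a \<in> A" "x \<in> lists A" for a x
    using dec[OF that] stacking_slice_eq[OF that(1)] by simp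
  have "decidable_language c A (y ` carrier G)"
  proof (cases "A = {}")
    case True
    show ?thesis
      unfolding decidable_language_def
      by (rule exI[of _ "\<lambda>_. 1"]) (simp add: computable_const True nf_set_no_gens[OF True])
  next
    case False
    then obtain a where a: "a \<in> A" by blast
    obtain X where X: "finite X" "X \<subseteq> lists A" "y ` carrier G = (\<Union>x\<in>X. stacking_slice G y \<phi> a x)"
      using nf_set_UN[OF a] .
    show ?thesis unfolding X(3) using X(2) by (intro decidable_language_UN X(1) *[OF a]) auto
  qed
  with c * show thesis by (rule that)
qed

lemma decidable_tuples_if_slices:
  assumes "inj_on c A"
    "\<And>a x. a \<in> A \<Longrightarrow> x \<in> lists A \<Longrightarrow> decidable_language c A (stacking_slice G y \<phi> a x)"
  shows "decidable_tuples 3 A (stacking_language G A y \<phi>)"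
proof -
  obtain S where S: "finite S" "S \<subseteq> A \<times> lists A"
    "stacking_language G A y \<phi> = (\<Union>(a, x)\<in>S. (\<lambda>u. [u, [a], x]) ` stacking_slice G y \<phi> a x)"
    by (rule stacking_language_UN)
  show ?thesis unfolding S(3) using S(2) assms by (intro decidable_tuples_UN[OF assms(1) S(1)]) auto
qed

end

end

section \<open>Reading normal forms of the graph product\<close>

context graph_product_stackings begin

context
  notes in_listsD [rule del] and in_listsI [rule del]
begin

definition vertex_nfs :: "nat \<Rightarrow> 'a list set" where
  "vertex_nfs i = y i ` carrier (G i)"

text \<open>A state consists of the forbidden vertices of the normal word read so far, the vertex of its last
  syllable, and the part of this syllable that has been read. Only the initial state has an empty
  part, and its vertex has no meaning.\<close>

fun read_letter :: "(nat set \<times> nat \<times> 'a list) option \<Rightarrow> nat \<times> 'a \<Rightarrow> (nat set \<times> nat \<times> 'a list) option" where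
  "read_letter None l = None"
| "read_letter (Some (F, i, u)) (j, a) =
    (if u \<noteq> [] \<and> j = i then (if u @ [a] \<in> vertex_nfs i then Some (F, i, u @ [a]) else None)
     else if j \<notin> F \<and> [a] \<in> vertex_nfs j then Some (forbid F j, j, [a]) else None)"

definition read_word :: "(nat \<times> 'a) list \<Rightarrow> (nat set \<times> nat \<times> 'a list) option" where
  "read_word = foldl read_letter (Some ({}, 0, []))"

fun state_of :: "(nat \<times> 'a) list \<Rightarrow> nat set \<times> nat \<times> 'a list" where
  "state_of [] = ({}, 0, [])"
| "state_of ((i, s) # r) = (forbidden ((i, s) # r), i, y i s)"

lemma vertex_nf_empty_iff: "i \<in> I \<Longrightarrow> s \<in> carrier (G i) \<Longrightarrow> y i s = [] \<longleftrightarrow> s = \<one>\<^bsub>G i\<^esub>"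
  using vertex_nf_value[of i s] vertex_nf_one[of i] by auto

lemma read_letter_new_syllable:
  assumes r: "normal r" and i: "i \<in> I" "i \<notin> forbidden r" and a: "[a] \<in> vertex_nfs i"
  shows "read_letter (Some (state_of r)) (i, a) = Some (forbid (forbidden r) i, i, [a])"
  using assms by (cases r rule: state_of.cases) auto

text \<open>The normal forms of the vertex groups are prefix closed, so every prefix of a spelled normal word
  is itself the spelling of a normal word. This is why membership may be tested after every letter.\<close>

lemma read_word_eq_Some:
  assumes "w \<in> lists letters"
  shows "read_word w = Some \<sigma> \<longleftrightarrow> (\<exists>r. normal r \<and> w = spell r \<and> \<sigma> = state_of r)"
  using assms
proof (induction w arbitrary: \<sigma> rule: rev_induct)
  case Nil
  have empty: "r = []" if "normal r" "spell r = []" for r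
  proof (cases r rule: state_of.cases)
    case (2 i s r')
    then show ?thesis using that vertex_nf_empty_iff[of i s] by simp
  qed simp
  have "(\<exists>r. normal r \<and> [] = spell r \<and> \<sigma> = state_of r) \<longleftrightarrow> \<sigma> = state_of []"
  proof
    assume "\<exists>r. normal r \<and> [] = spell r \<and> \<sigma> = state_of r"
    then obtain r where r: "normal r" "[] = spell r" "\<sigma> = state_of r" by blast
    show "\<sigma> = state_of []" using empty[OF r(1) r(2)[symmetric]] r(3) by simp
  next
    assume "\<sigma> = state_of []"
    then show "\<exists>r. normal r \<and> [] = spell r \<and> \<sigma> = state_of r" by (intro exI[of _ "[]"]) simp
  qed
  then show ?case by (auto simp: read_word_def)
next
  case (snoc l w)
  obtain j a where l: "l = (j, a)" by (cases l)
  have j: "j \<in> I" "a \<in> A j" and w: "w \<in> lists letters" using snoc.prems l by simp_all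
  note IH = snoc.IH[OF w]
  have step: "read_word (w @ [l]) = read_letter (read_word w) l" by (simp add: read_word_def)
  show ?case
  proof
    assume S: "read_word (w @ [l]) = Some \<sigma>"
    then obtain \<tau> where \<tau>: "read_word w = Some \<tau>" unfolding step by (cases "read_word w") auto
    then obtain r where r: "normal r" "w = spell r" "\<tau> = state_of r" using IH by blast
    have S': "read_letter (Some (state_of r)) (j, a) = Some \<sigma>" using S step \<tau> r(3) l by simp
    have new: "\<exists>r. normal r \<and> w @ [l] = spell r \<and> \<sigma> = state_of r"
      if nw: "j \<notin> forbidden r" "[a] \<in> vertex_nfs j" "\<sigma> = (forbid (forbidden r) j, j, [a])"
    proof -
      obtain s where s: "s \<in> carrier (G j)" "y j s = [a]" using nw(2) unfolding vertex_nfs_def by auto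
      then have "s \<noteq> \<one>\<^bsub>G j\<^esub>" using vertex_nf_one[OF j(1)] by auto
      then have "normal ((j, s) # r)" using r(1) j(1) s(1) nw(1) by simp
      moreover have "w @ [l] = spell ((j, s) # r)" using r(2) s(2) l by simp
      moreover have "\<sigma> = state_of ((j, s) # r)" using nw(3) s(2) by simp
      ultimately show ?thesis by blast
    qed
    show "\<exists>r. normal r \<and> w @ [l] = spell r \<and> \<sigma> = state_of r"
    proof (cases r rule: state_of.cases)
      case 1
      then show ?thesis using S' new by (auto split: if_splits)
    next
      case (2 i s r')
      have n: "normal r'" "i \<in> I" "s \<in> carrier (G i)" "s \<noteq> \<one>\<^bsub>G i\<^esub>" "i \<notin> forbidden r'" using r(1) 2 by simp_all
      have ne: "y i s \<noteq> []" using vertex_nf_empty_iff n by simp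
      show ?thesis
      proof (cases "j = i")
        case True
        then have "y i s @ [a] \<in> vertex_nfs i" and \<sigma>: "\<sigma> = (forbidden r, i, y i s @ [a])"
          using S' ne unfolding 2 by (simp_all split: if_splits)
        then obtain t where t: "t \<in> carrier (G i)" "y i t = y i s @ [a]" unfolding vertex_nfs_def by auto
        then have "t \<noteq> \<one>\<^bsub>G i\<^esub>" using vertex_nf_one[OF n(2)] by auto
        then have "normal ((i, t) # r')" using n t(1) by simp
        moreover have "w @ [l] = spell ((i, t) # r')" using r(2) t(2) l True unfolding 2 by simp
        moreover have "\<sigma> = state_of ((i, t) # r')" using \<sigma> t(2) unfolding 2 by simp
        ultimately show ?thesis by blast
      next
        case False
        then have "j \<notin> forbidden r \<and> [a] \<in> vertex_nfs j \<and> \<sigma> = (forbid (forbidden r) j, j, [a])"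
          using S' unfolding 2 by (simp split: if_splits)
        then show ?thesis using new by blast
      qed
    qed
  next
    assume "\<exists>r. normal r \<and> w @ [l] = spell r \<and> \<sigma> = state_of r"
    then obtain q where q: "normal q" "w @ [l] = spell q" "\<sigma> = state_of q" by blast
    then obtain i s r where qr: "q = (i, s) # r" by (cases q rule: state_of.cases) auto
    have n: "normal r" "i \<in> I" "s \<in> carrier (G i)" "s \<noteq> \<one>\<^bsub>G i\<^esub>" "i \<notin> forbidden r" using q(1) qr by simp_all
    obtain t b where t: "t \<in> carrier (G i)" "b \<in> A i" "s = t \<otimes>\<^bsub>G i\<^esub> b" "y i s = y i t @ [b]"
      using vertex_nf_last[OF n(2-4)] .
    have sp: "w = spell r @ map (Pair i) (y i t)" "l = (i, b)" using q(2) t(4) unfolding qr by simp_all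
    then have ji: "j = i" "b = a" using l by simp_all
    have mem: "y i s \<in> vertex_nfs i" using n(3) by (simp add: vertex_nfs_def)
    show "read_word (w @ [l]) = Some \<sigma>"
    proof (cases "t = \<one>\<^bsub>G i\<^esub>")
      case True
      then have yt: "y i t = []" using vertex_nf_one n(2) by simp
      then have "read_word w = Some (state_of r)" using sp(1) n(1) IH by auto
      moreover have "[b] \<in> vertex_nfs i" using mem t(4) yt by simp
      ultimately show ?thesis
        unfolding q(3) qr using step sp(2) read_letter_new_syllable[OF n(1,2,5), of b] t(4) yt by simp
    next
      case False
      then have "normal ((i, t) # r)" using n t(1) by simp
      moreover have "w = spell ((i, t) # r)" using sp(1) by simp
      ultimately have "read_word w = Some (state_of ((i, t) # r))" using IH by blast
      moreover have "y i t \<noteq> []" using False vertex_nf_empty_iff[OF n(2) t(1)] by simp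
      moreover have "y i t @ [b] \<in> vertex_nfs i" using mem t(4) by simp
      ultimately show ?thesis unfolding q(3) qr using step sp(2) t(4) by simp
    qed
  qed
qed

fun flow_accepts :: "nat \<times> 'a \<Rightarrow> (nat \<times> 'a) list \<Rightarrow> nat set \<times> nat \<times> 'a list \<Rightarrow> bool" where
  "flow_accepts (j, a) x (F, i, u) \<longleftrightarrow>
    (if u \<noteq> [] \<and> i = j then u \<in> y j ` {g \<in> carrier (G j). map (Pair j) (\<phi> j g a) = x}
     else if j \<in> F then x = [(i, inv\<^bsub>G i\<^esub> (last u)), (j, a), (i, last u)]
     else x = map (Pair j) (\<phi> j \<one>\<^bsub>G j\<^esub> a))"

lemma flow_accepts_state_of:
  assumes r: "normal r" and j: "j \<in> I"
  shows "flow_accepts (j, a) x (state_of r) \<longleftrightarrow> product_flow_letters r (j, a) = x"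
proof (cases r rule: state_of.cases)
  case 1
  then show ?thesis by auto
next
  case (2 i s r')
  have n: "i \<in> I" "s \<in> carrier (G i)" "s \<noteq> \<one>\<^bsub>G i\<^esub>" using r 2 by simp_all
  have ne: "y i s \<noteq> []" using vertex_nf_empty_iff n by simp
  show ?thesis
  proof (cases "i = j")
    case True
    have inj: "g = s" if "g \<in> carrier (G j)" "y j s = y j g" for g
      using vertex_nf_value[OF j that(1)] vertex_nf_value[OF n(1,2)] that(2) True by simp
    have "y j s \<in> y j ` {g \<in> carrier (G j). map (Pair j) (\<phi> j g a) = x} \<longleftrightarrow> map (Pair j) (\<phi> j s a) = x"
    proof
      assume "y j s \<in> y j ` {g \<in> carrier (G j). map (Pair j) (\<phi> j g a) = x}"
      then obtain g where "g \<in> carrier (G j)" "map (Pair j) (\<phi> j g a) = x" "y j s = y j g" by blast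
      then show "map (Pair j) (\<phi> j s a) = x" using inj by simp
    next
      assume "map (Pair j) (\<phi> j s a) = x"
      then show "y j s \<in> y j ` {g \<in> carrier (G j). map (Pair j) (\<phi> j g a) = x}"
        using n(2) True by simp
    qed
    then show ?thesis using True ne unfolding 2 by simp
  next
    case False
    then show ?thesis unfolding 2 by auto
  qed
qed

lemma product_flow_letters_in_lists:
  assumes r: "normal r" and j: "j \<in> I" and a: "a \<in> A j"
  shows "product_flow_letters r (j, a) \<in> lists letters"
  using r j
proof (cases rule: extend_cases)
  case (coset r\<^sub>0 h)
  have "map (Pair j) w \<in> lists letters" if "w \<in> lists (A j)" for w
    using that j by (induction w) simp_all
  then show ?thesis
    using coset vertex_flow(1)[OF j coset(3) a] product_flow_letters_extend[OF j coset(1,2)] by simp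
next
  case (shuffle i s r')
  have n: "i \<in> I" "s \<in> carrier (G i)" "s \<noteq> \<one>\<^bsub>G i\<^esub>" using r shuffle by simp_all
  obtain t c where "c \<in> A i" "y i s = y i t @ [c]" using vertex_nf_last[OF n] .
  then show ?thesis using shuffle n(1) j a gen_inv by simp
qed

lemma product_slice:
  assumes j: "j \<in> I" and a: "a \<in> A j" and x: "x \<in> lists letters"
  shows "stacking_slice H product_nf product_flow (\<iota> j a) (map embed x) =
    map embed ` {w \<in> lists letters. \<exists>\<sigma>. read_word w = Some \<sigma> \<and> flow_accepts (j, a) x \<sigma>}"
    (is "?L = map embed ` ?R")
proof -
  have flow: "product_flow g (\<iota> j a) = map embed x \<longleftrightarrow> product_flow_letters (nform g) (j, a) = x"
    if "g \<in> carrier H" for g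
  proof -
    have "set (product_flow_letters (nform g) (j, a)) \<union> set x \<subseteq> letters"
      using product_flow_letters_in_lists[OF normal_nform[OF that] j a] x
      by (auto simp: in_lists_conv_set)
    from inj_on_map_eq_map[OF inj_on_subset[OF inj_on_embed this]] show ?thesis
      unfolding product_flow_def inv_into_embed[OF j a] .
  qed
  show ?thesis
  proof (intro subset_antisym subsetI)
    fix v assume "v \<in> ?L"
    then obtain g where g: "g \<in> carrier H" "v = product_nf g" "product_flow_letters (nform g) (j, a) = x"
      unfolding stacking_slice_def using flow by auto
    note n = normal_nform[OF g(1)]
    have "spell (nform g) \<in> ?R"
      using read_word_eq_Some[OF spell_in_lists[OF n]] spell_in_lists[OF n] n g(3)
        flow_accepts_state_of[OF n j, of a x] by blast
    then show "v \<in> map embed ` ?R" unfolding g(2) product_nf_def by (rule imageI)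
  next
    fix v assume "v \<in> map embed ` ?R"
    then obtain w \<sigma> where w: "v = map embed w" "w \<in> lists letters" "read_word w = Some \<sigma>"
        "flow_accepts (j, a) x \<sigma>" by blast
    then obtain r where r: "normal r" "w = spell r" "\<sigma> = state_of r" using read_word_eq_Some by blast
    then have "product_flow_letters r (j, a) = x" using flow_accepts_state_of j w(4) by blast
    then have "product_flow (syllables_value r) (\<iota> j a) = map embed x"
      using flow[OF syllables_value_closed[OF r(1)]] nform_syllables_value[OF r(1)] by simp
    moreover have "v = product_nf (syllables_value r)" using product_nf_syllables[OF r(1)] w(1) r(2) by simp
    ultimately show "v \<in> ?L"
      unfolding stacking_slice_def using syllables_value_closed[OF r(1)] by blast
  qed
qed

lemma flow_accepts_slice:
  "y j ` {g \<in> carrier (G j). map (Pair j) (\<phi> j g a) = x} =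
    (if x = map (Pair j) (map snd x) then stacking_slice (G j) (y j) (\<phi> j) a (map snd x) else {})"
proof -
  have "map (Pair j) v = x \<longleftrightarrow> x = map (Pair j) (map snd x) \<and> v = map snd x" for v :: "'a list"
    by (auto simp: comp_def)
  then show ?thesis unfolding stacking_slice_def by (auto split: if_splits)
qed

lemma map_snd_in_lists:
  "j \<in> I \<Longrightarrow> x \<in> lists letters \<Longrightarrow> x = map (Pair j) (map snd x) \<Longrightarrow> map snd x \<in> lists (A j)"
proof (induction x)
  case (Cons l x)
  then show ?case by (cases l) simp
qed simp

lemma product_gens_words: "v \<in> lists product_gens \<Longrightarrow> \<exists>x\<in>lists letters. v = map embed x"
proof (induction v)
  case (Cons b v)
  then obtain x where x: "x \<in> lists letters" "v = map embed x" by auto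
  have "b \<in> embed ` letters" using Cons.prems by (simp add: product_gens_def)
  then obtain l where "l \<in> letters" "b = embed l" by blast
  then show ?case using x by (intro bexI[of _ "l # x"]) simp_all
qed simp

end
end

section \<open>Regularity of the product stacking\<close>

lemma finite_state_last:
  assumes "finite \<Sigma>"
  shows "finite_state \<Sigma> (\<lambda>u. if u = [] then None else Some (last u))"
proof (rule finite_stateI)
  have "(\<lambda>u. if u = [] then None else Some (last u)) ` lists \<Sigma> \<subseteq> insert None (Some ` \<Sigma>)"
    by (auto simp: in_lists_conv_set)
  moreover have "finite (insert None (Some ` \<Sigma>))" using assms by simp
  ultimately show "finite ((\<lambda>u. if u = [] then None else Some (last u)) ` lists \<Sigma>)" by (rule finite_subset)
qed simp

context graph_product_stackings begin

context
  notes in_listsD [rule del] and in_listsI [rule del]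
begin

text \<open>An invariant of the states that are reached; 0 stands for the vertex of the initial state.\<close>

definition valid_state :: "(nat set \<times> nat \<times> 'a list) option \<Rightarrow> bool" where
  "valid_state s \<longleftrightarrow> (\<forall>F i u. s = Some (F, i, u) \<longrightarrow>
    F \<subseteq> I \<and> i \<in> insert 0 I \<and> (u = [] \<and> F = {} \<or> u \<noteq> [] \<and> i \<in> I \<and> u \<in> lists (A i)))"

lemma valid_init: "valid_state (Some ({}, 0, []))"
  by (simp add: valid_state_def)

lemma valid_read_letter:
  assumes "valid_state s" "l \<in> letters"
  shows "valid_state (read_letter s l)"
proof (cases s)
  case None
  then show ?thesis by (simp add: valid_state_def)
next
  case (Some t)
  obtain F i u where t: "t = (F, i, u)" by (cases t)
  obtain j a where l: "l = (j, a)" by (cases l)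
  have ja: "j \<in> I" "a \<in> A j" using assms(2) l by simp_all
  have s: "F \<subseteq> I" "u = [] \<or> i \<in> I \<and> u \<in> lists (A i)" using assms(1) Some t by (auto simp: valid_state_def)
  have "forbid F j \<subseteq> I" using s(1) ja(1) adj_in by (auto simp: forbid_def)
  then show ?thesis using s ja unfolding Some t l by (auto simp: valid_state_def)
qed

lemma valid_read_word: "w \<in> lists letters \<Longrightarrow> valid_state (read_word w)"
  unfolding read_word_def
  by (induction w rule: rev_induct) (simp_all add: valid_init valid_read_letter)

text \<open>The states become finitely many if the part of the last syllable is replaced by its class under
  a right congruence that recognizes the normal forms of its vertex, recognizes the slice of the
  vertex \<open>j\<close> of the label, and determines the last letter.\<close>

lemma regular_product_slice:
  assumes nfs: "\<And>i. i \<in> I \<Longrightarrow> regular_language (A i) (vertex_nfs i)"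
    and slice: "regular_language (A j) (y j ` {g \<in> carrier (G j). map (Pair j) (\<phi> j g a) = x})"
    and j: "j \<in> I" and a: "a \<in> A j"
  shows "regular_language letters {w \<in> lists letters. \<exists>\<sigma>. read_word w = Some \<sigma> \<and> flow_accepts (j, a) x \<sigma>}"
    (is "regular_language letters ?L")
proof -
  let ?S = "y j ` {g \<in> carrier (G j). map (Pair j) (\<phi> j g a) = x}"
  let ?last = "\<lambda>u. if u = [] then None else Some (last u)"
  have "\<exists>f :: 'a list \<Rightarrow> (nat \<times> nat) \<times> 'a option. finite_state (A i) f \<and> saturates (A i) f (vertex_nfs i) \<and>
      (i = j \<longrightarrow> saturates (A i) f ?S) \<and> (\<forall>u v. f u = f v \<longrightarrow> ?last u = ?last v)" if i: "i \<in> I" for i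
  proof -
    obtain f :: "'a list \<Rightarrow> nat" where f: "finite_state (A i) f" "saturates (A i) f (vertex_nfs i)"
      using nfs[OF i] by (rule regular_languageE)
    have "\<exists>g :: 'a list \<Rightarrow> nat. finite_state (A i) g \<and> (i = j \<longrightarrow> saturates (A i) g ?S)"
    proof (cases "i = j")
      case True
      obtain g :: "'a list \<Rightarrow> nat" where "finite_state (A j) g" "saturates (A j) g ?S"
        using slice by (rule regular_languageE)
      then show ?thesis using True by blast
    next
      case False
      then show ?thesis using f(1) by blast
    qed
    then obtain g :: "'a list \<Rightarrow> nat" where g: "finite_state (A i) g" "i = j \<longrightarrow> saturates (A i) g ?S" by blast
    let ?f = "\<lambda>u. ((f u, g u), ?last u)"
    have "finite_state (A i) ?f"
      by (intro finite_state_Pair f g finite_state_last generated_group.finite_gens[OF gens[OF i]])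
    moreover have "saturates (A i) ?f (vertex_nfs i)"
    proof (rule saturatesI)
      fix u v assume "u \<in> lists (A i)" "v \<in> lists (A i)" "?f u = ?f v" "u \<in> vertex_nfs i"
      then show "v \<in> vertex_nfs i" using saturatesD[OF f(2), of u v] by simp
    qed
    moreover have "i = j \<longrightarrow> saturates (A i) ?f ?S"
    proof
      assume ij: "i = j"
      have gs: "saturates (A i) g ?S" using g(2) ij by (rule mp)
      show "saturates (A i) ?f ?S"
      proof (rule saturatesI)
        fix u v assume uv: "u \<in> lists (A i)" "v \<in> lists (A i)" "?f u = ?f v" "u \<in> ?S"
        have "g u = g v" using uv(3) by simp
        from saturatesD[OF gs uv(1,2) this uv(4)] show "v \<in> ?S" .
      qed
    qed
    moreover have "\<forall>u v. ?f u = ?f v \<longrightarrow> ?last u = ?last v" by simp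
    ultimately show ?thesis by (intro exI[of _ ?f] conjI)
  qed
  then have "\<exists>f :: nat \<Rightarrow> 'a list \<Rightarrow> (nat \<times> nat) \<times> 'a option. \<forall>i\<in>I. finite_state (A i) (f i) \<and>
      saturates (A i) (f i) (vertex_nfs i) \<and> (i = j \<longrightarrow> saturates (A i) (f i) ?S) \<and>
      (\<forall>u v. f i u = f i v \<longrightarrow> ?last u = ?last v)"
    by (intro bchoice ballI)
  then obtain f :: "nat \<Rightarrow> 'a list \<Rightarrow> (nat \<times> nat) \<times> 'a option"
    where f: "\<And>i. i \<in> I \<Longrightarrow> finite_state (A i) (f i)"
      "\<And>i. i \<in> I \<Longrightarrow> saturates (A i) (f i) (vertex_nfs i)"
      "saturates (A j) (f j) ?S"
      "\<And>i u v. i \<in> I \<Longrightarrow> f i u = f i v \<Longrightarrow> ?last u = ?last v"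
    using j by blast
  define c where "c = map_option (\<lambda>(F :: nat set, i, u). (F, i, if u = [] then None else Some (f i u)))"
  have last_eq: "last u = last v" if "i \<in> I" "f i u = f i v" "u \<noteq> []" "v \<noteq> []" for i u v
    using f(4)[OF that(1,2)] that(3,4) by simp
  have collapse: "\<exists>v. t = Some (F, i, v) \<and> (u = [] \<longleftrightarrow> v = []) \<and> (u \<noteq> [] \<longrightarrow> f i u = f i v)"
    if eq: "c (Some (F, i, u)) = c t" for F i u t
  proof (cases t)
    case None
    then show ?thesis using eq by (simp add: c_def)
  next
    case (Some p)
    obtain F' i' v where "p = (F', i', v)" by (cases p)
    then show ?thesis using eq Some by (auto simp: c_def split: if_splits)
  qed
  have fs: "finite_state letters (\<lambda>w. c (foldl read_letter (Some ({}, 0, [])) w))"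
  proof (rule finite_state_foldl[where P = valid_state and c = c and step = read_letter])
    show "valid_state (Some ({}, 0, []))" by (rule valid_init)
    show "valid_state (read_letter s l)" if "valid_state s" "l \<in> letters" for s l
      using that by (rule valid_read_letter)
    let ?X = "insert None (Some ` (\<Union>i\<in>I. f i ` lists (A i)))"
    have "c ` {s. valid_state s} \<subseteq> insert None (Some ` (Pow I \<times> insert 0 I \<times> ?X))"
    proof (rule image_subsetI)
      fix s assume s: "s \<in> {s. valid_state s}"
      show "c s \<in> insert None (Some ` (Pow I \<times> insert 0 I \<times> ?X))"
      proof (cases s)
        case None
        then show ?thesis by (simp add: c_def)
      next
        case (Some t)
        obtain F i u where t: "t = (F, i, u)" by (cases t)
        have "F \<in> Pow I" "i \<in> insert 0 I" "u = [] \<or> i \<in> I \<and> u \<in> lists (A i)"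
          using s Some t by (auto simp: valid_state_def)
        moreover from this(3) have "(if u = [] then None else Some (f i u)) \<in> ?X" by auto
        ultimately have "(F, i, if u = [] then None else Some (f i u)) \<in> Pow I \<times> insert 0 I \<times> ?X"
          by (intro SigmaI)
        moreover have "c s = Some (F, i, if u = [] then None else Some (f i u))"
          unfolding Some t c_def by simp
        ultimately show ?thesis by (simp only: insertI2 imageI)
      qed
    qed
    moreover have "finite (insert None (Some ` (Pow I \<times> insert 0 I \<times> ?X)))"
      using finite_vertices finite_state_finite[OF f(1)] by simp
    ultimately show "finite (c ` {s. valid_state s})" by (rule finite_subset)
    show "c (read_letter s l) = c (read_letter t l)"
      if v: "valid_state s" "valid_state t" and l: "l \<in> letters" and eq: "c s = c t" for s t l
    proof (cases s)
      case None
      then have "t = None" using eq by (simp add: c_def)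
      then show ?thesis using None by simp
    next
      case (Some p)
      obtain F i u where p: "p = (F, i, u)" by (cases p)
      obtain k b where l': "l = (k, b)" by (cases l)
      have kb: "k \<in> I" "b \<in> A k" using l l' by simp_all
      obtain u' where u': "t = Some (F, i, u')" "u = [] \<longleftrightarrow> u' = []" "u \<noteq> [] \<longrightarrow> f i u = f i u'"
        using collapse[of F i u t] eq Some p by blast
      show ?thesis
      proof (cases "u \<noteq> [] \<and> k = i")
        case True
        then have i: "i \<in> I" "b \<in> A i" and uu: "u \<in> lists (A i)" "u' \<in> lists (A i)" "u' \<noteq> []"
          using kb v u' Some p by (auto simp: valid_state_def)
        have e: "f i (u @ [b]) = f i (u' @ [b])"
          using finite_stateD[OF f(1)[OF i(1)] uu(1,2) i(2)] u'(3) True by blast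
        have "u @ [b] \<in> lists (A i)" "u' @ [b] \<in> lists (A i)" using uu i(2) by simp_all
        then have "u @ [b] \<in> vertex_nfs i \<longleftrightarrow> u' @ [b] \<in> vertex_nfs i"
          using saturatesD[OF f(2)[OF i(1)]] e by metis
        then show ?thesis using True uu(3) e unfolding Some p u'(1) l' by (simp add: c_def)
      next
        case False
        then have "read_letter s l = read_letter t l"
          using u'(2) unfolding Some p u'(1) l' by auto
        then show ?thesis by simp
      qed
    qed
  qed
  show ?thesis
  proof (rule regular_languageI[OF fs])
    show "?L \<subseteq> lists letters" by blast
    show "saturates letters (\<lambda>w. c (foldl read_letter (Some ({}, 0, [])) w)) ?L"
    proof (rule saturatesI)
      fix v w assume vw: "v \<in> lists letters" "w \<in> lists letters" and v: "v \<in> ?L"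
        and "c (foldl read_letter (Some ({}, 0, [])) v) = c (foldl read_letter (Some ({}, 0, [])) w)"
      then have eq: "c (read_word v) = c (read_word w)" by (simp add: read_word_def)
      obtain F i u where s: "read_word v = Some (F, i, u)" and acc: "flow_accepts (j, a) x (F, i, u)"
        using v by (auto simp del: flow_accepts.simps)
      obtain u' where t: "read_word w = Some (F, i, u')" "u = [] \<longleftrightarrow> u' = []" "u \<noteq> [] \<longrightarrow> f i u = f i u'"
        using collapse[of F i u "read_word w"] eq s by auto
      have "flow_accepts (j, a) x (F, i, u')"
      proof (cases "u = []")
        case True
        then have "u' = []" using t(2) by simp
        then show ?thesis using acc True by simp
      next
        case False
        then have ne: "u' \<noteq> []" and e: "f i u = f i u'" using t by simp_all
        have i: "i \<in> I" "u \<in> lists (A i)" "u' \<in> lists (A i)"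
          using valid_read_word[OF vw(1)] valid_read_word[OF vw(2)] False ne unfolding s t(1) by (simp_all add: valid_state_def)
        show ?thesis
        proof (cases "i = j")
          case True
          have "u \<in> ?S" using acc False True by simp
          then have "u' \<in> ?S" using saturatesD[OF f(3)] i e unfolding True by blast
          then show ?thesis using ne True by simp
        next
          case ij: False
          have "last u = last u'" using last_eq[OF i(1) e False ne] .
          then show ?thesis using acc ij by simp
        qed
      qed
      then show "w \<in> ?L" using vw(2) t(1) by blast
    qed
  qed
qed

theorem synchronously_regular_product:
  assumes reg: "\<And>i. i \<in> I \<Longrightarrow> synchronously_regular 3 (A i) (stacking_language (G i) (A i) (y i) (\<phi> i))"
  shows "synchronously_regular 3 product_gens (stacking_language H product_gens product_nf product_flow)"
proof (rule generated_group.synchronously_regular_if_slices[OF generated_group_product stacking_product])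
  fix b v assume b: "b \<in> product_gens" and v: "v \<in> lists product_gens"
  obtain j a where j: "j \<in> I" and a: "a \<in> A j" and b: "b = \<iota> j a" using product_gensE[OF b] .
  obtain x where x: "x \<in> lists letters" "v = map embed x" using product_gens_words[OF v] by blast
  note slices = generated_group.regular_slices[OF gens stackings reg]
  have "regular_language (A j) (y j ` {g \<in> carrier (G j). map (Pair j) (\<phi> j g a) = x})"
  proof (cases "x = map (Pair j) (map snd x)")
    case True
    have "regular_language (A j) (stacking_slice (G j) (y j) (\<phi> j) a (map snd x))"
      by (rule slices(1)[OF j j j a map_snd_in_lists[OF j x(1) True]])
    then show ?thesis unfolding flow_accepts_slice by (subst if_P[OF True])
  next
    case False
    then show ?thesis unfolding flow_accepts_slice using regular_language_UN[of "{}"] by simp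
  qed
  then have "regular_language letters {w \<in> lists letters. \<exists>\<sigma>. read_word w = Some \<sigma> \<and> flow_accepts (j, a) x \<sigma>}"
    using slices(2) by (intro regular_product_slice j a) (simp_all add: vertex_nfs_def)
  from regular_language_map[OF inj_on_embed this]
  show "regular_language product_gens (stacking_slice H product_nf product_flow b v)"
    unfolding b x(2) product_slice[OF j a x(1)] product_gens_def .
qed

section \<open>Decidability of the product stacking\<close>

lemma computable_case_vertex:
  assumes "finite S" "\<And>i. i \<in> S \<Longrightarrow> computable (f i)"
  shows "\<exists>g. computable g \<and> (\<forall>i\<in>S. \<forall>x. g (prod_encode (i, x)) = f i x)"
  using assms
proof (induction S)
  case empty
  then show ?case using computable_id by auto
next
  case (insert k S)
  then obtain g where g: "computable g" "\<forall>i\<in>S. \<forall>x. g (prod_encode (i, x)) = f i x" by auto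
  have fk: "computable (f k)" using insert.prems by simp
  have "computable (\<lambda>z. if fst (prod_decode z) = k then f k (snd (prod_decode z)) else g z)"
    by (intro computable_if_eq computable_fst computable_const computable_comp[OF fk] computable_snd
        computable_id g(1))
  then show ?case using g(2) insert.hyps
    by (intro exI[of _ "\<lambda>z. if fst (prod_decode z) = k then f k (snd (prod_decode z)) else g z"]) auto
qed

lemma computable_on_finite_image:
  assumes "finite S" "inj_on e S"
  shows "\<exists>g. computable g \<and> (\<forall>s\<in>S. g (e s) = f s)"
proof -
  obtain g where g: "computable g" "\<forall>n\<in>e ` S. g n = f (inv_into S e n)"
    using computable_on_finite[of "e ` S" "\<lambda>n. f (inv_into S e n)"] assms(1) by blast
  then show ?thesis using inv_into_f_f[OF assms(2)] by (intro exI[of _ g]) simp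
qed

context
  fixes c :: "nat \<Rightarrow> 'a \<Rightarrow> nat"
  assumes c: "\<And>i. i \<in> I \<Longrightarrow> inj_on (c i) (A i)"
begin

definition letter_code :: "nat \<times> 'a \<Rightarrow> nat" where
  "letter_code = (\<lambda>(i, a). prod_encode (i, c i a))"

definition product_letter_code :: "'h \<Rightarrow> nat" where
  "product_letter_code b = letter_code (inv_into letters embed b)"

text \<open>Reversed words make it possible to append a letter by a single pairing.\<close>

definition rev_code :: "nat \<Rightarrow> 'a list \<Rightarrow> nat" where
  "rev_code i u = list_encode (rev (map (c i) u))"

fun state_code :: "(nat set \<times> nat \<times> 'a list) option \<Rightarrow> nat" where
  "state_code None = 0"
| "state_code (Some (F, i, u)) = Suc (prod_encode (set_encode F, prod_encode (i, rev_code i u)))"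

lemma letter_code_simp [simp]: "letter_code (i, a) = prod_encode (i, c i a)"
  by (simp add: letter_code_def)

lemma rev_code_simps [simp]:
  "rev_code i [] = 0"
  "rev_code i (u @ [a]) = Suc (prod_encode (c i a, rev_code i u))"
  by (simp_all add: rev_code_def)

lemma rev_code_single: "rev_code i [a] = Suc (prod_encode (c i a, 0))"
  using rev_code_simps(2)[of i "[]" a] by simp

lemma rev_code_eq_0_iff: "rev_code i u = 0 \<longleftrightarrow> u = []"
  by (cases u rule: rev_cases) simp_all

lemma inj_on_letter_code: "inj_on letter_code letters"
proof (rule inj_onI)
  fix l m assume lm: "l \<in> letters" "m \<in> letters" "letter_code l = letter_code m"
  obtain i a j b where ij: "l = (i, a)" "m = (j, b)" by (metis surj_pair)
  have "i = j" "c i a = c j b" using lm(3) ij by (auto simp: prod_encode_eq)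
  then have "a = b" using inj_onD[OF c[of i], of a b] lm(1,2) ij by simp
  with \<open>i = j\<close> show "l = m" using ij by simp
qed

lemma inj_on_product_letter_code: "inj_on product_letter_code product_gens"
proof (rule inj_onI)
  fix b d assume bd: "b \<in> product_gens" "d \<in> product_gens" "product_letter_code b = product_letter_code d"
  obtain l m where lm: "l \<in> letters" "b = embed l" "m \<in> letters" "d = embed m"
    using bd(1,2) unfolding product_gens_def by blast
  have "letter_code l = letter_code m"
    using bd(3) lm(1,3) unfolding product_letter_code_def lm(2,4) by (simp add: inv_into_f_f[OF inj_on_embed])
  then show "b = d" using inj_onD[OF inj_on_letter_code] lm by blast
qed

lemma word_code_embed:
  "w \<in> lists letters \<Longrightarrow> word_code product_letter_code (map embed w) = list_encode (map letter_code w)"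
proof -
  assume "w \<in> lists letters"
  then have "map product_letter_code (map embed w) = map letter_code w"
    by (induction w) (simp_all add: product_letter_code_def inv_into_f_f[OF inj_on_embed])
  then show ?thesis unfolding word_code_def by (rule arg_cong)
qed

lemma computable_rev_code:
  assumes "i \<in> I" "decidable_language (c i) (A i) L"
  shows "\<exists>p. computable p \<and> (\<forall>u\<in>lists (A i). p (rev_code i u) = (if u \<in> L then 1 else 0))"
proof -
  obtain p where p: "computable p" "\<forall>u\<in>lists (A i). p (word_code (c i) u) = (if u \<in> L then 1 else 0)"
    using assms(2) unfolding decidable_language_def by blast
  obtain R where R: "computable R" "\<forall>xs. R (list_encode xs) = list_encode (rev xs)"
    using computable_rev by blast
  have "computable (\<lambda>z. p (R z))" using p(1) R(1) by (rule computable_comp)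
  moreover have "p (R (rev_code i u)) = (if u \<in> L then 1 else 0)" if "u \<in> lists (A i)" for u
    using p(2) that R(2) by (simp add: rev_code_def word_code_def)
  ultimately show ?thesis by blast
qed

context
  assumes nfs: "\<And>i. i \<in> I \<Longrightarrow> decidable_language (c i) (A i) (vertex_nfs i)"
begin

lemma computable_vertex_nfs:
  "\<exists>N. computable N \<and> (\<forall>i\<in>I. \<forall>u\<in>lists (A i).
    N (prod_encode (i, rev_code i u)) = (if u \<in> vertex_nfs i then 1 else 0))"
proof -
  have "\<forall>i\<in>I. \<exists>p. computable p \<and> (\<forall>u\<in>lists (A i). p (rev_code i u) = (if u \<in> vertex_nfs i then 1 else 0))"
    using computable_rev_code nfs by blast
  then obtain p where p: "\<forall>i\<in>I. computable (p i) \<and>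
      (\<forall>u\<in>lists (A i). p i (rev_code i u) = (if u \<in> vertex_nfs i then 1 else 0))"
    by (rule bchoice[THEN exE])
  obtain N where "computable N" "\<forall>i\<in>I. \<forall>x. N (prod_encode (i, x)) = p i x"
    using computable_case_vertex[OF finite_vertices, of p] p by blast
  then show ?thesis using p by (intro exI[of _ N]) simp
qed

lemma computable_on_vertex_sets:
  fixes f :: "nat set \<Rightarrow> nat \<Rightarrow> nat"
  shows "\<exists>g. computable g \<and> (\<forall>F i. F \<subseteq> I \<longrightarrow> i \<in> I \<longrightarrow> g (prod_encode (set_encode F, i)) = f F i)"
proof -
  let ?e = "\<lambda>(F, i). prod_encode (set_encode F, i)"
  have "inj_on ?e (Pow I \<times> I)"
  proof (rule inj_onI)
    fix p q assume pq: "p \<in> Pow I \<times> I" "q \<in> Pow I \<times> I" "?e p = ?e q"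
    have "finite (fst p)" "finite (fst q)" using pq(1,2) finite_vertices finite_subset by auto
    then show "p = q" using pq(3) set_encode_eq by (cases p; cases q) (simp add: prod_encode_eq)
  qed
  then obtain g where "computable g" "\<forall>p\<in>Pow I \<times> I. g (?e p) = (case p of (F, i) \<Rightarrow> f F i)"
    using computable_on_finite_image[of "Pow I \<times> I" ?e "\<lambda>(F, i). f F i"] finite_vertices by auto
  then show ?thesis by (intro exI[of _ g]) auto
qed

text \<open>Apart from coding, a step consists of finite tables, which handle the sets of forbidden vertices,
  and of the test for normal forms of the vertex groups, which is computable by assumption.\<close>

lemma computable_read_letter:
  "\<exists>step. computable step \<and> (\<forall>s l. valid_state s \<longrightarrow> l \<in> letters \<longrightarrow>
    step (prod_encode (state_code s, letter_code l)) = state_code (read_letter s l))"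
proof -
  obtain N where N: "computable N" "\<forall>i\<in>I. \<forall>u\<in>lists (A i).
      N (prod_encode (i, rev_code i u)) = (if u \<in> vertex_nfs i then 1 else 0)"
    using computable_vertex_nfs by blast
  obtain M where M: "computable M" "\<forall>F i. F \<subseteq> I \<longrightarrow> i \<in> I \<longrightarrow>
      M (prod_encode (set_encode F, i)) = (if i \<in> F then 0 else 1)"
    using computable_on_vertex_sets[of "\<lambda>F i. if i \<in> F then 0 else 1"] by blast
  obtain U where U: "computable U" "\<forall>F i. F \<subseteq> I \<longrightarrow> i \<in> I \<longrightarrow>
      U (prod_encode (set_encode F, i)) = set_encode (forbid F i)"
    using computable_on_vertex_sets[of "\<lambda>F i. set_encode (forbid F i)"] by blast
  define st where "st z = fst (prod_decode z)" for z
  define F where "F z = fst (prod_decode (st z - 1))" for z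
  define i where "i z = fst (prod_decode (snd (prod_decode (st z - 1))))" for z
  define u where "u z = snd (prod_decode (snd (prod_decode (st z - 1))))" for z
  define j where "j z = fst (prod_decode (snd (prod_decode z)))" for z
  define a where "a z = snd (prod_decode (snd (prod_decode z)))" for z
  have comps: "computable st" "computable F" "computable i" "computable u" "computable j" "computable a"
    unfolding st_def F_def i_def u_def j_def a_def
    by (intro computable_fst computable_snd computable_diff computable_const computable_id)+
  define push where "push z = Suc (prod_encode (a z, u z))" for z
  define single where "single z = Suc (prod_encode (a z, 0))" for z
  define new where "new z = (if M (prod_encode (F z, j z)) = 0 then 0
    else if N (prod_encode (j z, single z)) = 0 then 0
    else Suc (prod_encode (U (prod_encode (F z, j z)), prod_encode (j z, single z))))" for z
  define continue where "continue z = (if N (prod_encode (i z, push z)) = 0 then 0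
    else Suc (prod_encode (F z, prod_encode (i z, push z))))" for z
  define step where "step z = (if st z = 0 then 0 else if u z = 0 then new z
    else if j z = i z then continue z else new z)" for z
  have "computable push" "computable single"
    unfolding push_def single_def by (intro computable_Suc computable_pair comps computable_const)+
  note comps = comps this
  have "computable (\<lambda>z. M (prod_encode (F z, j z)))" "computable (\<lambda>z. N (prod_encode (j z, single z)))"
    "computable (\<lambda>z. U (prod_encode (F z, j z)))" "computable (\<lambda>z. N (prod_encode (i z, push z)))"
    by (rule computable_comp[OF M(1)] computable_comp[OF N(1)] computable_comp[OF U(1)],
        intro computable_pair comps)+
  note comps = comps this
  have "computable new" "computable continue"
    unfolding new_def continue_def
    by (intro computable_if_0 computable_Suc computable_pair comps computable_const)+
  then have "computable step"
    unfolding step_def by (intro computable_if_0 computable_if_eq comps computable_const)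
  moreover have "step (prod_encode (state_code s, letter_code l)) = state_code (read_letter s l)"
    if s: "valid_state s" and l: "l \<in> letters" for s l
  proof (cases s)
    case None
    then show ?thesis by (simp add: step_def st_def)
  next
    case (Some p)
    obtain F' i' u' where p: "p = (F', i', u')" by (cases p)
    obtain k b where l': "l = (k, b)" by (cases l)
    have kb: "k \<in> I" "b \<in> A k" using l l' by simp_all
    have v: "F' \<subseteq> I" "u' = [] \<or> i' \<in> I \<and> u' \<in> lists (A i')" using s Some p by (auto simp: valid_state_def)
    let ?z = "prod_encode (state_code s, letter_code l)"
    have z: "st ?z = Suc (prod_encode (set_encode F', prod_encode (i', rev_code i' u')))"
      by (simp add: st_def Some p)
    have zs: "F ?z = set_encode F'" "i ?z = i'" "u ?z = rev_code i' u'" "j ?z = k" "a ?z = c k b"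
      by (simp_all add: F_def i_def u_def z) (simp_all add: j_def a_def l')
    have single: "single ?z = rev_code k [b]" by (simp add: single_def zs rev_code_single)
    have "[b] \<in> lists (A k)" using kb by simp
    then have new: "new ?z = state_code (if k \<notin> F' \<and> [b] \<in> vertex_nfs k then Some (forbid F' k, k, [b]) else None)"
      using M(2) N(2) U(2) kb v(1) unfolding new_def single zs by simp
    show ?thesis
    proof (cases "u' \<noteq> [] \<and> k = i'")
      case True
      then have u': "u' @ [b] \<in> lists (A i')" "i' \<in> I" using v kb by auto
      have push: "push ?z = rev_code i' (u' @ [b])" using True by (simp add: push_def zs)
      have "continue ?z = state_code (if u' @ [b] \<in> vertex_nfs i' then Some (F', i', u' @ [b]) else None)"
        using bspec[OF bspec[OF N(2) u'(2)] u'(1)] unfolding continue_def push zs by simp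
      then show ?thesis
        using True rev_code_eq_0_iff[of i' u'] unfolding step_def z zs unfolding Some p l' by simp
    next
      case False
      then have "step ?z = new ?z"
        using rev_code_eq_0_iff[of i' u'] unfolding step_def z zs by auto
      then show ?thesis using False unfolding new unfolding Some p l' by auto
    qed
  qed
  ultimately show ?thesis by blast
qed

lemma computable_read_word:
  "\<exists>f. computable f \<and> (\<forall>w\<in>lists letters. f (list_encode (map letter_code w)) = state_code (read_word w))"
proof -
  obtain step where step: "computable step" "\<forall>s l. valid_state s \<longrightarrow> l \<in> letters \<longrightarrow>
      step (prod_encode (state_code s, letter_code l)) = state_code (read_letter s l)"
    using computable_read_letter by blast
  obtain f where f: "computable f" "\<forall>s xs. f (prod_encode (s, list_encode xs)) =
      foldl (\<lambda>s x. step (prod_encode (s, x))) s xs"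
    using computable_foldl[OF step(1)] by blast
  let ?init = "Some ({}, 0, []) :: (nat set \<times> nat \<times> 'a list) option"
  have fold: "foldl (\<lambda>s x. step (prod_encode (s, x))) (state_code s) (map letter_code w) =
      state_code (foldl read_letter s w)" if "w \<in> lists letters" "valid_state s" for w s
    using that
  proof (induction w arbitrary: s rule: list.induct)
    case (Cons l w)
    then have "l \<in> letters" "w \<in> lists letters" by simp_all
    moreover from this have "step (prod_encode (state_code s, letter_code l)) = state_code (read_letter s l)"
      using step(2) Cons.prems(2) by blast
    ultimately show ?case
      using Cons.IH[of "read_letter s l"] valid_read_letter[OF Cons.prems(2)] by simp
  qed simp
  have "computable (\<lambda>n. f (prod_encode (state_code ?init, n)))"
    by (intro computable_comp[OF f(1)] computable_pair computable_const computable_id)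
  moreover have "f (prod_encode (state_code ?init, list_encode (map letter_code w))) = state_code (read_word w)"
    if "w \<in> lists letters" for w
    unfolding read_word_def using f(2) fold[OF that valid_init] by simp
  ultimately show ?thesis by blast
qed

lemma computable_flow_accepts:
  assumes slice: "decidable_language (c j) (A j) (y j ` {g \<in> carrier (G j). map (Pair j) (\<phi> j g a) = x})"
    and j: "j \<in> I"
  shows "\<exists>q. computable q \<and> (\<forall>\<sigma>. valid_state (Some \<sigma>) \<longrightarrow>
    q (state_code (Some \<sigma>)) = (if flow_accepts (j, a) x \<sigma> then 1 else 0))"
proof -
  let ?S = "y j ` {g \<in> carrier (G j). map (Pair j) (\<phi> j g a) = x}"
  obtain p where p: "computable p" "\<forall>u\<in>lists (A j). p (rev_code j u) = (if u \<in> ?S then 1 else 0)"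
    using computable_rev_code[OF j slice] by blast
  obtain M where M: "computable M" "\<forall>F i. F \<subseteq> I \<longrightarrow> i \<in> I \<longrightarrow>
      M (prod_encode (set_encode F, i)) = (if i \<in> F then 1 else 0)"
    using computable_on_vertex_sets[of "\<lambda>F i. if i \<in> F then 1 else 0"] by blast
  let ?shuffle = "\<lambda>(i, b). if x = [(i, inv\<^bsub>G i\<^esub> b), (j, a), (i, b)] then 1 else (0 :: nat)"
  have "finite letters"
    unfolding letters_def using finite_vertices generated_group.finite_gens[OF gens] by simp
  then obtain T where T: "computable T" "\<forall>l\<in>letters. T (letter_code l) = ?shuffle l"
    using computable_on_finite_image[OF _ inj_on_letter_code, of ?shuffle] by blast
  let ?base = "if x = map (Pair j) (\<phi> j \<one>\<^bsub>G j\<^esub> a) then 1 else (0 :: nat)"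
  define F where "F z = fst (prod_decode (z - 1))" for z
  define i where "i z = fst (prod_decode (snd (prod_decode (z - 1))))" for z
  define u where "u z = snd (prod_decode (snd (prod_decode (z - 1))))" for z
  have "computable F" "computable i" "computable u"
    unfolding F_def i_def u_def
    by (intro computable_fst computable_snd computable_diff computable_const computable_id)+
  note comps = this
  define h where "h z = fst (prod_decode (u z - 1))" for z
  have "computable h" unfolding h_def by (intro computable_fst computable_diff comps computable_const)
  note comps = comps this
  have "computable (\<lambda>z. M (prod_encode (F z, j)))" "computable (\<lambda>z. T (prod_encode (i z, h z)))" "computable (\<lambda>z. p (u z))"
    by (rule computable_comp[OF M(1)] computable_comp[OF T(1)] computable_comp[OF p(1)],
        intro computable_pair comps computable_const)+
  note comps = comps this
  define other where "other z = (if M (prod_encode (F z, j)) = 0 then ?base else T (prod_encode (i z, h z)))" for z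
  have "computable other" unfolding other_def by (intro computable_if_0 comps computable_const)
  define q where "q z = (if u z = 0 then ?base else if i z = j then p (u z) else other z)" for z
  have "computable q"
    unfolding q_def by (intro computable_if_0 computable_if_eq comps computable_const \<open>computable other\<close>)
  moreover have main: "q (state_code (Some (F', i', u'))) = (if flow_accepts (j, a) x (F', i', u') then 1 else 0)"
    if v: "valid_state (Some (F', i', u'))" for F' i' u'
  proof -
    have V: "F' \<subseteq> I" "u' = [] \<or> i' \<in> I \<and> u' \<in> lists (A i')" using v by (auto simp: valid_state_def)
    have init: "u' = [] \<longrightarrow> j \<notin> F'" using v adj_in by (auto simp: valid_state_def)
    let ?z = "state_code (Some (F', i', u'))"
    have zs: "F ?z = set_encode F'" "i ?z = i'" "u ?z = rev_code i' u'"
      by (simp_all add: F_def i_def u_def)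
    show ?thesis
    proof (cases u' rule: rev_cases)
      case Nil
      then show ?thesis using init unfolding q_def zs by simp
    next
      case (snoc u'' b)
      have i': "i' \<in> I" "b \<in> A i'" "u' \<in> lists (A i')" using V(2) snoc by auto
      have h: "h ?z = c i' b" unfolding h_def zs using snoc by simp
      have ne: "rev_code i' u' \<noteq> 0" "u' \<noteq> []" using snoc by simp_all
      show ?thesis
      proof (cases "i' = j")
        case True
        then have "p (rev_code i' u') = (if u' \<in> ?S then 1 else 0)" using p(2) i'(3) by blast
        then show ?thesis using True ne unfolding q_def zs by simp
      next
        case False
        have "(i', b) \<in> letters" using i' by simp
        from bspec[OF T(2) this] have "T (prod_encode (i', c i' b)) = ?shuffle (i', b)"
          by (simp only: letter_code_simp)
        then have "other ?z = (if j \<in> F' then ?shuffle (i', b) else ?base)"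
          using M(2) V(1) j unfolding other_def zs h by simp
        moreover have "q ?z = other ?z" using False ne(1) unfolding q_def zs by simp
        ultimately show ?thesis using False snoc by simp
      qed
    qed
  qed
  moreover have "q (state_code (Some \<sigma>)) = (if flow_accepts (j, a) x \<sigma> then 1 else 0)"
    if "valid_state (Some \<sigma>)" for \<sigma>
  proof (cases \<sigma>)
    case (fields F' i' u')
    show ?thesis using main[of F' i' u'] that unfolding fields by (simp only:)
  qed
  ultimately show ?thesis by blast
qed

end
end
end
end

context graph_product_stackings begin

lemma inj_on_map_embed: "inj_on (map embed) (lists letters)"
proof (rule inj_on_mapI, rule inj_on_subset[OF inj_on_embed])
  show "\<Union> (set ` lists letters) \<subseteq> letters" by (rule UN_least) (simp add: lists_eq_set)
qed

lemma decidable_product_slice: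
  assumes c: "\<And>i. i \<in> I \<Longrightarrow> inj_on (c i) (A i)"
    and nfs: "\<And>i. i \<in> I \<Longrightarrow> decidable_language (c i) (A i) (vertex_nfs i)"
    and slice: "decidable_language (c j) (A j) (y j ` {g \<in> carrier (G j). map (Pair j) (\<phi> j g a) = x})"
    and j: "j \<in> I" and a: "a \<in> A j" and x: "x \<in> lists letters"
  shows "decidable_language (product_letter_code c) product_gens
    (stacking_slice H product_nf product_flow (\<iota> j a) (map embed x))"
proof -
  let ?R = "{w \<in> lists letters. \<exists>\<sigma>. read_word w = Some \<sigma> \<and> flow_accepts (j, a) x \<sigma>}"
  obtain f where f: "computable f"
    "\<forall>w\<in>lists letters. f (list_encode (map (letter_code c) w)) = state_code c (read_word w)"
    using computable_read_word[OF c nfs] by blast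
  obtain q where q: "computable q" "\<forall>\<sigma>. valid_state (Some \<sigma>) \<longrightarrow>
      q (state_code c (Some \<sigma>)) = (if flow_accepts (j, a) x \<sigma> then 1 else 0)"
    using computable_flow_accepts[OF c nfs slice j] by blast
  let ?p = "\<lambda>n. if f n = 0 then 0 else q (f n)"
  have "computable ?p"
    by (intro computable_if_0 f(1) computable_const computable_comp[OF q(1) f(1)])
  moreover have "?p (word_code (product_letter_code c) v) =
      (if v \<in> stacking_slice H product_nf product_flow (\<iota> j a) (map embed x) then 1 else 0)"
    if v: "v \<in> lists product_gens" for v
  proof -
    obtain w where w: "w \<in> lists letters" "v = map embed w" using product_gens_words[OF v] by blast
    have mem: "v \<in> map embed ` ?R \<longleftrightarrow> w \<in> ?R"
      unfolding w(2) by (rule inj_on_image_mem_iff[OF inj_on_map_embed w(1)]) (rule Collect_restrict)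
    have code: "word_code (product_letter_code c) v = list_encode (map (letter_code c) w)"
      unfolding w(2) using word_code_embed[OF c w(1)] .
    have "?p (list_encode (map (letter_code c) w)) = (if w \<in> ?R then 1 else 0)"
    proof (cases "read_word w")
      case None
      then show ?thesis using bspec[OF f(2) w(1)] by (simp add: state_code.simps(1)[OF c])
    next
      case (Some \<sigma>)
      have "valid_state (Some \<sigma>)" using valid_read_word[OF w(1)] Some by simp
      then have acc: "q (state_code c (Some \<sigma>)) = (if flow_accepts (j, a) x \<sigma> then 1 else 0)" using q(2) by blast
      have fw: "f (list_encode (map (letter_code c) w)) = state_code c (Some \<sigma>)"
        using bspec[OF f(2) w(1)] Some by simp
      have "state_code c (Some \<sigma>) \<noteq> 0" by (cases \<sigma>) (simp add: state_code.simps(2)[OF c])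
      then have "?p (list_encode (map (letter_code c) w)) = q (state_code c (Some \<sigma>))"
        unfolding fw by (rule if_not_P)
      moreover have "w \<in> ?R \<longleftrightarrow> flow_accepts (j, a) x \<sigma>"
        using Some w(1) by (simp del: split_paired_Ex flow_accepts.simps)
      ultimately show ?thesis using acc by (simp only:)
    qed
    then show ?thesis unfolding product_slice[OF j a x] code mem .
  qed
  ultimately show ?thesis unfolding decidable_language_def by blast
qed

theorem decidable_tuples_product:
  assumes dec: "\<And>i. i \<in> I \<Longrightarrow> decidable_tuples 3 (A i) (stacking_language (G i) (A i) (y i) (\<phi> i))"
  shows "decidable_tuples 3 product_gens (stacking_language H product_gens product_nf product_flow)"
proof -
  have "\<forall>i\<in>I. \<exists>c. inj_on c (A i) \<and>
      (\<forall>a\<in>A i. \<forall>x\<in>lists (A i). decidable_language c (A i) (stacking_slice (G i) (y i) (\<phi> i) a x)) \<and>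
      decidable_language c (A i) (vertex_nfs i)"
  proof
    fix i assume i: "i \<in> I"
    show "\<exists>c. inj_on c (A i) \<and>
      (\<forall>a\<in>A i. \<forall>x\<in>lists (A i). decidable_language c (A i) (stacking_slice (G i) (y i) (\<phi> i) a x)) \<and>
      decidable_language c (A i) (vertex_nfs i)"
      unfolding vertex_nfs_def
    proof (rule generated_group.decidable_slices[OF gens[OF i] stackings[OF i] dec[OF i]])
      fix c assume "inj_on c (A i)" "decidable_language c (A i) (y i ` carrier (G i))"
        "\<And>a x. a \<in> A i \<Longrightarrow> x \<in> lists (A i) \<Longrightarrow> decidable_language c (A i) (stacking_slice (G i) (y i) (\<phi> i) a x)"
      then show "\<exists>c. inj_on c (A i) \<and>
          (\<forall>a\<in>A i. \<forall>x\<in>lists (A i). decidable_language c (A i) (stacking_slice (G i) (y i) (\<phi> i) a x)) \<and>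
          decidable_language c (A i) (y i ` carrier (G i))"
        by (intro exI[of _ c] conjI ballI)
    qed
  qed
  then obtain c where c: "\<forall>i\<in>I. inj_on (c i) (A i) \<and>
      (\<forall>a\<in>A i. \<forall>x\<in>lists (A i). decidable_language (c i) (A i) (stacking_slice (G i) (y i) (\<phi> i) a x)) \<and>
      decidable_language (c i) (A i) (vertex_nfs i)"
    by (rule bchoice[THEN exE])
  have inj: "\<And>i. i \<in> I \<Longrightarrow> inj_on (c i) (A i)" and nfs: "\<And>i. i \<in> I \<Longrightarrow> decidable_language (c i) (A i) (vertex_nfs i)"
    using c by simp_all
  show ?thesis
  proof (rule generated_group.decidable_tuples_if_slices[OF generated_group_product stacking_product
        inj_on_product_letter_code[OF inj]])
    fix b v assume gen: "b \<in> product_gens" and v: "v \<in> lists product_gens"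
    obtain j a where j: "j \<in> I" and a: "a \<in> A j" and b: "b = \<iota> j a" using product_gensE[OF gen] .
    obtain x where x: "x \<in> lists letters" "v = map embed x" using product_gens_words[OF v] by blast
    have slice: "decidable_language (c j) (A j) (y j ` {g \<in> carrier (G j). map (Pair j) (\<phi> j g a) = x})"
    proof (cases "x = map (Pair j) (map snd x)")
      case True
      have "decidable_language (c j) (A j) (stacking_slice (G j) (y j) (\<phi> j) a (map snd x))"
        using c j a map_snd_in_lists[OF j x(1) True] by blast
      then show ?thesis unfolding flow_accepts_slice by (subst if_P[OF True])
    next
      case False
      then show ?thesis unfolding flow_accepts_slice using decidable_language_UN[of "{}"] by simp
    qed
    show "decidable_language (product_letter_code c) product_gens (stacking_slice H product_nf product_flow b v)"
      unfolding b x(2) by (rule decidable_product_slice[OF inj nfs slice j a x(1)])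
  qed
qed

lemma product_gens_eq: "product_gens = (\<Union>i\<in>I. \<iota> i ` A i)"
  unfolding product_gens_def letters_def embed_def by auto

lemma product_summary:
  "generated_group H (\<Union>i\<in>I. \<iota> i ` A i) \<and>
   (\<exists>Y \<Phi>. stacking H (\<Union>i\<in>I. \<iota> i ` A i) Y \<Phi> \<and>
    ((\<forall>i\<in>I. synchronously_regular 3 (A i) (stacking_language (G i) (A i) (y i) (\<phi> i))) \<longrightarrow>
      synchronously_regular 3 (\<Union>i\<in>I. \<iota> i ` A i) (stacking_language H (\<Union>i\<in>I. \<iota> i ` A i) Y \<Phi>)) \<and>
    ((\<forall>i\<in>I. decidable_tuples 3 (A i) (stacking_language (G i) (A i) (y i) (\<phi> i))) \<longrightarrow>
      decidable_tuples 3 (\<Union>i\<in>I. \<iota> i ` A i) (stacking_language H (\<Union>i\<in>I. \<iota> i ` A i) Y \<Phi>)))"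
  unfolding product_gens_eq[symmetric]
  by (intro conjI exI[of _ product_nf] exI[of _ product_flow] impI generated_group_product
      stacking_product synchronously_regular_product decidable_tuples_product) simp_all

end

section \<open>Closure under graph products\<close>

theorem theorem3p2:
  fixes n :: nat
    and G :: "nat \<Rightarrow> ('a, 'm) monoid_scheme"
    and A :: "nat \<Rightarrow> 'a set"
    and E :: "nat set set"
  assumes "n \<ge> 1"
    and "\<And>i. i \<in> {1..n} \<Longrightarrow> generated_group (G i) (A i)"
    and simplicial: "\<And>e. e \<in> E \<Longrightarrow> e \<subseteq> {1..n} \<and> card e = 2"
  defines "GL \<equiv> graph_product {1..n} E G"
    and "AL \<equiv> (\<Union>i\<in>{1..n}. graph_product_incl {1..n} E G i ` A i)"
  shows "((\<forall>i\<in>{1..n}. autostackable (G i) (A i)) \<longrightarrow> autostackable GL AL) \<and>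
    ((\<forall>i\<in>{1..n}. stackable (G i) (A i)) \<longrightarrow> stackable GL AL) \<and>
    ((\<forall>i\<in>{1..n}. algorithmically_stackable (G i) (A i)) \<longrightarrow> algorithmically_stackable GL AL)"
proof -
  have graph: "graph_of_groups {1..n} E G"
  proof (rule graph_of_groups.intro)
    show "group (G i)" if "i \<in> {1..n}" for i
      using assms(2)[OF that] by (simp add: generated_group_def)
  qed (rule simplicial)
  have product: "graph_product_stackings {1..n} E G GL (graph_product_incl {1..n} E G) (graph_of_groups.nf {1..n} E G) A y \<phi>"
    if "\<forall>i\<in>{1..n}. stacking (G i) (A i) (y i) (\<phi> i)" for y \<phi>
    unfolding GL_def
    by (intro graph_product_stackings.intro graph_product_stackings_axioms.intro
        graph_of_groups.graph_product_nf[OF graph] finite_atLeastAtMost assms(2) bspec[OF that])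
  note summary = graph_product_stackings.product_summary[OF product, folded AL_def]
  show ?thesis
  proof (intro conjI impI)
    assume "\<forall>i\<in>{1..n}. autostackable (G i) (A i)"
    then have "\<forall>i\<in>{1..n}. \<exists>y \<phi>. stacking (G i) (A i) y \<phi> \<and>
        synchronously_regular 3 (A i) (stacking_language (G i) (A i) y \<phi>)"
      unfolding autostackable_iff by blast
    then obtain y \<phi> where "\<forall>i\<in>{1..n}. stacking (G i) (A i) (y i) (\<phi> i) \<and>
        synchronously_regular 3 (A i) (stacking_language (G i) (A i) (y i) (\<phi> i))" by metis
    then show "autostackable GL AL" unfolding autostackable_iff using summary[of y \<phi>] by blast
  next
    assume "\<forall>i\<in>{1..n}. stackable (G i) (A i)"
    then have "\<forall>i\<in>{1..n}. \<exists>y \<phi>. stacking (G i) (A i) y \<phi>" unfolding stackable_iff by blast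
    then obtain y \<phi> where "\<forall>i\<in>{1..n}. stacking (G i) (A i) (y i) (\<phi> i)" by metis
    then show "stackable GL AL" unfolding stackable_iff using summary[of y \<phi>] by blast
  next
    assume "\<forall>i\<in>{1..n}. algorithmically_stackable (G i) (A i)"
    then have "\<forall>i\<in>{1..n}. \<exists>y \<phi>. stacking (G i) (A i) y \<phi> \<and>
        decidable_tuples 3 (A i) (stacking_language (G i) (A i) y \<phi>)"
      unfolding algorithmically_stackable_iff by blast
    then obtain y \<phi> where "\<forall>i\<in>{1..n}. stacking (G i) (A i) (y i) (\<phi> i) \<and>
        decidable_tuples 3 (A i) (stacking_language (G i) (A i) (y i) (\<phi> i))" by metis
    then show "algorithmically_stackable GL AL"
      unfolding algorithmically_stackable_iff using summary[of y \<phi>] by blast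
  qed
qed

end
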